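(* Let $G$ be one of $\mathrm{GO}_{2m+1}(3)$ with $m\ge3$, $\mathrm{GO}^\pm_{2m}(3)$ with $m\ge4$, or $\mathrm{Sp}_{2m}(3)$ with $m\ge3$, let $G'$ be the derived subgroup of $G$, and let $H$ be a group with $G'\le H\le G$. Then neither $H$ nor $H/Z(H)$ has a Steinberg-like character for $p=2$.
   Context: A character $\chi$ of a finite group $X$ is Steinberg-like for $p=2$ if $\chi(g)=0$ for all $g\in X$ of even order and $\chi(1)=|X|_2$, the $2$-part of $|X|$. *)

theory Defs
  imports "HOL-Algebra.Algebra" "HOL-Library.Numeral_Type" "Jordan_Normal_Form.Matrix"
    "HOL-Computational_Algebra.Primes"
begin

text \<open>Matrix groups over GF(3); the field GF(3) is the numeral type 3 (integers mod 3).\<close>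

definition isom_group :: "nat \<Rightarrow> 3 mat \<Rightarrow> 3 mat monoid" where
  "isom_group n S = \<lparr> carrier = {A \<in> carrier_mat n n. invertible_mat A \<and> transpose_mat A * S * A = S},
                       monoid.mult = (\<lambda>A B. A * B), one = 1\<^sub>m n \<rparr>"

definition hyp :: "nat \<Rightarrow> nat \<Rightarrow> nat \<Rightarrow> 3" where
  "hyp k i j = (if (i < k \<and> j = i + k) \<or> (j < k \<and> i = j + k) then 1 else 0)"

definition GO_odd :: "nat \<Rightarrow> 3 mat monoid" where
  "GO_odd m = isom_group (2*m+1)
     (mat (2*m+1) (2*m+1) (\<lambda>(i,j). if i = 2*m \<and> j = 2*m then 1 else hyp m i j))"

definition GO_plus :: "nat \<Rightarrow> 3 mat monoid" where
  "GO_plus m = isom_group (2*m) (mat (2*m) (2*m) (\<lambda>(i,j). hyp m i j))"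

text \<open>GO^-_{2m}(3): hyperbolic form on 2m-2 coordinates plus the anisotropic form
  x^2 + y^2 (anisotropic over GF(3)), i.e. Witt index m-1.\<close>
definition GO_minus :: "nat \<Rightarrow> 3 mat monoid" where
  "GO_minus m = isom_group (2*m)
     (mat (2*m) (2*m) (\<lambda>(i,j). if 2*m-2 \<le> i \<and> i = j then 1 else hyp (m-1) i j))"

definition Sp :: "nat \<Rightarrow> 3 mat monoid" where
  "Sp m = isom_group (2*m)
     (mat (2*m) (2*m) (\<lambda>(i,j). if i < m \<and> j = i + m then 1
                               else if j < m \<and> i = j + m then -1 else 0))"

definition GL_cx :: "nat \<Rightarrow> complex mat monoid" where
  "GL_cx n = \<lparr> carrier = {A \<in> carrier_mat n n. invertible_mat A}, monoid.mult = (\<lambda>A B. A * B), one = 1\<^sub>m n \<rparr>"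

definition mat_trace :: "'a::comm_ring_1 mat \<Rightarrow> 'a" where
  "mat_trace A = (\<Sum>i<dim_row A. A $$ (i,i))"

definition is_character :: "('a, 'b) monoid_scheme \<Rightarrow> ('a \<Rightarrow> complex) \<Rightarrow> bool" where
  "is_character Gp chi \<longleftrightarrow>
     (\<exists>n rho. n > 0 \<and> rho \<in> hom Gp (GL_cx n) \<and> (\<forall>g \<in> carrier Gp. chi g = mat_trace (rho g)))"

definition steinberg_like_2 :: "('a, 'b) monoid_scheme \<Rightarrow> ('a \<Rightarrow> complex) \<Rightarrow> bool" where
  "steinberg_like_2 Gp chi \<longleftrightarrow> is_character Gp chi
     \<and> (\<forall>g \<in> carrier Gp. even (group.ord Gp g) \<longrightarrow> chi g = 0)
     \<and> chi (one Gp) = of_nat (2 ^ multiplicity (2::nat) (order Gp))"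

definition center :: "('a, 'b) monoid_scheme \<Rightarrow> 'a set" where
  "center Gp = {z \<in> carrier Gp. \<forall>x \<in> carrier Gp. monoid.mult Gp x z = monoid.mult Gp z x}"

end

theory Submission
  imports Defs "Jordan_Normal_Form.Schur_Decomposition" "HOL-Library.Function_Algebras"
begin

text \<open>
  Let \<open>X\<close> be \<open>H\<close> or \<open>H/Z(H)\<close>, let \<open>\<rho>\<close> afford a Steinberg-like character \<open>\<chi>\<close> of \<open>X\<close> and let \<open>t\<close> be a long root
  element, of order 3: a transvection in the symplectic case, a Siegel element of a totally
  singular plane in the orthogonal case. The centralizer of \<open>t\<close> contains a Heisenberg group with
  center generated by \<open>t\<close>. Let \<open>\<omega>\<close> be a nontrivial cube root of unity and \<open>d\<close> the dimension of the
  \<open>\<omega>\<close>-eigenspace of \<open>\<rho>(t)\<close>. If \<open>A\<close> is an abelian subgroup of the Heisenberg group, with \<open>3^r\<close>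
  elements, all of whose nontrivial elements \<open>a\<close> are conjugate to \<open>at\<close> in the centralizer of \<open>t\<close>,
  then nontrivial elements of \<open>A\<close> have trace 0 on the eigenspace, so \<open>3^r\<close> divides \<open>d\<close>. If \<open>s\<close>
  is a nontrivial 2-element commuting with \<open>t\<close>, then the products \<open>s t^j\<close> have even order and hence \<open>s\<close> has
  trace 0 there too, so the 2-part of the order of the centralizer divides \<open>d\<close>. As \<open>d \<le> \<chi>(1)\<close>, which is the
  2-part of \<open>|X|\<close>, we get \<open>d = 0\<close> as soon as \<open>3^r\<close> exceeds the 2-part of the size of the class of
  \<open>t\<close>. This holds in all cases of the theorem. Hence \<open>\<rho>(t) = 1\<close>, and then \<open>\<rho>(w) = 1\<close> for a
  noncentral 2-element \<open>w\<close> in the \<open>SL_2(3)\<close> generated by \<open>t\<close> and an opposite root element,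
  although \<open>\<chi>(w) = 0\<close>.
\<close>

section \<open>Traces of averaged representations\<close>

text \<open>Divisibility comes from ranks being integers. If a finite group Q commutes with t, the
  average of z^j \<rho>(q t^j) is idempotent, so its trace is a natural number; when only q = 1
  contributes to that trace, |Q| divides the dimension of an eigenspace of t. For Q = A the other
  terms vanish because a and \<open>a t\<close> have equal traces on a space where t is a scalar.
  For a Sylow 2-subgroup of the centralizer the terms outside Z vanish by the Steinberg-like
  condition. The two divisors are coprime and hence multiply.

  The final inequality sets a linear function against an exponential one: the 2-part of the number
  of long root elements is at most 4m (symplectic) or 8m (orthogonal), while r is m - 1 in the
  symplectic case and n - 4 in the orthogonal one, n being the dimension. The bounds on m are where
  the inequality begins to hold: Sp_4(3) has 40 transvections and 8 > 3; the 2-part is 16 against 3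
  for GO_5(3), and 16 against 9 for both GO_6^+(3) and GO_6^-(3).\<close>

lemma mat_trace_mult_commute:
  fixes A B :: "'a::comm_ring_1 mat"
  assumes "A \<in> carrier_mat n n" "B \<in> carrier_mat n n"
  shows "mat_trace (A * B) = mat_trace (B * A)"
proof -
  have "mat_trace (A * B) = (\<Sum>i<n. \<Sum>k<n. A $$ (i,k) * B $$ (k,i))"
    using assms by (auto simp: mat_trace_def scalar_prod_def atLeast0LessThan intro!: sum.cong)
  also have "\<dots> = (\<Sum>k<n. \<Sum>i<n. B $$ (k,i) * A $$ (i,k))"
    by (subst sum.swap) (simp add: mult.commute)
  also have "\<dots> = mat_trace (B * A)"
    using assms by (auto simp: mat_trace_def scalar_prod_def atLeast0LessThan intro!: sum.cong)
  finally show ?thesis .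
qed

lemma mat_trace_similar:
  fixes A B :: "'a::comm_ring_1 mat"
  assumes "A \<in> carrier_mat n n" "similar_mat A B"
  shows "mat_trace A = mat_trace B"
proof -
  from assms(2) obtain P Q where "similar_mat_wit A B P Q" by (auto simp: similar_mat_def)
  note w = similar_mat_witD2[OF assms(1) this]
  have "mat_trace A = mat_trace (P * (B * Q))" using w by (simp add: assoc_mult_mat[of P n n B n Q n])
  also have "\<dots> = mat_trace ((B * Q) * P)" by (rule mat_trace_mult_commute) (use w in auto)
  also have "\<dots> = mat_trace B" using w by (simp add: assoc_mult_mat[of B n n Q n P n])
  finally show ?thesis .
qed

text \<open>The diagonal of a triangular idempotent consists of zeros and ones, so after Schur
  triangularization the trace counts the ones. If there are none, the matrix is strictly triangular,
  hence nilpotent, and a nilpotent idempotent is 0.\<close>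

lemma idempotent_trace:
  fixes E :: "complex mat"
  assumes E: "E \<in> carrier_mat n n" and idem: "E * E = E"
  obtains k where "mat_trace E = of_nat k" "k = 0 \<Longrightarrow> E = 0\<^sub>m n n"
proof -
  obtain es where "char_poly E = (\<Prod>a\<leftarrow>es. [:- a, 1:])" using char_poly_factorized[OF E] by blast
  from schur_decomposition_exists[OF E this] obtain B where
    B: "B \<in> carrier_mat n n" "upper_triangular B" "similar_mat E B" by blast
  from B(3) obtain P Q where wit: "similar_mat_wit E B P Q" by (auto simp: similar_mat_def)
  note w = similar_mat_witD2[OF E wit]
  have BQ: "B = Q * E * P"
    using similar_mat_witD2(3)[OF B(1) similar_mat_wit_sym[OF wit]] .
  have "B * B = Q * E * (P * Q) * E * P"
    unfolding BQ using w E by (simp add: assoc_mult_mat[of _ n n _ n _ n])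
  also have "\<dots> = Q * (E * E) * P" using w E by (simp add: assoc_mult_mat[of _ n n _ n _ n])
  finally have BB: "B * B = B" using idem BQ by simp
  have ent: "B $$ (i,j) = (\<Sum>k<n. B $$ (i,k) * B $$ (k,j))" if "i < n" "j < n" for i j
    using arg_cong[OF BB, of "\<lambda>M. M $$ (i,j)"] that B
    by (simp add: scalar_prod_def atLeast0LessThan)
  have low: "B $$ (i,j) = 0" if "j < i" "i < n" for i j
    using B(1,2) that by (auto simp: upper_triangular_def)
  have diag: "B $$ (i,i) = 0 \<or> B $$ (i,i) = 1" if i: "i < n" for i
  proof -
    have "B $$ (i,i) = (\<Sum>k<n. if k = i then B $$ (i,i) * B $$ (i,i) else 0)"
      by (subst ent[OF i i]) (rule sum.cong, use low i in \<open>auto, metis linorder_cases\<close>)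
    also have "\<dots> = B $$ (i,i) * B $$ (i,i)" using i by simp
    finally show ?thesis by (metis mult_cancel_left2 mult_eq_0_iff)
  qed
  define k where "k = card {i. i < n \<and> B $$ (i,i) = 1}"
  have "mat_trace E = (\<Sum>i<n. B $$ (i,i))"
    using mat_trace_similar[OF E B(3)] B(1) by (simp add: mat_trace_def)
  also have "\<dots> = (\<Sum>i<n. if B $$ (i,i) = 1 then 1 else 0)"
    by (rule sum.cong) (use diag in auto)
  also have "\<dots> = of_nat k" by (simp add: sum.If_cases k_def Collect_conj_eq lessThan_def)
  finally have tr: "mat_trace E = of_nat k" .
  have "E = 0\<^sub>m n n" if "k = 0"
  proof -
    have d0: "B $$ (i,i) = 0" if "i < n" for i
      using diag[OF that] \<open>k = 0\<close> that by (auto simp: k_def)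
    \<comment> \<open>Strong induction on the distance d from the diagonal: in the sum for
      \<open>(B * B) $$ (i, i + d)\<close> every product has a factor on or below the diagonal, or a
      factor at a smaller distance above it.\<close>
    have "i < n \<longrightarrow> i + d < n \<longrightarrow> B $$ (i, i + d) = 0" for i d
    proof (induction d arbitrary: i rule: less_induct)
      case (less d)
      show ?case
      proof (intro impI)
        assume id: "i < n" "i + d < n"
        have "B $$ (i,k) * B $$ (k,i+d) = 0" if "k < n" for k
        proof -
          consider "k < i" | "k = i" | "i < k" "k < i + d" | "k = i + d" | "i + d < k" by linarith
          then show ?thesis
          proof cases
            case 3
            then have "B $$ (i, i + (k - i)) = 0" using less.IH[of "k - i" i] id that by auto
            then show ?thesis using 3 by simp
          qed (use d0 low id that in auto)
        qed
        then have "(\<Sum>k<n. B $$ (i,k) * B $$ (k,i+d)) = 0" by (intro sum.neutral) blast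
        then show "B $$ (i, i + d) = 0" using ent[OF id] by simp
      qed
    qed
    then have "B $$ (i,j) = 0" if "i < n" "j < n" for i j
      using that low[of j i] by (metis le_add_diff_inverse not_le)
    then have "B = 0\<^sub>m n n" using B(1) by auto
    then show ?thesis using w by simp
  qed
  with tr show thesis by (rule that)
qed

text \<open>Left translations permute K, so the average of \<tau> is idempotent and its trace is a
  rank. The product \<open>m\<close> on the index set is a parameter because the index set will
  consist of pairs (q, j).\<close>

lemma average_trace:
  fixes \<tau> :: "'k \<Rightarrow> complex mat"
  assumes fin: "finite K" "K \<noteq> {}"
    and carr: "\<And>x. x \<in> K \<Longrightarrow> \<tau> x \<in> carrier_mat N N"
    and mult: "\<And>x y. x \<in> K \<Longrightarrow> y \<in> K \<Longrightarrow> \<tau> x * \<tau> y = \<tau> (m x y)"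
    and bij: "\<And>x. x \<in> K \<Longrightarrow> bij_betw (m x) K K"
  obtains k where "(\<Sum>x\<in>K. mat_trace (\<tau> x)) = of_nat (card K * k)"
    "\<And>i j. k = 0 \<Longrightarrow> i < N \<Longrightarrow> j < N \<Longrightarrow> (\<Sum>x\<in>K. \<tau> x $$ (i,j)) = 0"
proof -
  define c where "c = (of_nat (card K) :: complex)"
  have c: "c \<noteq> 0" using fin by (simp add: c_def)
  define E where "E = mat N N (\<lambda>(i,j). (\<Sum>x\<in>K. \<tau> x $$ (i,j)) / c)"
  have E: "E \<in> carrier_mat N N" by (simp add: E_def)
  have "E * E = E"
  proof (rule eq_matI)
    fix i j assume "i < dim_row E" "j < dim_col E"
    then have ij: "i < N" "j < N" using E by auto
    have "(E * E) $$ (i,j) = (\<Sum>k<N. (\<Sum>x\<in>K. \<tau> x $$ (i,k)) / c * ((\<Sum>y\<in>K. \<tau> y $$ (k,j)) / c))"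
      using ij E by (simp add: scalar_prod_def atLeast0LessThan) (simp add: E_def)
    also have "\<dots> = (\<Sum>k<N. \<Sum>x\<in>K. \<Sum>y\<in>K. \<tau> x $$ (i,k) * \<tau> y $$ (k,j)) / (c * c)"
      by (simp add: sum_product sum_divide_distrib)
    also have "(\<Sum>k<N. \<Sum>x\<in>K. \<Sum>y\<in>K. \<tau> x $$ (i,k) * \<tau> y $$ (k,j))
        = (\<Sum>x\<in>K. \<Sum>y\<in>K. \<Sum>k<N. \<tau> x $$ (i,k) * \<tau> y $$ (k,j))"
      by (subst sum.swap, rule sum.cong[OF refl], rule sum.swap)
    also have "\<dots> = (\<Sum>x\<in>K. \<Sum>y\<in>K. \<tau> (m x y) $$ (i,j))"
    proof (intro sum.cong refl)
      fix x y assume xy: "x \<in> K" "y \<in> K"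
      have "(\<Sum>k<N. \<tau> x $$ (i,k) * \<tau> y $$ (k,j)) = (\<tau> x * \<tau> y) $$ (i,j)"
        using carr[OF xy(1)] carr[OF xy(2)] ij by (simp add: scalar_prod_def atLeast0LessThan)
      then show "(\<Sum>k<N. \<tau> x $$ (i,k) * \<tau> y $$ (k,j)) = \<tau> (m x y) $$ (i,j)" using mult[OF xy] by simp
    qed
    also have "\<dots> = (\<Sum>x\<in>K. \<Sum>y\<in>K. \<tau> y $$ (i,j))"
      by (intro sum.cong refl sum.reindex_bij_betw[OF bij])
    also have "\<dots> / (c * c) = E $$ (i,j)" using ij c by (simp add: E_def c_def)
    finally show "(E * E) $$ (i,j) = E $$ (i,j)" .
  qed (use E in auto)
  from idempotent_trace[OF E this] obtain k where
    k: "mat_trace E = of_nat k" "k = 0 \<Longrightarrow> E = 0\<^sub>m N N" by blast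
  have "mat_trace E = (\<Sum>i<N. \<Sum>x\<in>K. \<tau> x $$ (i,i)) / c"
    using E by (simp add: mat_trace_def sum_divide_distrib) (simp add: E_def sum_divide_distrib)
  also have "(\<Sum>i<N. \<Sum>x\<in>K. \<tau> x $$ (i,i)) = (\<Sum>x\<in>K. mat_trace (\<tau> x))"
    by (subst sum.swap) (use carr in \<open>auto simp: mat_trace_def intro!: sum.cong\<close>)
  finally have "(\<Sum>x\<in>K. mat_trace (\<tau> x)) = of_nat (card K * k)"
    using k(1) c by (simp add: c_def field_simps)
  moreover have "(\<Sum>x\<in>K. \<tau> x $$ (i,j)) = 0" if "k = 0" "i < N" "j < N" for i j
    using arg_cong[OF k(2)[OF that(1)], of "\<lambda>M. M $$ (i,j)"] that c by (simp add: E_def)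
  ultimately show thesis by (rule that)
qed

section \<open>Representations of a finite group and projections onto eigenspaces\<close>

locale finite_rep = group K for K (structure) +
  fixes \<rho> N
  assumes fin: "finite (carrier K)" and hom: "\<rho> \<in> hom K (GL_cx N)"
begin

abbreviation chi where "chi g \<equiv> mat_trace (\<rho> g)"

lemma rho_carrier [simp]: "g \<in> carrier K \<Longrightarrow> \<rho> g \<in> carrier_mat N N"
  using hom by (auto simp: hom_def GL_cx_def)

lemma rho_mult: "g \<in> carrier K \<Longrightarrow> h \<in> carrier K \<Longrightarrow> \<rho> (g \<otimes> h) = \<rho> g * \<rho> h"
  using hom by (auto simp: hom_def GL_cx_def)

text \<open>An invertible idempotent is the identity, so multiplicativity alone determines the value
  at \<open>\<one>\<close>.\<close>

lemma rho_one: "\<rho> \<one> = 1\<^sub>m N"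
proof -
  have "invertible_mat (\<rho> \<one>)" using hom by (auto simp: hom_def GL_cx_def)
  then obtain B where B: "inverts_mat (\<rho> \<one>) B" "inverts_mat B (\<rho> \<one>)" by (auto simp: invertible_mat_def)
  have B': "B * \<rho> \<one> = 1\<^sub>m (dim_row B)" using B by (simp add: inverts_mat_def)
  from arg_cong[OF this, of dim_col] have "dim_row B = N"
    using carrier_matD(2)[OF rho_carrier[of \<one>]] by simp
  moreover have "dim_col B = N"
    using B(1) rho_carrier[of \<one>] by (metis inverts_mat_def carrier_matD index_mult_mat(3) index_one_mat(3) one_closed)
  ultimately have Bc: "B \<in> carrier_mat N N" by auto
  have "\<rho> \<one> * \<rho> \<one> = \<rho> \<one>" using rho_mult[of \<one> \<one>] by simp
  then have "B * (\<rho> \<one> * \<rho> \<one>) = B * \<rho> \<one>" by simp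
  then have "(B * \<rho> \<one>) * \<rho> \<one> = B * \<rho> \<one>" using Bc by (simp add: assoc_mult_mat[of B N N _ N _ N])
  then show ?thesis using B' Bc carrier_matD[OF Bc] left_mult_one_mat[OF rho_carrier[OF one_closed]] by simp
qed

lemma chi_one: "chi \<one> = of_nat N"
  by (simp add: rho_one mat_trace_def)

lemma chi_conj:
  assumes "a \<in> carrier K" "c \<in> carrier K" "b \<in> carrier K" "b \<otimes> a = c \<otimes> b"
  shows "chi a = chi c"
proof -
  have "chi a = chi (inv b \<otimes> (c \<otimes> b))" using assms by (metis inv_solve_left m_closed)
  also have "\<dots> = chi (c \<otimes> b \<otimes> inv b)"
    using assms mat_trace_mult_commute[of "\<rho> (inv b)" N "\<rho> (c \<otimes> b)"]
    by (simp add: rho_mult[of "inv b" "c \<otimes> b"] rho_mult[of "c \<otimes> b" "inv b"])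
  also have "\<dots> = chi c" using assms by (simp add: m_assoc)
  finally show ?thesis .
qed

text \<open>The average of z^j \<rho>(q t^j) projects onto the vectors that are fixed by Q and on
  which t acts as the inverse of z; k is the dimension of that space. Indexing by pairs (q, j) makes
  coincidences among the elements q t^j harmless.\<close>

lemma eigenspace_average:
  assumes Q: "subgroup Q K" and t: "t \<in> carrier K" "t [^] (3::nat) = \<one>"
    and comm: "\<And>q. q \<in> Q \<Longrightarrow> q \<otimes> t = t \<otimes> q" and z: "z ^ 3 = (1::complex)"
  obtains k where "(\<Sum>q\<in>Q. \<Sum>j<3. z ^ j * chi (q \<otimes> t [^] j)) = of_nat (3 * card Q * k)"
    "\<And>i l. k = 0 \<Longrightarrow> i < N \<Longrightarrow> l < N \<Longrightarrow> (\<Sum>q\<in>Q. \<Sum>j<3. z ^ j * \<rho> (q \<otimes> t [^] j) $$ (i,l)) = 0"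
proof -
  note Qs = subgroup.subset[OF Q]
  have QK: "q \<in> carrier K" if "q \<in> Q" for q using Qs that by blast
  have finQ: "finite Q" using Qs fin finite_subset by blast
  define \<tau> where "\<tau> = (\<lambda>(q,j). z ^ j \<cdot>\<^sub>m \<rho> (q \<otimes> t [^] j))"
  define m where "m = (\<lambda>(q,j) (q',j'). (q \<otimes> q', (j + j') mod (3::nat)))"
  let ?K = "Q \<times> {..<3::nat}"
  have pow_mod: "t [^] (n mod 3) = t [^] n" for n :: nat
  proof -
    have "t [^] n = t [^] (3 * (n div 3) + n mod 3)" by simp
    also have "\<dots> = t [^] (n mod 3)" using t by (simp only: nat_pow_mult[symmetric] nat_pow_pow[symmetric]) simp
    finally show ?thesis by simp
  qed
  have z_mod: "z ^ (n mod 3) = z ^ n" for n :: nat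
  proof -
    have "z ^ n = z ^ (3 * (n div 3) + n mod 3)" by simp
    also have "\<dots> = z ^ (n mod 3)" using z by (simp only: power_add power_mult) simp
    finally show ?thesis by simp
  qed
  have comm': "t [^] j \<otimes> q = q \<otimes> t [^] j" if q: "q \<in> Q" for q and j :: nat
    using pow_mult_distrib comm[OF q] QK[OF q] t by (induction j) (simp_all add: m_assoc, metis m_assoc nat_pow_closed)
  have trace_smult: "mat_trace (c \<cdot>\<^sub>m M) = c * mat_trace M" if "M \<in> carrier_mat N N" for c :: complex and M
    using that by (auto simp: mat_trace_def sum_distrib_left intro!: sum.cong)
  have smult2: "c \<cdot>\<^sub>m (d \<cdot>\<^sub>m M) = (c * d) \<cdot>\<^sub>m M" for c d :: complex and M
    by (intro eq_matI) (auto simp: mult.assoc)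
  obtain k where k: "(\<Sum>x\<in>?K. mat_trace (\<tau> x)) = of_nat (card ?K * k)"
    "\<And>i l. k = 0 \<Longrightarrow> i < N \<Longrightarrow> l < N \<Longrightarrow> (\<Sum>x\<in>?K. \<tau> x $$ (i,l)) = 0"
  proof (rule average_trace[of ?K \<tau> N m])
    show "finite ?K" "?K \<noteq> {}" using finQ subgroup.one_closed[OF Q] by (auto simp: lessThan_empty_iff)
    show "\<tau> x \<in> carrier_mat N N" if "x \<in> ?K" for x using that QK t by (auto simp: \<tau>_def)
    show "\<tau> x * \<tau> y = \<tau> (m x y)" if xy: "x \<in> ?K" "y \<in> ?K" for x y
    proof -
      obtain q j q' j' where e: "x = (q,j)" "y = (q',j')" "q \<in> Q" "q' \<in> Q" using xy by auto
      have "(q \<otimes> t [^] j) \<otimes> (q' \<otimes> t [^] j') = q \<otimes> (t [^] j \<otimes> q') \<otimes> t [^] j'"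
        using QK[OF e(3)] QK[OF e(4)] t by (simp add: m_assoc)
      also have "\<dots> = (q \<otimes> q') \<otimes> (t [^] j \<otimes> t [^] j')"
        unfolding comm'[OF e(4)] using QK[OF e(3)] QK[OF e(4)] t by (simp add: m_assoc)
      finally have *: "(q \<otimes> t [^] j) \<otimes> (q' \<otimes> t [^] j') = (q \<otimes> q') \<otimes> t [^] ((j + j') mod 3)"
        using t by (simp add: pow_mod nat_pow_mult)
      have "\<tau> x * \<tau> y = (z ^ j * z ^ j') \<cdot>\<^sub>m (\<rho> (q \<otimes> t [^] j) * \<rho> (q' \<otimes> t [^] j'))"
        using e QK t by (simp add: \<tau>_def mult_smult_assoc_mat[of _ N N _ N] mult_smult_distrib[of _ N N _ N] mult.commute smult2)
      also have "\<dots> = \<tau> (m x y)"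
        using e QK t * by (simp add: \<tau>_def m_def z_mod power_add flip: rho_mult)
      finally show ?thesis .
    qed
    show "bij_betw (m x) ?K ?K" if x: "x \<in> ?K" for x
    proof -
      obtain q j where e: "x = (q,j)" "q \<in> Q" "j < 3" using x by auto
      have "inj_on (m x) ?K"
      proof (rule inj_onI)
        fix y y' assume yy: "y \<in> ?K" "y' \<in> ?K" "m x y = m x y'"
        obtain a i a' i' where y: "y = (a,i)" "y' = (a',i')" by fastforce
        have "a = a'" using yy y e QK by (simp add: m_def)
        moreover have "(j + i) mod 3 = (j + i') mod 3" "i < 3" "i' < 3" using yy y e by (simp_all add: m_def)
        then have "i = i'" by presburger
        ultimately show "y = y'" using y by simp
      qed
      moreover have "m x ` ?K \<subseteq> ?K"
        using e subgroup.m_closed[OF Q] by (auto simp: m_def)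
      ultimately show ?thesis using finQ by (simp add: bij_betw_def endo_inj_surj)
    qed
  qed (rule that)
  have "(\<Sum>q\<in>Q. \<Sum>j<3. z ^ j * chi (q \<otimes> t [^] j)) = (\<Sum>x\<in>?K. mat_trace (\<tau> x))"
    unfolding sum.cartesian_product
    by (rule sum.cong) (use QK t in \<open>auto simp: \<tau>_def trace_smult\<close>)
  moreover have "(\<Sum>q\<in>Q. \<Sum>j<3. z ^ j * \<rho> (q \<otimes> t [^] j) $$ (i,l)) = (\<Sum>x\<in>?K. \<tau> x $$ (i,l))" if "i < N" "l < N" for i l
    unfolding sum.cartesian_product
    by (rule sum.cong) (use QK t that in \<open>auto simp: \<tau>_def\<close>, metis QK carrier_matD index_smult_mat(1) m_closed nat_pow_closed rho_carrier)
  ultimately show thesis using k by (intro that[of k]) (auto simp: mult.commute card_cartesian_product)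
qed

end

section \<open>The Heisenberg obstruction\<close>

lemma (in group) sylow_subgroup_of:
  assumes C: "subgroup C G" and p: "Factorial_Ring.prime p" and fin: "finite (carrier G)"
  obtains P where "subgroup P G" "P \<subseteq> C" "card P = p ^ multiplicity p (card C)"
proof -
  have finC: "finite C" using subgroup.subset[OF C] fin finite_subset by blast
  have "card C > 0" using finC subgroup.one_closed[OF C] card_gt_0_iff by blast
  then obtain m where m: "card C = p ^ multiplicity p (card C) * m"
    by (meson dvdE multiplicity_dvd)
  interpret C: group "G\<lparr>carrier := C\<rparr>" using subgroup_imp_group[OF C] .
  obtain P where P: "subgroup P (G\<lparr>carrier := C\<rparr>)" "card P = p ^ multiplicity p (card C)"
    using sylow_thm[OF p C.group_axioms, of "multiplicity p (card C)" m] m finC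
    by (auto simp: Coset.order_def)
  show thesis
    using that[of P] P incl_subgroup[OF C P(1)] subgroup.subset[OF P(1)] by simp
qed

text \<open>\<open>small\<close> says that |A| exceeds the 2-part of the class size of t. The
  elements t and s imitate opposite root elements of SL_2(3): they satisfy the braid relation, and t
  s t is the Weyl element, whose square is the central involution of SL_2(3).\<close>

locale heisenberg_obstruction = group K for K (structure) +
  fixes t s A
  assumes fin: "finite (carrier K)"
    and t_in: "t \<in> carrier K" and t3: "t [^] (3::nat) = \<one>"
    and A: "subgroup A K" and odd_A: "odd (card A)"
    and A_comm: "\<And>a. a \<in> A \<Longrightarrow> a \<otimes> t = t \<otimes> a"
    and A_conj: "\<And>a. a \<in> A \<Longrightarrow> a \<noteq> \<one> \<Longrightarrow> \<exists>b\<in>carrier K. b \<otimes> t = t \<otimes> b \<and> b \<otimes> a = a \<otimes> t \<otimes> b"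
    and small: "2 ^ multiplicity 2 (Coset.order K)
        < card A * 2 ^ multiplicity (2::nat) (card {g \<in> carrier K. g \<otimes> t = t \<otimes> g})"
    and s_in: "s \<in> carrier K"
    and braid: "t \<otimes> s \<otimes> t = s \<otimes> t \<otimes> s"
    and w4: "(t \<otimes> s \<otimes> t) [^] (4::nat) = \<one>"
    and w_t: "(t \<otimes> s \<otimes> t) \<otimes> t \<noteq> t \<otimes> (t \<otimes> s \<otimes> t)"

context heisenberg_obstruction
begin

lemma centralizer_subgroup:
  assumes "x \<in> carrier K" shows "subgroup {g \<in> carrier K. g \<otimes> x = x \<otimes> g} K"
proof (rule subgroupI)
  fix a b assume a: "a \<in> {g \<in> carrier K. g \<otimes> x = x \<otimes> g}"
  then have "a \<otimes> (inv a \<otimes> x) = a \<otimes> (x \<otimes> inv a)"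
    using assms by (simp flip: m_assoc) (simp add: m_assoc)
  then show "inv a \<in> {g \<in> carrier K. g \<otimes> x = x \<otimes> g}" using a assms by simp
  assume b: "b \<in> {g \<in> carrier K. g \<otimes> x = x \<otimes> g}"
  have "a \<otimes> b \<otimes> x = a \<otimes> (x \<otimes> b)" using a b assms by (simp add: m_assoc)
  also have "\<dots> = x \<otimes> (a \<otimes> b)" using a b assms by (simp flip: m_assoc)
  finally show "a \<otimes> b \<in> {g \<in> carrier K. g \<otimes> x = x \<otimes> g}" using a b by simp
qed (use assms in auto)

text \<open>
  The subgroup \<open>Z\<close> is trivial or the center, so that both parts of the theorem are treated at
  once. In terms of \<open>K\<close>, vanishing of the character of \<open>K/Z\<close> on elements of even order is the
  assumption \<open>nonzero\<close>.
\<close>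

lemma eigenspace_trivial:
  assumes rep: "finite_rep K \<rho> N" and Z: "subgroup Z K" and Z_rho: "\<And>z. z \<in> Z \<Longrightarrow> \<rho> z = 1\<^sub>m N"
    and nonzero: "\<And>g. g \<in> carrier K \<Longrightarrow> mat_trace (\<rho> g) \<noteq> 0 \<Longrightarrow> \<exists>k::nat. odd k \<and> g [^] k \<in> Z"
    and N: "N * 2 ^ multiplicity 2 (card Z) = 2 ^ multiplicity 2 (Coset.order K)"
    and z: "z ^ 3 = (1::complex)" "z \<noteq> 1" and il: "i < N" "l < N"
  shows "(\<Sum>j<3. z ^ j * \<rho> (t [^] j) $$ (i,l)) = 0"
proof -
  interpret finite_rep K \<rho> N by fact
  define C where "C = {g \<in> carrier K. g \<otimes> t = t \<otimes> g}"
  have C: "subgroup C K" unfolding C_def by (rule centralizer_subgroup[OF t_in])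
  obtain P where P: "subgroup P K" "P \<subseteq> C" "card P = 2 ^ multiplicity 2 (card C)"
    using sylow_subgroup_of[OF C, of 2] fin by auto
  have Zpow: "y [^] n \<in> Z" if "y \<in> Z" for y and n :: nat
    by (induction n) (use that Z in \<open>auto intro: subgroup.one_closed subgroup.m_closed\<close>)
  define S where "S = (\<Sum>j<3. z ^ j * chi (t [^] j))"
  have z3: "(\<Sum>j<3. z ^ j) = 0"
  proof -
    have "(1 - z) * (\<Sum>j<3. z ^ j) = 0" using z(1) by (simp add: numeral_3_eq_3 algebra_simps)
    then show ?thesis using z(2) by simp
  qed
  have tpow: "t [^] (j::nat) \<in> carrier K" for j using t_in by simp
  obtain k where k: "S = of_nat (3 * k)"
    "k = 0 \<Longrightarrow> (\<Sum>j<3. z ^ j * \<rho> (t [^] j) $$ (i,l)) = 0"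
  proof -
    obtain k where k: "(\<Sum>q\<in>{\<one>}. \<Sum>j<3. z ^ j * chi (q \<otimes> t [^] j)) = of_nat (3 * card {\<one>} * k)"
      "\<And>i l. k = 0 \<Longrightarrow> i < N \<Longrightarrow> l < N \<Longrightarrow> (\<Sum>q\<in>{\<one>}. \<Sum>j<3. z ^ j * \<rho> (q \<otimes> t [^] j) $$ (i,l)) = 0"
      by (rule eigenspace_average[OF triv_subgroup t_in t3 _ z(1)]) (use t_in in auto)
    show thesis using that[of k] k(1) k(2)[OF _ il] tpow by (simp add: S_def)
  qed
  obtain kA where kA: "(\<Sum>q\<in>A. \<Sum>j<3. z ^ j * chi (q \<otimes> t [^] j)) = of_nat (3 * card A * kA)"
    by (rule eigenspace_average[OF A t_in t3 A_comm z(1)], assumption, rule that)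
  have AK: "a \<in> carrier K" if "a \<in> A" for a using that subgroup.subset[OF A] by blast
  have finA: "finite A" using subgroup.subset[OF A] fin finite_subset by blast
  \<comment> \<open>The element b centralizes t and conjugates q to q t, hence each q t^j to q
    t^(j+1). So chi (q t^j) does not depend on j and factors out of the vanishing sum of the
    z^j.\<close>
  have "(\<Sum>j<3. z ^ j * chi (q \<otimes> t [^] j)) = 0" if q: "q \<in> A - {\<one>}" for q
  proof -
    obtain b where b: "b \<in> carrier K" "b \<otimes> t = t \<otimes> b" "b \<otimes> q = q \<otimes> t \<otimes> b" using A_conj q by blast
    have "chi (q \<otimes> t [^] j) = chi q" for j :: nat
    proof (induction j)
      case (Suc j)
      have "b \<otimes> t [^] j = t [^] j \<otimes> b" for j :: nat
        by (induction j) (use b t_in in \<open>simp_all add: m_assoc\<close>, metis m_assoc tpow b(2) b(1) t_in)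
      then have "b \<otimes> (q \<otimes> t [^] j) = (q \<otimes> t \<otimes> t [^] j) \<otimes> b"
        using b q AK t_in by (metis DiffD1 m_assoc m_closed tpow)
      moreover have "t \<otimes> t [^] j = t [^] Suc j" by (rule nat_pow_Suc2[OF t_in, symmetric])
      ultimately have "b \<otimes> (q \<otimes> t [^] j) = (q \<otimes> t [^] Suc j) \<otimes> b"
        using b q AK t_in by (metis DiffD1 m_assoc tpow)
      then have "chi (q \<otimes> t [^] j) = chi (q \<otimes> t [^] Suc j)"
        by (rule chi_conj[rotated 3]) (use b q AK tpow[of j] tpow[of "Suc j"] in blast)+
      then show ?case using Suc by simp
    qed (use q AK in auto)
    then show ?thesis using z3 by (simp flip: sum_distrib_right)
  qed
  then have "(\<Sum>q\<in>A. \<Sum>j<3. z ^ j * chi (q \<otimes> t [^] j)) = S"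
    using sum.remove[OF finA subgroup.one_closed[OF A], of "\<lambda>q. \<Sum>j<3. z ^ j * chi (q \<otimes> t [^] j)"] tpow
    by (simp add: S_def)
  with kA k(1) have A_dvd: "card A dvd k" by (simp flip: of_nat_mult)
  obtain kP where kP: "(\<Sum>q\<in>P. \<Sum>j<3. z ^ j * chi (q \<otimes> t [^] j)) = of_nat (3 * card P * kP)"
    by (rule eigenspace_average[OF P(1) t_in t3 _ z(1)], use P(2) C_def in blast, rule that)
  have finP: "finite P" using subgroup.subset[OF P(1)] fin finite_subset by blast
  have PK: "a \<in> carrier K" if "a \<in> P" for a using that subgroup.subset[OF P(1)] by blast
  \<comment> \<open>Elements of Z act trivially and contribute S each. For q outside Z, a nonzero
    value at q t^j would put an odd power of q t^j into Z; cubing removes t, so some q^(3n) with n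
    odd lies in Z. As q is a 2-element, it is a power of q^(3n), so q would lie in Z.\<close>
  have "(\<Sum>j<3. z ^ j * chi (q \<otimes> t [^] j)) = (if q \<in> Z then S else 0)" if q: "q \<in> P" for q
  proof (cases "q \<in> Z")
    case True
    have "chi (q \<otimes> t [^] j) = chi (t [^] j)" for j :: nat
      using rho_mult[of q "t [^] j"] Z_rho[OF True] q PK tpow left_mult_one_mat[OF rho_carrier[OF tpow]] by simp
    then show ?thesis using True by (simp add: S_def)
  next
    case False
    have "chi (q \<otimes> t [^] j) = 0" for j :: nat
    proof (rule ccontr)
      assume "chi (q \<otimes> t [^] j) \<noteq> 0"
      then obtain n :: nat where n: "odd n" "(q \<otimes> t [^] j) [^] n \<in> Z"
        using nonzero q PK tpow by (meson m_closed)
      have qt: "q \<otimes> t [^] j = t [^] j \<otimes> q"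
      proof -
        have "q \<otimes> t = t \<otimes> q" using q P(2) by (auto simp: C_def)
        then show ?thesis
          using q PK t_in by (induction j) (simp_all, metis m_assoc tpow)
      qed
      have "((q \<otimes> t [^] j) [^] n) [^] (3::nat) \<in> Z"
        using Zpow n(2) by blast
      also have "((q \<otimes> t [^] j) [^] n) [^] (3::nat) = q [^] (3 * n) \<otimes> (t [^] (3::nat)) [^] (j * n)"
        using pow_mult_distrib[OF qt PK[OF q] tpow, of "3 * n"] PK[OF q] t_in
        by (simp add: nat_pow_pow mult.commute mult.left_commute mult.assoc)
      finally have q3: "q [^] (3 * n) \<in> Z" using t3 PK[OF q] by simp
      have qP: "q [^] card P = \<one>"
      proof -
        interpret P: group "K\<lparr>carrier := P\<rparr>" using subgroup_imp_group[OF P(1)] .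
        have "q [^]\<^bsub>K\<lparr>carrier := P\<rparr>\<^esub> Coset.order (K\<lparr>carrier := P\<rparr>) = \<one>\<^bsub>K\<lparr>carrier := P\<rparr>\<^esub>"
          using P.pow_order_eq_1 q by simp
        then show ?thesis by (simp add: Coset.order_def nat_pow_consistent[symmetric])
      qed
      have "coprime (3 * n) (card P)" using n(1) P(3) by simp
      then obtain x y where xy: "3 * n * x = card P * y + 1"
        using bezout_nat[of "3 * n" "card P"] n(1) by (metis coprime_iff_gcd_eq_1 odd_pos mult_is_0 neq0_conv zero_neq_numeral)
      have "q [^] (3 * n * x) = q"
        unfolding xy using PK[OF q] qP by (simp add: nat_pow_mult[symmetric] nat_pow_pow[symmetric])
      moreover have "(q [^] (3 * n)) [^] x \<in> Z" using Zpow q3 by blast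
      ultimately show False using False PK[OF q] by (metis nat_pow_pow)
    qed
    then show ?thesis using False by simp
  qed
  then have "(\<Sum>q\<in>P. \<Sum>j<3. z ^ j * chi (q \<otimes> t [^] j)) = of_nat (card (P \<inter> Z)) * S"
    using finP by (simp add: sum.If_cases)
  with kP k(1) have P_eq: "card (P \<inter> Z) * k = card P * kP"
    by (simp flip: of_nat_mult; metis (no_types, opaque_lifting) mult.left_commute mult_cancel_left of_nat_eq_iff zero_neq_numeral of_nat_mult of_nat_numeral)
  have PZ: "subgroup (P \<inter> Z) K" using subgroups_Inter_pair[OF P(1) Z] .
  have "card (P \<inter> Z) dvd card P"
    using group.lagrange[OF subgroup_imp_group[OF P(1)], of "P \<inter> Z"] subgroup_incl[OF PZ P(1)]
    by (metis Coset.order_def dvd_triv_right inf_le1 partial_object.select_convs(1) partial_object.update_convs(1) monoid.surjective)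
  then obtain c where c: "card (P \<inter> Z) = 2 ^ c" "c \<le> multiplicity 2 (card C)"
    unfolding P(3) using divides_primepow_nat[of 2] two_is_prime_nat by blast
  have "card (P \<inter> Z) dvd card Z"
    using group.lagrange[OF subgroup_imp_group[OF Z], of "P \<inter> Z"] subgroup_incl[OF PZ Z]
    by (metis Coset.order_def dvd_triv_right inf_le2 partial_object.select_convs(1) partial_object.update_convs(1) monoid.surjective)
  moreover have "card Z > 0" using subgroup.one_closed[OF Z] finite_subset[OF subgroup.subset[OF Z] fin] card_gt_0_iff by blast
  ultimately have cZ: "c \<le> multiplicity 2 (card Z)" using c by (intro multiplicity_geI) auto
  have mults: "\<exists>k. (\<Sum>j<3. y ^ j * chi (t [^] j)) = of_nat (3 * k)" if y: "y ^ 3 = 1" for y :: complex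
  proof -
    obtain k where "(\<Sum>q\<in>{\<one>}. \<Sum>j<3. y ^ j * chi (q \<otimes> t [^] j)) = of_nat (3 * card {\<one>} * k)"
      by (rule eigenspace_average[OF triv_subgroup t_in t3 _ y]) (use t_in in auto)
    then show ?thesis using tpow by auto
  qed
  obtain k1 where k1: "(\<Sum>j<3. 1 ^ j * chi (t [^] j)) = of_nat (3 * k1)"
    using mults[of 1] by auto
  have "(z ^ 2) ^ 3 = 1" using z(1) by (metis power_mult power_one mult.commute)
  then obtain k2 where k2: "(\<Sum>j<3. (z ^ 2) ^ j * chi (t [^] j)) = of_nat (3 * k2)"
    using mults by blast
  have sum3: "(\<Sum>j<3. f j) = f 0 + f 1 + f 2" for f :: "nat \<Rightarrow> complex"
    by (simp add: numeral_3_eq_3 numeral_2_eq_2)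
  \<comment> \<open>The numbers k1, k and k2 are the dimensions of the three eigenspaces of t. By
    orthogonality of the cube roots of unity they add up to N, which bounds k.\<close>
  have "of_nat (3 * k1) + of_nat (3 * k) + of_nat (3 * k2) = (of_nat (3 * N) :: complex)"
  proof -
    have z4: "(z ^ 2) ^ 2 = z ^ 4" by (simp flip: power_mult)
    have "of_nat (3 * k1) + of_nat (3 * k) + of_nat (3 * k2)
        = (\<Sum>j<3. (1 ^ j + z ^ j + (z ^ 2) ^ j) * chi (t [^] j))"
      unfolding k(1)[symmetric] k1[symmetric] k2[symmetric] S_def by (simp add: sum.distrib algebra_simps)
    also have "\<dots> = 3 * chi \<one> + (1 + z + z ^ 2) * chi t + (1 + z ^ 2 + z ^ 4) * chi (t [^] (2::nat))"
      using t_in nat_pow_eone[OF t_in] z4 by (simp add: sum3 algebra_simps)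
    also have "1 + z + z ^ 2 = 0" using z3 by (simp add: sum3)
    also have "1 + z ^ 2 + z ^ 4 = 1 + z + z ^ 2"
      using z(1) power_add[of z 3 1] by simp
    also have "1 + z + z ^ 2 = 0" using z3 by (simp add: sum3)
    finally show ?thesis by (simp add: chi_one)
  qed
  then have "3 * k1 + 3 * k + 3 * k2 = 3 * N" by (metis of_nat_add of_nat_eq_iff)
  then have kN: "k \<le> N" by simp
  have "k = 0"
  proof (rule ccontr)
    \<comment> \<open>\<open>P_eq\<close> makes 2^(v - c) divide k, and so does the odd number |A|;
      hence |A| 2^(v - c) is at most N. Multiplying by 2^c, which is at most the 2-part of |Z|,
      gives |A| 2^v \<le> |K|_2 and contradicts \<open>small\<close>.\<close>
    assume "k \<noteq> 0"
    define v where "v = multiplicity 2 (card C)"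
    have "2 ^ v dvd 2 ^ c * k" using P_eq P(3) c(1) by (simp add: v_def)
    also have "2 ^ v = (2::nat) ^ c * 2 ^ (v - c)" using c(2) by (simp add: v_def flip: power_add)
    finally have "2 ^ (v - c) dvd k" by simp
    then have "card A * 2 ^ (v - c) dvd k" using A_dvd odd_A by (intro divides_mult) auto
    then have "card A * 2 ^ (v - c) \<le> N" using \<open>k \<noteq> 0\<close> kN by (meson dvd_imp_le le_trans neq0_conv)
    then have "card A * 2 ^ (v - c) * 2 ^ c \<le> N * 2 ^ multiplicity 2 (card Z)"
      using cZ by (intro mult_mono power_increasing) auto
    then have "card A * 2 ^ v \<le> 2 ^ multiplicity 2 (Coset.order K)"
      using c(2) N by (simp add: v_def mult.assoc flip: power_add)
    then show False using small by (simp add: C_def v_def)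
  qed
  then show ?thesis using k(2) by simp
qed

text \<open>Entrywise, with a and b for \<rho>(t) and \<rho>(t^2), the vanishing of both nontrivial
  projections reads 1 + w a + w^2 b = 0 and 1 + w^2 a + w b = 0. Subtracting gives a = b, and then w
  + w^2 = -1 gives a = 1.\<close>

lemma rho_t:
  assumes rep: "finite_rep K \<rho> N" and Z: "subgroup Z K" "\<And>z. z \<in> Z \<Longrightarrow> \<rho> z = 1\<^sub>m N"
    and nonzero: "\<And>g. g \<in> carrier K \<Longrightarrow> mat_trace (\<rho> g) \<noteq> 0 \<Longrightarrow> \<exists>k::nat. odd k \<and> g [^] k \<in> Z"
    and N: "N * 2 ^ multiplicity 2 (card Z) = 2 ^ multiplicity 2 (Coset.order K)"
  shows "\<rho> t = 1\<^sub>m N"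
proof (rule eq_matI)
  interpret finite_rep K \<rho> N by fact
  define w where "w = Complex (-1/2) (sqrt 3 / 2)"
  have w: "w * w = - 1 - w" "w \<noteq> 1" by (auto simp: w_def complex_eq_iff)
  have w3: "w * w * w = 1"
  proof -
    have "w * w * w = (- 1 - w) * w" using w(1) by simp
    also have "\<dots> = - w - w * w" by (simp add: algebra_simps)
    finally show ?thesis using w(1) by simp
  qed
  have w2: "w * w \<noteq> 1"
  proof
    assume "w * w = 1"
    then have "w = 1" using w3 by simp
    then show False using w(2) by simp
  qed
  fix i j assume "i < dim_row (1\<^sub>m N :: complex mat)" "j < dim_col (1\<^sub>m N :: complex mat)"
  then have ij: "i < N" "j < N" by auto
  note triv = eigenspace_trivial[OF rep Z nonzero N]
  have "(\<Sum>k<3. w ^ k * \<rho> (t [^] k) $$ (i,j)) = 0"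
    by (rule triv) (use w w3 ij in \<open>auto simp: power3_eq_cube\<close>)
  then have 1: "\<rho> \<one> $$ (i,j) + w * \<rho> t $$ (i,j) + w * w * \<rho> (t \<otimes> t) $$ (i,j) = 0"
    using t_in by (simp add: numeral_3_eq_3)
  have "(w * w) ^ 3 = (w * w * w) * (w * w * w)" by (simp add: power3_eq_cube)
  then have "(w * w) ^ 3 = 1" using w3 by simp
  then have "(\<Sum>k<3. (w * w) ^ k * \<rho> (t [^] k) $$ (i,j)) = 0"
    by (intro triv) (use w2 ij in auto)
  then have "\<rho> \<one> $$ (i,j) + w * w * \<rho> t $$ (i,j) + (w * w * w) * w * \<rho> (t \<otimes> t) $$ (i,j) = 0"
    using t_in by (simp add: numeral_3_eq_3 mult.assoc)
  then have 2: "\<rho> \<one> $$ (i,j) + w * w * \<rho> t $$ (i,j) + w * \<rho> (t \<otimes> t) $$ (i,j) = 0" using w3 by simp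
  have "(w - w * w) * (\<rho> t $$ (i,j) - \<rho> (t \<otimes> t) $$ (i,j))
      = (\<rho> \<one> $$ (i,j) + w * \<rho> t $$ (i,j) + w * w * \<rho> (t \<otimes> t) $$ (i,j))
        - (\<rho> \<one> $$ (i,j) + w * w * \<rho> t $$ (i,j) + w * \<rho> (t \<otimes> t) $$ (i,j))"
    by (simp add: algebra_simps)
  then have "(w - w * w) * (\<rho> t $$ (i,j) - \<rho> (t \<otimes> t) $$ (i,j)) = 0" using 1 2 by simp
  moreover have "w - w * w \<noteq> 0" using w2 w w3 by (metis mult_cancel_left1 eq_iff_diff_eq_0 mult_zero_left zero_neq_one)
  ultimately have tt: "\<rho> (t \<otimes> t) $$ (i,j) = \<rho> t $$ (i,j)" by simp
  have "\<rho> \<one> $$ (i,j) + (w + w * w) * \<rho> t $$ (i,j) = 0" using 1 tt by (simp add: algebra_simps)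
  then show "\<rho> t $$ (i,j) = 1\<^sub>m N $$ (i,j)" using w(1) rho_one by simp
qed (use finite_rep.rho_carrier[OF rep t_in] in auto)

lemma no_representation:
  assumes rep: "finite_rep K \<rho> N" and Z: "subgroup Z K" "\<And>z. z \<in> Z \<Longrightarrow> \<rho> z = 1\<^sub>m N"
    and central: "\<And>z g. z \<in> Z \<Longrightarrow> g \<in> carrier K \<Longrightarrow> z \<otimes> g = g \<otimes> z"
    and nonzero: "\<And>g. g \<in> carrier K \<Longrightarrow> mat_trace (\<rho> g) \<noteq> 0 \<Longrightarrow> \<exists>k::nat. odd k \<and> g [^] k \<in> Z"
    and N: "N * 2 ^ multiplicity 2 (card Z) = 2 ^ multiplicity 2 (Coset.order K)"
  shows False
proof -
  interpret finite_rep K \<rho> N by fact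
  note t1 = rho_t[OF rep Z nonzero N]
  have sc: "\<rho> s \<in> carrier_mat N N" using s_in by simp
  \<comment> \<open>Once \<rho>(t) = 1, the braid relation collapses to \<rho>(s) = \<rho>(s)^2, so
    \<rho>(s) = 1 as well.\<close>
  have "\<rho> s = \<rho> (t \<otimes> s \<otimes> t)"
    using t_in s_in t1 left_mult_one_mat[OF sc] right_mult_one_mat[OF sc] by (simp add: rho_mult)
  also have "\<dots> = \<rho> s * \<rho> s" unfolding braid
    using t_in s_in t1 left_mult_one_mat[OF sc] right_mult_one_mat[OF sc] by (simp add: rho_mult)
  finally have ss: "\<rho> s = \<rho> s * \<rho> s" .
  have si: "\<rho> s * \<rho> (inv s) = 1\<^sub>m N" using rho_mult[of s "inv s"] s_in rho_one by simp
  then have "1\<^sub>m N = (\<rho> s * \<rho> s) * \<rho> (inv s)" using ss by simp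
  also have "\<dots> = \<rho> s * (\<rho> s * \<rho> (inv s))"
    using s_in by (intro assoc_mult_mat[of _ N N _ N _ N]) auto
  also note si
  finally have s1: "\<rho> s = 1\<^sub>m N" using sc by simp
  define w where "w = t \<otimes> s \<otimes> t"
  have w: "w \<in> carrier K" using t_in s_in by (simp add: w_def)
  have "\<rho> w = 1\<^sub>m N" using t_in s_in t1 s1 by (simp add: w_def rho_mult)
  moreover have "N \<noteq> 0" using N by (metis mult_0 power_not_zero zero_neq_numeral)
  ultimately have "mat_trace (\<rho> w) \<noteq> 0" by (simp add: mat_trace_def)
  then obtain k :: nat where k: "odd k" "w [^] k \<in> Z" using nonzero w by blast
  have Zpow: "y [^] n \<in> Z" if "y \<in> Z" for y and n :: nat
    by (induction n) (use that Z(1) in \<open>auto intro: subgroup.one_closed subgroup.m_closed\<close>)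
  \<comment> \<open>An odd square is 1 modulo 4, so w = (w^k)^k is a power of an element of Z. Then
    w would be central, against \<open>w_t\<close>.\<close>
  obtain j where j: "k = 2 * j + 1" using k(1) oddE by blast
  have "w [^] (k * k) = w [^] (4 * (j * j + j) + 1)" by (simp add: j algebra_simps)
  also have "\<dots> = (w [^] (4::nat)) [^] (j * j + j) \<otimes> w" using w by (simp add: nat_pow_pow nat_pow_mult[symmetric])
  also have "\<dots> = w" using w4 w by (simp add: w_def)
  finally have "w = (w [^] k) [^] k" using w by (simp add: nat_pow_pow)
  then have "w \<in> Z" using Zpow[OF k(2), of k] by simp
  then have "w \<otimes> t = t \<otimes> w" using central t_in by blast
  then show False using w_t by (simp add: w_def)
qed

section \<open>The contradiction for the group and for its quotient by the center\<close>

theorem no_steinberg_like: "\<not> steinberg_like_2 K \<chi>"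
proof
  assume st: "steinberg_like_2 K \<chi>"
  then obtain N \<rho> where \<rho>: "\<rho> \<in> hom K (GL_cx N)" "\<And>g. g \<in> carrier K \<Longrightarrow> \<chi> g = mat_trace (\<rho> g)"
    by (auto simp: steinberg_like_2_def is_character_def)
  interpret finite_rep K \<rho> N by unfold_locales (use fin \<rho> in auto)
  have "of_nat N = (of_nat (2 ^ multiplicity 2 (Coset.order K)) :: complex)"
    using st \<rho>(2)[OF one_closed] chi_one by (simp add: steinberg_like_2_def)
  then have "N = 2 ^ multiplicity 2 (Coset.order K)" by (metis of_nat_eq_iff)
  \<comment> \<open>Here Z is trivial, and the odd exponent required for an element with nonzero
    value is its order.\<close>
  then show False
    using st \<rho>(2) pow_ord_eq_1
    by (intro no_representation[OF finite_rep_axioms triv_subgroup])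
      (auto simp: steinberg_like_2_def rho_one)
qed

text \<open>The representation of the quotient is inflated to K, where Z acts trivially. If the
  value at g is nonzero, the coset of g has odd order, and that order is an odd exponent taking g
  into Z. The degree condition follows from |K|_2 = |K/Z|_2 |Z|_2.\<close>

theorem no_steinberg_like_mod_center: "\<not> steinberg_like_2 (K Mod center K) \<chi>"
proof
  define Z where "Z = center K"
  assume "steinberg_like_2 (K Mod center K) \<chi>"
  then have st: "steinberg_like_2 (K Mod Z) \<chi>" by (simp add: Z_def)
  have central: "z \<otimes> g = g \<otimes> z" if "z \<in> Z" "g \<in> carrier K" for z g
    using that by (auto simp: Z_def center_def)
  have Z: "subgroup Z K"
  proof (rule subgroupI)
    show "Z \<subseteq> carrier K" "Z \<noteq> {}" by (auto simp: Z_def center_def intro: exI[of _ \<one>])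
    fix a b assume a: "a \<in> Z"
    then have aK: "a \<in> carrier K" by (simp add: Z_def center_def)
    have "x \<otimes> inv a = inv a \<otimes> x" if x: "x \<in> carrier K" for x
    proof -
      have "inv a \<otimes> x = inv a \<otimes> (x \<otimes> a) \<otimes> inv a" using aK x by (simp add: m_assoc)
      also have "x \<otimes> a = a \<otimes> x" using central[OF a x] by simp
      finally show ?thesis using aK x by (simp flip: m_assoc)
    qed
    then show "inv a \<in> Z" using aK by (simp add: Z_def center_def)
    assume b: "b \<in> Z"
    then have bK: "b \<in> carrier K" by (simp add: Z_def center_def)
    have "x \<otimes> (a \<otimes> b) = a \<otimes> b \<otimes> x" if x: "x \<in> carrier K" for x
      using aK bK x central[OF a x] central[OF b x] by (metis m_assoc)
    then show "a \<otimes> b \<in> Z" using aK bK by (simp add: Z_def center_def)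
  qed
  have norm: "Z \<lhd> K"
  proof -
    have "x \<otimes> h \<otimes> inv x \<in> Z" if "x \<in> carrier K" "h \<in> Z" for x h
      using that subgroup.subset[OF Z] central[OF that(2,1)]
      by (metis inv_closed m_assoc r_inv r_one subsetD)
    then show ?thesis using Z by (simp add: normal_inv_iff)
  qed
  interpret Z: normal Z K by fact
  interpret Q: group "K Mod Z" by (rule Z.factorgroup_is_group)
  obtain N \<rho> where \<rho>: "\<rho> \<in> hom (K Mod Z) (GL_cx N)"
      "\<And>g. g \<in> carrier (K Mod Z) \<Longrightarrow> \<chi> g = mat_trace (\<rho> g)"
    using st by (auto simp: steinberg_like_2_def is_character_def)
  let ?\<pi> = "\<lambda>g. Z #> g"
  have \<pi>: "?\<pi> \<in> hom K (K Mod Z)" by (rule Z.r_coset_hom_Mod)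
  have finQ: "finite (carrier (K Mod Z))"
    using fin by (auto simp: FactGroup_def RCOSETS_def)
  interpret Q: finite_rep "K Mod Z" \<rho> N by unfold_locales (use finQ \<rho> in auto)
  have hom: "\<rho> \<circ> ?\<pi> \<in> hom K (GL_cx N)"
    unfolding o_def
    by (rule homI) (simp_all only: hom_mult[OF \<pi>] hom_in_carrier[OF \<pi>] hom_mult[OF \<rho>(1)] hom_in_carrier[OF \<rho>(1)])
  interpret finite_rep K "\<rho> \<circ> ?\<pi>" N by unfold_locales (use fin hom in auto)
  interpret \<pi>: group_hom K "K Mod Z" ?\<pi> by unfold_locales (rule \<pi>)
  have \<pi>Z: "?\<pi> g = \<one>\<^bsub>K Mod Z\<^esub> \<longleftrightarrow> g \<in> Z" if "g \<in> carrier K" for g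
    using that coset_join1[of Z g] coset_join2[of g Z] Z by (auto simp: FactGroup_def)
  have ord_eq: "Coset.order (K Mod Z) * card Z = Coset.order K"
    using lagrange[OF Z] by (simp add: Coset.order_def FactGroup_def)
  have "Coset.order K \<noteq> 0" using fin by (simp add: Coset.order_def card_eq_0_iff) (use one_closed in blast)
  then have "multiplicity 2 (Coset.order K) = multiplicity 2 (Coset.order (K Mod Z)) + multiplicity 2 (card Z)"
    unfolding ord_eq[symmetric] by (subst prime_elem_multiplicity_mult_distrib) auto
  moreover have "of_nat N = (of_nat (2 ^ multiplicity 2 (Coset.order (K Mod Z))) :: complex)"
    using st \<rho>(2)[OF Q.one_closed] Q.chi_one by (simp add: steinberg_like_2_def)
  then have "N = 2 ^ multiplicity 2 (Coset.order (K Mod Z))" by (metis of_nat_eq_iff)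
  ultimately have N: "N * 2 ^ multiplicity 2 (card Z) = 2 ^ multiplicity 2 (Coset.order K)" by (simp add: power_add)
  show False
  proof (rule no_representation[OF finite_rep_axioms Z _ central _ N])
    show "(\<rho> \<circ> ?\<pi>) z = 1\<^sub>m N" if "z \<in> Z" for z
      using \<pi>Z[of z] that subgroup.subset[OF Z] Q.rho_one by auto
    fix g assume g: "g \<in> carrier K" "mat_trace ((\<rho> \<circ> ?\<pi>) g) \<noteq> 0"
    have gQ: "?\<pi> g \<in> carrier (K Mod Z)" using \<pi>.hom_closed[OF g(1)] .
    have "odd (Q.ord (?\<pi> g))"
      using g(2) gQ \<rho>(2)[OF gQ] st by (auto simp: steinberg_like_2_def)
    moreover have "?\<pi> (g [^] Q.ord (?\<pi> g)) = \<one>\<^bsub>K Mod Z\<^esub>"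
      using Q.pow_ord_eq_1[OF gQ] \<pi>.hom_nat_pow[OF g(1)] by simp
    then have "g [^] Q.ord (?\<pi> g) \<in> Z" using \<pi>Z g(1) by simp
    ultimately show "\<exists>k::nat. odd k \<and> g [^] k \<in> Z" by blast
  qed
qed

end

text \<open>T is a disjoint union of conjugacy classes. If the p-part of every class size exceeded
  that of |T|, a higher power of p than the p-part of |T| would divide the sum of the class sizes,
  which is |T|.\<close>

lemma (in group) exists_small_class:
  assumes fin: "finite (carrier G)" and T: "T \<subseteq> carrier G" "T \<noteq> {}"
    and inv: "\<And>g t. g \<in> carrier G \<Longrightarrow> t \<in> T \<Longrightarrow> g \<otimes> t \<otimes> inv g \<in> T"
    and p: "Factorial_Ring.prime p"
  shows "\<exists>t\<in>T. multiplicity p (Coset.order G)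
    \<le> multiplicity p (card T) + multiplicity p (card {g \<in> carrier G. g \<otimes> t = t \<otimes> g})"
proof (rule ccontr)
  assume neg: "\<not> ?thesis"
  define \<phi> where "\<phi> = (\<lambda>g. \<lambda>h \<in> carrier G. g \<otimes> h \<otimes> inv g)"
  interpret act: group_action G "carrier G" \<phi>
    unfolding \<phi>_def by (rule action_by_conjugation)
  have finT: "finite T" using fin T finite_subset by blast
  define Orbs where "Orbs = orbit G \<phi> ` T"
  have orbit_T: "orbit G \<phi> t \<subseteq> T" if "t \<in> T" for t
    using that T inv by (auto simp: orbit_def \<phi>_def)
  have self: "t \<in> orbit G \<phi> t" if "t \<in> T" for t
    using act.orbit_refl that T by blast
  have "\<Union>Orbs = T" using orbit_T self by (auto simp: Orbs_def)
  moreover have "disjoint Orbs"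
    unfolding disjoint_def
  proof (intro ballI impI)
    fix a b assume ab: "a \<in> Orbs" "b \<in> Orbs" "a \<noteq> b"
    then have "a \<in> orbits G (carrier G) \<phi>" "b \<in> orbits G (carrier G) \<phi>"
      using T by (auto simp: Orbs_def orbits_def)
    then show "a \<inter> b = {}" using act.disjoint_union ab(3) by blast
  qed
  ultimately have cardT: "card T = (\<Sum>a\<in>Orbs. card a)"
    using card_Union_disjoint[of Orbs] finT orbit_T by (metis Orbs_def finite_subset imageE disjoint_def pairwise_def)
  have "p ^ Suc (multiplicity p (card T)) dvd card a" if a: "a \<in> Orbs" for a
  proof -
    obtain t where t: "t \<in> T" "a = orbit G \<phi> t" using a by (auto simp: Orbs_def)
    have tG: "t \<in> carrier G" using t T by blast
    let ?C = "{g \<in> carrier G. g \<otimes> t = t \<otimes> g}"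
    have "stabilizer G \<phi> t = ?C"
    proof -
      have "(g \<otimes> t \<otimes> inv g = t) \<longleftrightarrow> g \<otimes> t = t \<otimes> g" if "g \<in> carrier G" for g
        using that tG by (metis inv_closed inv_solve_right m_closed)
      then show ?thesis using tG by (auto simp: stabilizer_def \<phi>_def)
    qed
    then have eq: "card a * card ?C = Coset.order G"
      using act.orbit_stabilizer_theorem[OF tG] t(2) by simp
    have pos: "Coset.order G \<noteq> 0" using fin order_gt_0_iff_finite by simp
    then have "card a \<noteq> 0" "card ?C \<noteq> 0" using eq by (metis mult_0, metis mult_0_right)
    then have "multiplicity p (Coset.order G) = multiplicity p (card a) + multiplicity p (card ?C)"
      unfolding eq[symmetric] using p by (intro prime_elem_multiplicity_mult_distrib) auto
    moreover have "\<not> multiplicity p (Coset.order G) \<le> multiplicity p (card T) + multiplicity p (card ?C)"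
      using neg t(1) by blast
    ultimately have "Suc (multiplicity p (card T)) \<le> multiplicity p (card a)" by linarith
    then show ?thesis by (rule multiplicity_dvd')
  qed
  then have "p ^ Suc (multiplicity p (card T)) dvd card T" unfolding cardT by (rule dvd_sum)
  moreover have "card T \<noteq> 0" using finT T by simp
  ultimately have "Suc (multiplicity p (card T)) \<le> multiplicity p (card T)"
    using p by (intro multiplicity_geI) (auto simp: prime_nat_iff)
  then show False by simp
qed

section \<open>Bilinear forms over GF(3) and their isometry groups\<close>

lemma F3_cases: "(c::3) = 0 \<or> c = 1 \<or> c = -1"
proof (cases c)
  case (of_int z)
  then consider "z = 0" | "z = 1" | "z = 2" by fastforce
  then show ?thesis by cases (use of_int in auto)
qed

text \<open>Together with \<open>F3_double_left\<close> and \<open>F3_numerals\<close> this lets the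
  simplifier reduce coefficients modulo 3 once \<open>algebra_simps\<close> has sorted the
  summands.\<close>

lemma F3_double [simp]: "(c::3) + c = - c"
  using F3_cases[of c] by auto

lemma F3_double_left [simp]: "(c::3) + (c + d) = d - c"
  using F3_cases[of c] F3_cases[of d] by auto

lemma F3_numerals [simp]: "(2::3) = -1" "(3::3) = 0" "(4::3) = 1"
  by simp_all

lemma F3_square: "(c::3) \<noteq> 0 \<Longrightarrow> c * c = 1"
  using F3_cases[of c] by auto

section \<open>Vectors over GF(3) and the action of matrices on them\<close>

type_synonym F3vec = "nat \<Rightarrow> 3"

text \<open>As simp rules these would also unfold eta-expanded occurrences of whole vectors.\<close>

declare plus_fun_apply [simp del] zero_fun_apply [simp del]

definition scal :: "3 \<Rightarrow> F3vec \<Rightarrow> F3vec" where "scal c x = (\<lambda>i. c * x i)"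

lemma scal_apply: "scal c x i = c * x i" by (simp add: scal_def)

lemmas fvec = fun_eq_iff plus_fun_apply zero_fun_apply scal_apply

lemma scal_simps [simp]: "scal 0 x = 0" "scal 1 x = x" "scal c 0 = 0"
  by (simp_all add: fvec)

lemma two_times_vec [simp]: "2 * (x::F3vec) = scal (-1) x"
  unfolding mult_2 by (simp add: fvec)

lemma scal_scal [simp]: "scal a (scal b x) = scal (a * b) x"
  by (simp add: fvec mult.assoc)

lemma add_scal_neg [simp]: "x + scal (-1) x = 0"
  by (simp add: fvec)

definition act :: "nat \<Rightarrow> 3 mat \<Rightarrow> F3vec \<Rightarrow> F3vec" where
  "act n A x = (\<lambda>i. if i < n then \<Sum>j<n. A $$ (i,j) * x j else 0)"

text \<open>Vectors of length n are functions on all naturals vanishing from n on, so that addition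
  is the pointwise one of the function type and every dimension shares one type.\<close>

definition vecs :: "nat \<Rightarrow> F3vec set" where "vecs n = {x. \<forall>i\<ge>n. x i = 0}"

definition unit :: "nat \<Rightarrow> F3vec" where "unit j = (\<lambda>i. if i = j then 1 else 0)"

definition mt :: "nat \<Rightarrow> (F3vec \<Rightarrow> F3vec) \<Rightarrow> 3 mat" where
  "mt n f = mat n n (\<lambda>(i,j). f (unit j) i)"

lemma mt_carrier [simp]: "mt n f \<in> carrier_mat n n" by (simp add: mt_def)

lemma act_in_vecs [simp]: "act n A x \<in> vecs n" by (simp add: act_def vecs_def)

lemma act_add: "act n A (x + y) = act n A x + act n A y"
  by (auto simp: act_def fvec sum.distrib algebra_simps)

lemma act_scal: "act n A (scal c x) = scal c (act n A x)"
  by (auto simp: act_def fvec sum_distrib_left algebra_simps)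

lemma act_mult:
  assumes "A \<in> carrier_mat n n" "B \<in> carrier_mat n n"
  shows "act n (A * B) x = act n A (act n B x)"
proof
  fix i
  show "act n (A * B) x i = act n A (act n B x) i"
  proof (cases "i < n")
    case True
    have "act n (A * B) x i = (\<Sum>j<n. \<Sum>k<n. A $$ (i,k) * B $$ (k,j) * x j)"
      using True assms by (simp add: act_def scalar_prod_def atLeast0LessThan sum_distrib_right)
    also have "\<dots> = (\<Sum>k<n. \<Sum>j<n. A $$ (i,k) * B $$ (k,j) * x j)" by (rule sum.swap)
    also have "\<dots> = act n A (act n B x) i"
      using True by (simp add: act_def sum_distrib_left mult.assoc)
    finally show ?thesis .
  qed (simp add: act_def)
qed

lemma act_one [simp]: "x \<in> vecs n \<Longrightarrow> act n (1\<^sub>m n) x = x"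
proof
  fix i assume x: "x \<in> vecs n"
  have "(\<Sum>j<n. 1\<^sub>m n $$ (i,j) * x j) = (\<Sum>j<n. if j = i then x i else 0)" if "i < n"
    using that by (intro sum.cong) auto
  then show "act n (1\<^sub>m n) x i = x i" using x by (auto simp: act_def vecs_def)
qed

lemma unit_in_vecs [simp]: "j < n \<Longrightarrow> unit j \<in> vecs n"
  by (simp add: unit_def vecs_def)

lemma act_unit: "j < n \<Longrightarrow> act n A (unit j) = (\<lambda>i. if i < n then A $$ (i,j) else 0)"
proof
  fix i assume "j < n"
  have "(\<Sum>k<n. A $$ (i,k) * unit j k) = (\<Sum>k<n. if k = j then A $$ (i,j) else 0)"
    by (intro sum.cong) (auto simp: unit_def)
  then show "act n A (unit j) i = (if i < n then A $$ (i,j) else 0)" using \<open>j < n\<close> by (simp add: act_def)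
qed

lemma mat_eq_by_act:
  assumes "A \<in> carrier_mat n n" "B \<in> carrier_mat n n"
    and eq: "\<And>x. x \<in> vecs n \<Longrightarrow> act n A x = act n B x"
  shows "A = B"
proof (rule eq_matI)
  fix i j assume "i < dim_row B" "j < dim_col B"
  then have "i < n" "j < n" using assms by auto
  then show "A $$ (i,j) = B $$ (i,j)"
    using fun_cong[OF eq[of "unit j"], of i] by (simp add: act_unit)
qed (use assms in auto)

lemma vecs_add [simp]: "x \<in> vecs n \<Longrightarrow> y \<in> vecs n \<Longrightarrow> x + y \<in> vecs n"
  and vecs_scal [simp]: "x \<in> vecs n \<Longrightarrow> scal c x \<in> vecs n"
  and vecs_zero [simp]: "0 \<in> vecs n"
  by (simp_all add: vecs_def fvec)

lemma vecs_expand: "x \<in> vecs n \<Longrightarrow> x = (\<Sum>j<n. scal (x j) (unit j))"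
proof
  fix i assume x: "x \<in> vecs n"
  have "(\<Sum>j<n. scal (x j) (unit j)) i = (\<Sum>j<n. scal (x j) (unit j) i)"
    by (induction n) (auto simp: fvec)
  also have "\<dots> = (\<Sum>j<n. if j = i then x i else 0)" by (intro sum.cong) (auto simp: unit_def fvec)
  finally show "x i = (\<Sum>j<n. scal (x j) (unit j)) i" using x by (auto simp: vecs_def)
qed

lemma act_mt:
  assumes add: "\<And>x y. f (x + y) = f x + f y" and sc: "\<And>c x. f (scal c x) = scal c (f x)"
    and V: "\<And>x. x \<in> vecs n \<Longrightarrow> f x \<in> vecs n" and x: "x \<in> vecs n"
  shows "act n (mt n f) x = f x"
proof -
  have f0: "f 0 = 0" using sc[of 0 0] by simp
  have fsum: "f (\<Sum>j\<in>J. scal (x j) (unit j)) = (\<Sum>j\<in>J. scal (x j) (f (unit j)))" if "finite J" for J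
    using that by (induction J rule: finite_induct) (simp_all only: sum.empty sum.insert f0 add sc not_False_eq_True)
  have apply_sum: "(\<Sum>j\<in>J. g j) i = (\<Sum>j\<in>J. g j i)" if "finite J" for J and g :: "nat \<Rightarrow> F3vec" and i
    using that by (induction J rule: finite_induct) (auto simp: fvec)
  have "f x = (\<Sum>j<n. scal (x j) (f (unit j)))"
    using fsum[of "{..<n}"] vecs_expand[OF x] by simp
  then have "f x i = (\<Sum>j<n. x j * f (unit j) i)" for i by (simp add: apply_sum scal_apply)
  moreover have "f x i = 0" if "i \<ge> n" for i using V[OF x] that by (simp add: vecs_def)
  ultimately show ?thesis by (auto simp: act_def mt_def fvec mult.commute)
qed

lemma finite_vecs: "finite (vecs n)"
  and card_vecs: "card (vecs n) = 3 ^ n"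
proof -
  have "bij_betw (\<lambda>f i. if i < n then f i else 0) ({..<n} \<rightarrow>\<^sub>E (UNIV :: 3 set)) (vecs n)"
    by (rule bij_betw_byWitness[of _ "\<lambda>x. restrict x {..<n}"])
      (auto simp: vecs_def PiE_def extensional_def fvec)
  moreover have "finite ({..<n} \<rightarrow>\<^sub>E (UNIV :: 3 set))" by (intro finite_PiE) auto
  moreover have "card ({..<n} \<rightarrow>\<^sub>E (UNIV :: 3 set)) = 3 ^ n" by (simp add: card_PiE)
  ultimately show "finite (vecs n)" "card (vecs n) = 3 ^ n"
    by (auto dest: bij_betw_finite bij_betw_same_card)
qed

text \<open>Orthogonal (\<epsilon> = 1) and symplectic (\<epsilon> = -1) geometry are developed
  together; in characteristic 3 a skew-symmetric form is alternating. Nondegeneracy is stated in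
  coordinates, on the rows of S, and becomes \<open>nondeg\<close> once B exists.\<close>

locale form =
  fixes n :: nat and S :: "3 mat" and \<epsilon> :: 3
  assumes S: "S \<in> carrier_mat n n" and eps: "\<epsilon> = 1 \<or> \<epsilon> = -1"
    and S_sym: "\<And>i j. i < n \<Longrightarrow> j < n \<Longrightarrow> S $$ (j,i) = \<epsilon> * S $$ (i,j)"
    and nondeg': "\<And>x. x \<in> vecs n \<Longrightarrow> (\<And>j. j < n \<Longrightarrow> (\<Sum>i<n. x i * S $$ (i,j)) = 0) \<Longrightarrow> x = 0"
begin

definition B :: "F3vec \<Rightarrow> F3vec \<Rightarrow> 3" where
  "B x y = (\<Sum>i<n. \<Sum>j<n. x i * S $$ (i,j) * y j)"

abbreviation V where "V \<equiv> vecs n"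
abbreviation G where "G \<equiv> isom_group n S"

lemma B_add [simp]: "B (x + y) z = B x z + B y z" "B z (x + y) = B z x + B z y"
  by (simp_all add: B_def fvec algebra_simps sum.distrib)

lemma B_scal [simp]: "B (scal c x) z = c * B x z" "B z (scal c x) = c * B z x"
  by (simp_all add: B_def fvec algebra_simps sum_distrib_left)

lemma B_zero [simp]: "B 0 z = 0" "B z 0 = 0"
  by (simp_all add: B_def fvec)

lemma B_sym: "B y x = \<epsilon> * B x y"
proof -
  have "B y x = (\<Sum>i<n. \<Sum>j<n. \<epsilon> * (x j * S $$ (j,i) * y i))"
    unfolding B_def
  proof (intro sum.cong refl)
    fix i j assume "i \<in> {..<n}" "j \<in> {..<n}"
    then have "S $$ (i,j) = \<epsilon> * S $$ (j,i)" using S_sym[of j i] by simp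
    then show "y i * S $$ (i,j) * x j = \<epsilon> * (x j * S $$ (j,i) * y i)" by (simp add: mult_ac)
  qed
  also have "\<dots> = \<epsilon> * (\<Sum>i<n. \<Sum>j<n. x j * S $$ (j,i) * y i)" by (simp add: sum_distrib_left)
  finally show ?thesis unfolding B_def by (subst (asm) sum.swap)
qed

lemma B_unit_right: "j < n \<Longrightarrow> B x (unit j) = (\<Sum>i<n. x i * S $$ (i,j))"
proof -
  assume j: "j < n"
  have "(\<Sum>k<n. x i * S $$ (i,k) * unit j k) = (\<Sum>k<n. if k = j then x i * S $$ (i,j) else 0)" for i
    by (intro sum.cong) (auto simp: unit_def)
  then show ?thesis using j by (simp add: B_def)
qed

lemma B_units: "i < n \<Longrightarrow> j < n \<Longrightarrow> B (unit i) (unit j) = S $$ (i,j)"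
proof -
  assume ij: "i < n" "j < n"
  have "(\<Sum>k<n. unit i k * S $$ (k,j)) = (\<Sum>k<n. if k = i then S $$ (i,j) else 0)"
    by (intro sum.cong) (auto simp: unit_def)
  then show ?thesis using ij by (simp add: B_unit_right)
qed

lemma nondeg: "x \<in> V \<Longrightarrow> (\<And>y. y \<in> V \<Longrightarrow> B x y = 0) \<Longrightarrow> x = 0"
  by (rule nondeg') (simp_all flip: B_unit_right)

lemma B_act_transpose:
  assumes A: "A \<in> carrier_mat n n"
  shows "B (act n A x) (act n A y) = (\<Sum>i<n. \<Sum>j<n. x i * (transpose_mat A * S * A) $$ (i,j) * y j)"
proof -
  have B_act: "(\<Sum>i<n. \<Sum>j<n. x i * M $$ (i,j) * y j) = (\<Sum>i<n. x i * act n M y i)" for M x y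
    by (simp add: act_def sum_distrib_left mult.assoc)
  have adj: "(\<Sum>i<n. x i * act n (transpose_mat A) z i) = (\<Sum>j<n. act n A x j * z j)" for z
  proof -
    have "(\<Sum>i<n. x i * act n (transpose_mat A) z i) = (\<Sum>i<n. \<Sum>j<n. x i * (A $$ (j,i) * z j))"
      using A by (simp add: act_def sum_distrib_left)
    also have "\<dots> = (\<Sum>j<n. \<Sum>i<n. A $$ (j,i) * x i * z j)" by (subst sum.swap) (simp add: mult_ac)
    finally show ?thesis by (simp add: act_def sum_distrib_right)
  qed
  have "(\<Sum>i<n. \<Sum>j<n. x i * (transpose_mat A * S * A) $$ (i,j) * y j)
      = (\<Sum>i<n. x i * act n (transpose_mat A) (act n S (act n A y)) i)"
    unfolding B_act using A S by (simp add: act_mult)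
  also have "\<dots> = B (act n A x) (act n A y)" by (simp add: adj B_def B_act)
  finally show ?thesis by simp
qed

lemma carrier_iff:
  "A \<in> carrier G \<longleftrightarrow> A \<in> carrier_mat n n \<and> invertible_mat A \<and>
    (\<forall>x\<in>V. \<forall>y\<in>V. B (act n A x) (act n A y) = B x y)"
proof -
  have "(transpose_mat A * S * A = S) \<longleftrightarrow> (\<forall>x\<in>V. \<forall>y\<in>V. B (act n A x) (act n A y) = B x y)"
    if A: "A \<in> carrier_mat n n"
  proof
    assume "transpose_mat A * S * A = S"
    then show "\<forall>x\<in>V. \<forall>y\<in>V. B (act n A x) (act n A y) = B x y" using B_act_transpose[OF A] by (simp add: B_def)
  next
    assume iso: "\<forall>x\<in>V. \<forall>y\<in>V. B (act n A x) (act n A y) = B x y"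
    show "transpose_mat A * S * A = S"
    proof (rule eq_matI)
      fix i j assume "i < dim_row S" "j < dim_col S"
      then have ij: "i < n" "j < n" using S by auto
      have "(\<Sum>k<n. \<Sum>l<n. unit i k * M $$ (k,l) * unit j l) = M $$ (i,j)" for M :: "3 mat"
      proof -
        have "(\<Sum>l<n. unit i k * M $$ (k,l) * unit j l) = (if k = i then M $$ (i,j) else 0)" for k
        proof -
          have "(\<Sum>l<n. unit i k * M $$ (k,l) * unit j l) = (\<Sum>l<n. if l = j then unit i k * M $$ (k,j) else 0)"
            by (intro sum.cong) (auto simp: unit_def)
          then show ?thesis using ij by (simp add: unit_def)
        qed
        then show ?thesis using ij by simp
      qed
      then have "(transpose_mat A * S * A) $$ (i,j) = B (act n A (unit i)) (act n A (unit j))"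
        using B_act_transpose[OF A, of "unit i" "unit j"] by simp
      then show "(transpose_mat A * S * A) $$ (i,j) = S $$ (i,j)" using iso ij B_units by simp
    qed (use A S in auto)
  qed
  then show ?thesis by (auto simp: isom_group_def)
qed

lemma mult_G [simp]: "monoid.mult G A C = A * C" and one_G [simp]: "one G = 1\<^sub>m n"
  by (simp_all add: isom_group_def)

lemma carrier_mat_G: "A \<in> carrier G \<Longrightarrow> A \<in> carrier_mat n n"
  by (simp add: isom_group_def)

lemma mult_mat [simp]: "A \<in> carrier_mat n n \<Longrightarrow> C \<in> carrier_mat n n \<Longrightarrow> A * C \<in> carrier_mat n n"
  by (rule mult_carrier_mat)

lemma carrierI:
  assumes A: "A \<in> carrier_mat n n" "A' \<in> carrier_mat n n" "A * A' = 1\<^sub>m n" "A' * A = 1\<^sub>m n"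
    and iso: "\<And>x y. x \<in> V \<Longrightarrow> y \<in> V \<Longrightarrow> B (act n A x) (act n A y) = B x y"
  shows "A \<in> carrier G"
  unfolding carrier_iff invertible_mat_def inverts_mat_def using assms by (auto intro!: exI[of _ A'])

lemma G_inverse:
  assumes "A \<in> carrier G"
  obtains A' where "A' \<in> carrier G" "A * A' = 1\<^sub>m n" "A' * A = 1\<^sub>m n"
proof -
  have A: "A \<in> carrier_mat n n" "invertible_mat A" and iso: "\<And>x y. x \<in> V \<Longrightarrow> y \<in> V \<Longrightarrow> B (act n A x) (act n A y) = B x y"
    using assms by (auto simp: carrier_iff)
  from A(2) obtain A' where "inverts_mat A A'" "inverts_mat A' A" by (auto simp: invertible_mat_def)
  then have A': "A * A' = 1\<^sub>m n" "A' * A = 1\<^sub>m (dim_row A')" using A(1) by (auto simp: inverts_mat_def)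
  have "dim_row A' = n" using arg_cong[OF A'(2), of dim_col] A(1) by simp
  moreover have "dim_col A' = n" using arg_cong[OF A'(1), of dim_col] by simp
  ultimately have c: "A' \<in> carrier_mat n n" "A' * A = 1\<^sub>m n" using A' by auto
  have "B (act n A' x) (act n A' y) = B x y" if "x \<in> V" "y \<in> V" for x y
    using iso[of "act n A' x" "act n A' y"] that act_mult[OF A(1) c(1)] A'(1) by simp (metis act_one)
  then have "A' \<in> carrier G" using carrierI[OF c(1) A(1) c(2) A'(1)] by blast
  then show thesis using that A'(1) c(2) by blast
qed

lemma group_G: "group G"
proof (rule groupI)
  fix x y z assume x: "x \<in> carrier G"
  note xm = carrier_mat_G[OF x]
  show "\<one>\<^bsub>G\<^esub> \<otimes>\<^bsub>G\<^esub> x = x" using xm by simp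
  show "\<exists>y\<in>carrier G. y \<otimes>\<^bsub>G\<^esub> x = \<one>\<^bsub>G\<^esub>" using G_inverse[OF x] by auto
  assume y: "y \<in> carrier G"
  note ym = carrier_mat_G[OF y]
  obtain x' where x': "x' \<in> carrier G" "x * x' = 1\<^sub>m n" "x' * x = 1\<^sub>m n" using G_inverse[OF x] by blast
  obtain y' where y': "y' \<in> carrier G" "y * y' = 1\<^sub>m n" "y' * y = 1\<^sub>m n" using G_inverse[OF y] by blast
  note xm' = carrier_mat_G[OF x'(1)] and ym' = carrier_mat_G[OF y'(1)]
  have "(x * y) * (y' * x') = x * (y * y') * x'" "(y' * x') * (x * y) = y' * (x' * x) * y"
    using xm ym xm' ym' by (simp_all add: assoc_mult_mat[of _ n n _ n _ n])
  then have "(x * y) * (y' * x') = 1\<^sub>m n" "(y' * x') * (x * y) = 1\<^sub>m n"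
    using x' y' xm ym xm' ym' by simp_all
  then show "x \<otimes>\<^bsub>G\<^esub> y \<in> carrier G"
    using xm ym xm' ym' x y by (auto intro!: carrierI[of "x * y" "y' * x'"] simp: act_mult) (simp add: carrier_iff)
  assume z: "z \<in> carrier G"
  show "x \<otimes>\<^bsub>G\<^esub> y \<otimes>\<^bsub>G\<^esub> z = x \<otimes>\<^bsub>G\<^esub> (y \<otimes>\<^bsub>G\<^esub> z)"
    using xm ym carrier_mat_G[OF z] by (simp add: assoc_mult_mat[of _ n n _ n _ n])
qed (auto intro!: carrierI[of "1\<^sub>m n" "1\<^sub>m n"])

sublocale G: group G by (rule group_G)

lemma finite_G: "finite (carrier G)"
proof -
  have "inj_on (\<lambda>A. restrict (\<lambda>p. A $$ p) ({..<n} \<times> {..<n})) (carrier G)"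
  proof (rule inj_onI)
    fix A C assume AC: "A \<in> carrier G" "C \<in> carrier G"
      "restrict (\<lambda>p. A $$ p) ({..<n} \<times> {..<n}) = restrict (\<lambda>p. C $$ p) ({..<n} \<times> {..<n})"
    show "A = C"
    proof (rule eq_matI)
      fix i j assume "i < dim_row C" "j < dim_col C"
      then have "(i,j) \<in> {..<n} \<times> {..<n}" using carrier_mat_G[OF AC(2)] by auto
      then show "A $$ (i,j) = C $$ (i,j)" using fun_cong[OF AC(3), of "(i,j)"] by simp
    qed (use carrier_mat_G[OF AC(1)] carrier_mat_G[OF AC(2)] in auto)
  qed
  moreover have "(\<lambda>A. restrict (\<lambda>p. A $$ p) ({..<n} \<times> {..<n})) ` carrier G
      \<subseteq> ({..<n} \<times> {..<n}) \<rightarrow>\<^sub>E (UNIV :: 3 set)"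
    by (intro image_subsetI) (simp add: PiE_def)
  ultimately show ?thesis
    by (meson finite_PiE finite_SigmaI finite_lessThan finite_code finite_subset finite_imageD)
qed

text \<open>
  Siegel transformations: the usual coefficient \<open>- B w w / 2\<close> equals \<open>B w w\<close> in characteristic 3.
  For \<open>\<epsilon> = -1\<close> this term is 0 and \<open>psi u u\<close> is a transvection.
\<close>

definition psi :: "F3vec \<Rightarrow> F3vec \<Rightarrow> F3vec \<Rightarrow> F3vec" where
  "psi u w x = x + scal (B x u) w + scal (B w w * B x u - \<epsilon> * B x w) u"

definition E :: "F3vec \<Rightarrow> F3vec \<Rightarrow> 3 mat" where "E u w = mt n (psi u w)"

lemma psi_linear: "psi u w (x + y) = psi u w x + psi u w y" "psi u w (scal c x) = scal c (psi u w x)"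
  by (simp_all add: psi_def fvec algebra_simps)

lemma psi_V [simp]: "u \<in> V \<Longrightarrow> w \<in> V \<Longrightarrow> x \<in> V \<Longrightarrow> psi u w x \<in> V"
  by (simp add: psi_def)

lemma E_mat [simp]: "E u w \<in> carrier_mat n n" by (simp add: E_def)

lemma act_E: "u \<in> V \<Longrightarrow> w \<in> V \<Longrightarrow> x \<in> V \<Longrightarrow> act n (E u w) x = psi u w x"
  unfolding E_def by (rule act_mt) (simp_all add: psi_linear)

lemma psi_isometry:
  assumes "B u u = 0" "B w u = 0"
  shows "B (psi u w x) (psi u w y) = B x y"
proof -
  have "B u w = 0" using assms B_sym[of u w] by simp
  have e: "B w y = \<epsilon> * B y w" "B u y = \<epsilon> * B y u" by (rule B_sym)+
  have alt: "B w w = 0" if "\<epsilon> = -1" using B_sym[of w w] that F3_cases[of "B w w"] by auto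
  show ?thesis
    using eps alt by (auto simp: psi_def assms \<open>B u w = 0\<close> e algebra_simps)
qed

lemma psi_neg:
  assumes "B u u = 0" "B w u = 0"
  shows "psi u w (psi u (scal (-1) w) x) = x"
proof -
  have "B u w = 0" using assms B_sym[of u w] by simp
  have alt: "B w w = 0" if "\<epsilon> = -1" using B_sym[of w w] that F3_cases[of "B w w"] by auto
  show ?thesis
    using eps alt by (auto simp: psi_def assms \<open>B u w = 0\<close> algebra_simps fvec)
qed

lemma E_in_G:
  assumes "u \<in> V" "w \<in> V" "B u u = 0" "B w u = 0"
  shows "E u w \<in> carrier G"
proof (rule carrierI[of _ "E u (scal (-1) w)"])
  show "E u w * E u (scal (-1) w) = 1\<^sub>m n"
    by (rule mat_eq_by_act[of _ n]) (use assms mult_carrier_mat[OF E_mat E_mat] in \<open>auto simp: act_mult act_E psi_neg\<close>)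
  have "psi u (scal (-1) w) (psi u w x) = x" for x
    using psi_neg[of u "scal (-1) w" x] assms by simp
  then show "E u (scal (-1) w) * E u w = 1\<^sub>m n"
    by (intro mat_eq_by_act[of _ n]) (use assms mult_carrier_mat[OF E_mat E_mat] in \<open>auto simp: act_mult act_E\<close>)
qed (use assms in \<open>auto simp: act_E psi_isometry\<close>)

lemma psi_equivariant:
  assumes "A \<in> carrier G" "u \<in> V" "w \<in> V" "x \<in> V"
  shows "act n A (psi u w x) = psi (act n A u) (act n A w) (act n A x)"
  using assms by (simp add: psi_def act_add act_scal carrier_iff)

text \<open>\<open>psi\<close> is built from B and the two vectors alone, so conjugation by an
  isometry only moves these vectors. All conjugacies and commutators below are computed in this
  way.\<close>

lemma E_conj:
  assumes "A \<in> carrier G" "u \<in> V" "w \<in> V"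
  shows "A * E u w = E (act n A u) (act n A w) * A"
  using assms carrier_mat_G[OF assms(1)] mult_carrier_mat[OF E_mat carrier_mat_G[OF assms(1)]]
  by (intro mat_eq_by_act[of _ n]) (auto simp: act_mult act_E psi_equivariant)

end

section \<open>Subspaces, hyperbolic pairs and products of Siegel transformations\<close>

context form
begin

definition subsp :: "F3vec set \<Rightarrow> bool" where
  "subsp Y \<longleftrightarrow> Y \<subseteq> V \<and> 0 \<in> Y \<and> (\<forall>x\<in>Y. \<forall>y\<in>Y. x + y \<in> Y) \<and> (\<forall>c. \<forall>x\<in>Y. scal c x \<in> Y)"

lemma subspD:
  assumes "subsp Y"
  shows "Y \<subseteq> V" "0 \<in> Y" "x \<in> Y \<Longrightarrow> y \<in> Y \<Longrightarrow> x + y \<in> Y" "x \<in> Y \<Longrightarrow> scal c x \<in> Y" "finite Y"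
  using assms finite_subset[OF _ finite_vecs] by (auto simp: subsp_def)

lemma subsp_V: "subsp V" by (simp add: subsp_def)

lemma subsp_perp: "subsp Y \<Longrightarrow> subsp {w \<in> Y. B w u = 0}"
  by (auto simp: subsp_def)

lemma subsp_perp2: "subsp Y \<Longrightarrow> subsp {w \<in> Y. B w u = 0 \<and> B w u' = 0}"
  by (auto simp: subsp_def)

lemma B_swap_zero: "B x y = 0 \<Longrightarrow> B y x = 0"
  using B_sym[of y x] by simp

lemma split_bij:
  assumes Y: "subsp Y" and u: "u \<in> Y" "u' \<in> Y" "B u u = 0" "B u' u' = 0" "B u u' = 1"
  shows "bij_betw (\<lambda>((a,b),w). scal a u + scal b u' + w) (UNIV \<times> {w \<in> Y. B w u = 0 \<and> B w u' = 0}) Y"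
proof -
  let ?P = "{w \<in> Y. B w u = 0 \<and> B w u' = 0}"
  define f where "f = (\<lambda>((a,b),w). scal a u + scal b u' + w)"
  \<comment> \<open>Coordinates with respect to the hyperbolic pair: pairing x = a u + b u' + w with
    u' gives a, and pairing it with u gives b \<epsilon>, since B u' u = \<epsilon>.\<close>
  define g where "g = (\<lambda>x. ((B x u', \<epsilon> * B x u), x + scal (- B x u') u + scal (- (\<epsilon> * B x u)) u'))"
  have u'u: "B u' u = \<epsilon>" using B_sym[of u' u] u by simp
  have "g (f p) = p" if "p \<in> UNIV \<times> ?P" for p
  proof -
    obtain a b w where p: "p = ((a,b),w)" "B w u = 0" "B w u' = 0" using \<open>p \<in> _\<close> by auto
    show ?thesis using u u'u eps p(2,3) unfolding p(1) by (auto simp: f_def g_def fvec algebra_simps)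
  qed
  moreover have "f (g x) = x" for x by (simp add: f_def g_def fvec algebra_simps)
  moreover have "f ` (UNIV \<times> ?P) \<subseteq> Y" using u subspD[OF Y] by (auto simp: f_def)
  moreover have "g ` Y \<subseteq> UNIV \<times> ?P" using u u'u eps subspD[OF Y] by (auto simp: g_def)
  ultimately have "bij_betw f (UNIV \<times> ?P) Y" by (intro bij_betw_byWitness[of _ g]) auto
  then show ?thesis by (simp add: f_def)
qed

lemma split_card:
  assumes Y: "subsp Y" and u: "u \<in> Y" "u' \<in> Y" "B u u = 0" "B u' u' = 0" "B u u' = 1"
  shows "card Y = 9 * card {w \<in> Y. B w u = 0 \<and> B w u' = 0}"
  using bij_betw_same_card[OF split_bij[OF assms]] by (simp add: card_cartesian_product)

lemma scale_to_one:
  assumes "y \<in> V" "B x y \<noteq> 0" shows "\<exists>z\<in>V. B x z = c"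
  using assms F3_square[of "B x y"] by (intro bexI[of _ "scal (c * B x y) y"]) (auto simp: mult.assoc)

lemma exists_dual: "x \<in> V \<Longrightarrow> x \<noteq> 0 \<Longrightarrow> \<exists>y\<in>V. B x y = c"
  using nondeg[of x] scale_to_one by blast

text \<open>The last summand is the Heisenberg cocycle. It vanishes for \<epsilon> = 1; for
  \<epsilon> = -1 it amounts to a power of the transvection \<open>E u u\<close>, the center of the
  Heisenberg group.\<close>

lemma psi_add:
  assumes "B u u = 0" "B w1 u = 0" "B w2 u = 0"
  shows "psi u w1 (psi u w2 x) = psi u (w1 + w2) x + scal ((\<epsilon> - 1) * B w2 w1 * B x u) u"
proof -
  have e: "B u w1 = 0" "B u w2 = 0" using assms B_swap_zero by auto
  have s: "B w1 w2 = \<epsilon> * B w2 w1" by (rule B_sym)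
  show ?thesis
    using eps by (auto simp: psi_def assms e s fvec algebra_simps)
qed

lemma E_add:
  assumes "u \<in> V" "w1 \<in> V" "w2 \<in> V" "B u u = 0" "B w1 u = 0" "B w2 u = 0" "(\<epsilon> - 1) * B w2 w1 = 0"
  shows "E u w1 * E u w2 = E u (w1 + w2)"
  using assms mult_carrier_mat[OF E_mat E_mat]
  by (intro mat_eq_by_act[of _ n]) (auto simp: act_mult act_E psi_add)

lemma E_zero: "u \<in> V \<Longrightarrow> E u 0 = 1\<^sub>m n"
  by (intro mat_eq_by_act[of _ n]) (auto simp: act_E psi_def)

lemma act_in_G: "A \<in> carrier G \<Longrightarrow> x \<in> V \<Longrightarrow> y \<in> V \<Longrightarrow> B (act n A x) (act n A y) = B x y"
  by (simp add: carrier_iff)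

lemma E_conj_inv:
  assumes "A \<in> carrier G" "u \<in> V" "w \<in> V" "B u u = 0" "B w u = 0"
  shows "A * E u w * inv\<^bsub>G\<^esub> A = E (act n A u) (act n A w)"
proof -
  have "E u w \<in> carrier G" "E (act n A u) (act n A w) \<in> carrier G"
    using assms by (auto intro!: E_in_G simp: act_in_G)
  then show ?thesis using E_conj[OF assms(1-3)] assms(1)
    by (metis G.inv_solve_right' mult_G G.m_closed)
qed

end

section \<open>Groups between the derived group and the full isometry group\<close>

locale form_sub = form +
  fixes H
  assumes H: "subgroup H G" and der: "derived G (carrier G) \<subseteq> H"
begin

abbreviation K where "K \<equiv> G\<lparr>carrier := H\<rparr>"

lemma HG: "h \<in> H \<Longrightarrow> h \<in> carrier G" using subgroup.subset[OF H] by blast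

lemma H_mult: "g \<in> H \<Longrightarrow> h \<in> H \<Longrightarrow> g * h \<in> H" using subgroup.m_closed[OF H] by simp

lemma group_K: "group K" by (rule G.subgroup_imp_group[OF H])

text \<open>The equation exhibits k as the commutator of g and h without inverses, so it can be
  checked by plain matrix products.\<close>

lemma commutator_in_H:
  assumes "g \<in> carrier G" "h \<in> carrier G" "k \<in> carrier G" "g * h = k * (h * g)"
  shows "k \<in> H"
proof -
  have "k = g \<otimes>\<^bsub>G\<^esub> h \<otimes>\<^bsub>G\<^esub> inv\<^bsub>G\<^esub> (h \<otimes>\<^bsub>G\<^esub> g)"
    using assms by (metis G.inv_solve_right mult_G G.m_closed)
  also have "\<dots> = g \<otimes>\<^bsub>G\<^esub> h \<otimes>\<^bsub>G\<^esub> inv\<^bsub>G\<^esub> g \<otimes>\<^bsub>G\<^esub> inv\<^bsub>G\<^esub> h"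
    using assms by (simp only: G.inv_mult_group G.m_assoc G.inv_closed G.m_closed)
  finally show ?thesis using der assms(1,2) unfolding derived_def by (auto intro!: generate.incl)
qed

lemma E_inverse:
  assumes "u \<in> V" "w \<in> V" "B u u = 0" "B w u = 0"
  shows "inv\<^bsub>G\<^esub> (E u w) = E u (scal (-1) w)"
proof (rule G.inv_equality)
  have "(\<epsilon> - 1) * B w (scal (-1) w) = 0"
    using eps B_sym[of w w] F3_cases[of "B w w"] by auto
  then show "E u (scal (-1) w) \<otimes>\<^bsub>G\<^esub> E u w = \<one>\<^bsub>G\<^esub>"
    using E_add[of u "scal (-1) w" w] assms E_zero by (simp add: add.commute[of _ w])
qed (use assms in \<open>auto intro: E_in_G\<close>)

lemma E_neg_in_H:
  assumes "u \<in> V" "w \<in> V" "B u u = 0" "B w u = 0" "E u (scal (-1) w) \<in> H"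
  shows "E u w \<in> H"
  using E_inverse[of u "scal (-1) w"] subgroup.m_inv_closed[OF H assms(5)] assms by simp

lemma E_scal_in_H:
  assumes "u \<in> V" "w \<in> V" "B u u = 0" "B w u = 0" "E u w \<in> H"
  shows "E u (scal c w) \<in> H"
proof -
  have "E u (scal (-1) w) \<in> H"
    using E_inverse[OF assms(1-4)] subgroup.m_inv_closed[OF H assms(5)] by simp
  then show ?thesis
    using F3_cases[of c] assms E_zero subgroup.one_closed[OF H] by auto
qed

lemma finite_H: "finite H" using finite_subset[OF subgroup.subset[OF H] finite_G] .

text \<open>The hypothesis \<open>iso\<close> kills the cocycle of \<open>psi_add\<close>, so
  \<open>E u\<close> is additive on Y. It holds automatically for \<epsilon> = 1 and means total
  isotropy for \<epsilon> = -1.\<close>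

lemma E_family_subgroup:
  assumes Y: "subsp Y" and u: "u \<in> V" "B u u = 0" and perp: "\<And>w. w \<in> Y \<Longrightarrow> B w u = 0"
    and iso: "\<And>w w'. w \<in> Y \<Longrightarrow> w' \<in> Y \<Longrightarrow> (\<epsilon> - 1) * B w w' = 0"
    and mem: "\<And>w. w \<in> Y \<Longrightarrow> E u w \<in> H"
  shows "subgroup (E u ` Y) K"
proof (rule group.subgroupI[OF group_K])
  interpret K: group K by (rule group_K)
  note Yd = subspD[OF Y]
  show "E u ` Y \<subseteq> carrier K" using mem by auto
  show "E u ` Y \<noteq> {}" using Yd by auto
  fix a b assume "a \<in> E u ` Y"
  then obtain w where w: "a = E u w" "w \<in> Y" by auto
  have "inv\<^bsub>K\<^esub> a = inv\<^bsub>G\<^esub> a" using G.m_inv_consistent[OF H] mem w by simp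
  also have "\<dots> = E u (scal (-1) w)" using E_inverse w u perp Yd by blast
  finally show "inv\<^bsub>K\<^esub> a \<in> E u ` Y" using Yd w by auto
  assume "b \<in> E u ` Y"
  then obtain w' where w': "b = E u w'" "w' \<in> Y" by auto
  have "a * b = E u (w + w')" unfolding w w' using w w' u perp iso Yd by (intro E_add) auto
  then show "a \<otimes>\<^bsub>K\<^esub> b \<in> E u ` Y" using Yd w w' by simp
qed

text \<open>
  Choosing an orbit whose 2-part is at most that of \<open>card T\<close> avoids proving that \<open>H\<close> acts
  transitively on \<open>T\<close>.
\<close>

lemma exists_small_class_H:
  assumes "T \<subseteq> H" "T \<noteq> {}" and "\<And>g t. g \<in> H \<Longrightarrow> t \<in> T \<Longrightarrow> g * t * inv\<^bsub>G\<^esub> g \<in> T"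
    and bound: "(2::nat) ^ multiplicity 2 (card T) < N"
  shows "\<exists>t\<in>T. (2::nat) ^ multiplicity 2 (Coset.order K) < N * (2::nat) ^ multiplicity 2 (card {g \<in> carrier K. g \<otimes>\<^bsub>K\<^esub> t = t \<otimes>\<^bsub>K\<^esub> g})"
proof -
  interpret K: group K by (rule group_K)
  have "\<exists>t\<in>T. multiplicity 2 (Coset.order K) \<le> multiplicity 2 (card T) + multiplicity 2 (card {g \<in> carrier K. g \<otimes>\<^bsub>K\<^esub> t = t \<otimes>\<^bsub>K\<^esub> g})"
  proof (rule K.exists_small_class)
    fix g t assume "g \<in> carrier K" "t \<in> T"
    then show "g \<otimes>\<^bsub>K\<^esub> t \<otimes>\<^bsub>K\<^esub> inv\<^bsub>K\<^esub> g \<in> T" using assms(3) G.m_inv_consistent[OF H] by simp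
  qed (use assms finite_H in auto)
  then obtain t where t: "t \<in> T" "multiplicity 2 (Coset.order K) \<le> multiplicity 2 (card T) + multiplicity 2 (card {g \<in> carrier K. g \<otimes>\<^bsub>K\<^esub> t = t \<otimes>\<^bsub>K\<^esub> g})" by blast
  have "(2::nat) ^ multiplicity 2 (Coset.order K) \<le> (2::nat) ^ (multiplicity 2 (card T) + multiplicity 2 (card {g \<in> carrier K. g \<otimes>\<^bsub>K\<^esub> t = t \<otimes>\<^bsub>K\<^esub> g}))"
    using t(2) by (intro power_increasing) auto
  also have "\<dots> < N * (2::nat) ^ multiplicity 2 (card {g \<in> carrier K. g \<otimes>\<^bsub>K\<^esub> t = t \<otimes>\<^bsub>K\<^esub> g})"
    using bound by (simp add: power_add)
  finally show ?thesis using t(1) by blast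
qed

text \<open>The image of u' under \<open>E u w\<close> determines w: up to u' it is c w plus a
  multiple of u. Pairing with u' isolates \<open>B w w\<close>, hence the multiple of u, and what
  remains is c w.\<close>

lemma card_E_image:
  assumes Y: "Y \<subseteq> V" and u: "u \<in> V" "u' \<in> V" "B u' u = c" "c \<noteq> 0" and perp: "\<And>w. w \<in> Y \<Longrightarrow> B w u = 0 \<and> B w u' = 0"
  shows "card (E u ` Y) = card Y"
proof (rule card_image, rule inj_onI)
  fix w w' assume w: "w \<in> Y" "w' \<in> Y" "E u w = E u w'"
  have p: "B u' w = 0" "B u' w' = 0" using perp[OF w(1)] perp[OF w(2)] B_swap_zero by auto
  have cc: "c * c = 1" using F3_square u by simp
  have wV: "w \<in> V" "w' \<in> V" using w Y by auto
  have "psi u w u' = psi u w' u'"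
    using act_E[OF u(1) wV(1) u(2)] act_E[OF u(1) wV(2) u(2)] w(3) by simp
  then have eq: "scal c w + scal (B w w * c) u = scal c w' + scal (B w' w' * c) u"
    using p u by (simp add: psi_def fvec add.assoc)
  from arg_cong[OF eq, of "\<lambda>x. B x u'"] have "B w w * c * B u u' = B w' w' * c * B u u'"
    using perp w by simp
  moreover have "B u u' * B u u' = 1" using B_sym[of u u'] u cc eps by auto
  ultimately have "B w w = B w' w'"
    using cc F3_cases[of c] F3_cases[of "B u u'"] by auto
  with eq have "scal c w = scal c w'" by simp
  from arg_cong[OF this, of "scal c"] show "w = w'" by (simp add: cc)
qed

end

section \<open>Symplectic groups\<close>

context form
begin

text \<open>The induction carries an isotropic W inside a space Z orthogonal to W. Each step adds
  some x in Z outside W and cuts Z down to the vectors orthogonal to x, which loses at most a factor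
  3. Everything is phrased by cardinalities instead of dimensions.\<close>

lemma exists_isotropic:
  assumes alt: "\<And>x. B x x = 0" and Y: "subsp Y" and "3 ^ (2 * j) \<le> card Y"
  shows "\<exists>W. subsp W \<and> W \<subseteq> Y \<and> card W = 3 ^ j \<and> (\<forall>w\<in>W. \<forall>w'\<in>W. B w w' = 0)"
proof -
  have "\<exists>W Z. subsp W \<and> subsp Z \<and> W \<subseteq> Z \<and> Z \<subseteq> Y \<and> card W = 3 ^ j \<and> card Y \<le> card Z * 3 ^ j
      \<and> (\<forall>w\<in>W. \<forall>z\<in>Z. B z w = 0)"
    using assms(3)
  proof (induction j)
    case 0
    have "subsp {0}" by (simp add: subsp_def)
    then show ?case using Y subspD[OF Y] by (intro exI[of _ "{0}"] exI[of _ Y]) simp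
  next
    case (Suc j)
    have "(3::nat) ^ (2 * j) \<le> 3 ^ (2 * Suc j)" by (intro power_increasing) auto
    with Suc obtain W Z where WZ: "subsp W" "subsp Z" "W \<subseteq> Z" "Z \<subseteq> Y" "card W = 3 ^ j"
      "card Y \<le> card Z * 3 ^ j" "\<forall>w\<in>W. \<forall>z\<in>Z. B z w = 0" by (meson le_trans)
    \<comment> \<open>Otherwise |Y| would be at most 3^(2j). The strict inequality provides a vector
      of Z outside W.\<close>
    have "3 ^ j < card Z"
    proof (rule ccontr)
      assume "\<not> 3 ^ j < card Z"
      then have "card Z * 3 ^ j \<le> 3 ^ j * 3 ^ j" by simp
      then have "(3::nat) ^ (2 * Suc j) \<le> 3 ^ j * 3 ^ j"
        using WZ(6) Suc.prems by linarith
      then have "3 ^ (2 * Suc j) \<le> (3::nat) ^ (2 * j)"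
        by (simp only: mult_2 power_add)
      then show False by simp
    qed
    then obtain x where x: "x \<in> Z" "x \<notin> W" using WZ(5) by (metis less_irrefl subsetI subset_antisym WZ(3))
    define Z' where "Z' = {z \<in> Z. B z x = 0}"
    define f where "f = (\<lambda>(w,c). w + scal c x)"
    define W' where "W' = f ` (W \<times> UNIV)"
    have sZ: "subsp Z'" unfolding Z'_def by (rule subsp_perp[OF WZ(2)])
    note Wd = subspD[OF WZ(1)] and Zd = subspD[OF WZ(2)]
    have wV: "a \<in> V" if "a \<in> W" for a using that Wd by blast
    have zV: "a \<in> V" if "a \<in> Z" for a using that Zd by blast
    have sW: "subsp W'"
      unfolding subsp_def
    proof (intro conjI ballI allI)
      show "W' \<subseteq> V" using wV zV[OF x(1)] by (auto simp: W'_def f_def)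
      show "0 \<in> W'" using Wd by (auto simp: W'_def f_def image_iff intro!: bexI[of _ 0] exI[of _ 0])
      fix a b assume "a \<in> W'"
      then obtain w c where a: "a = w + scal c x" "w \<in> W" by (auto simp: W'_def f_def)
      show "scal d a \<in> W'" for d
        unfolding W'_def by (rule image_eqI[of _ _ "(scal d w, d * c)"]) (use a Wd in \<open>auto simp: f_def fvec algebra_simps\<close>)
      assume "b \<in> W'"
      then obtain w' c' where b: "b = w' + scal c' x" "w' \<in> W" by (auto simp: W'_def f_def)
      show "a + b \<in> W'"
        unfolding W'_def by (rule image_eqI[of _ _ "(w + w', c + c')"]) (use a b Wd in \<open>auto simp: f_def fvec algebra_simps\<close>)
    qed
    have "inj_on f (W \<times> UNIV)"
    proof (rule inj_onI)
      fix p q assume "p \<in> W \<times> UNIV" "q \<in> W \<times> UNIV" "f p = f q"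
      then obtain w c w' c' where pq: "p = (w,c)" "q = (w',c')" "w \<in> W" "w' \<in> W" "w + scal c x = w' + scal c' x"
        by (auto simp: f_def)
      have eqi: "w i + c * x i = w' i + c' * x i" for i using fun_cong[OF pq(5), of i] by (simp add: fvec)
      have e: "(c - c') * x i = w' i + - 1 * w i" for i
      proof -
        have "(c - c') * x i = (w i + c * x i) - (w' i + c' * x i) + (w' i - w i)" by (simp add: algebra_simps)
        then show ?thesis using eqi[of i] by simp
      qed
      show "p = q"
      proof (cases "c = c'")
        case True
        then show ?thesis using pq by simp
      next
        case False
        then have "(c - c') * (c - c') = 1" using F3_square by simp
        then have "x i = (c - c') * (w' i + - 1 * w i)" for i
          unfolding e[symmetric] by (simp flip: mult.assoc)
        then have "x = scal (c - c') (w' + scal (-1) w)"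
          by (simp only: fvec) simp
        then have "x \<in> W" using pq Wd by metis
        then show ?thesis using x by simp
      qed
    qed
    then have cW: "card W' = 3 ^ Suc j"
      unfolding W'_def using WZ(5) by (simp add: card_image card_cartesian_product)
    have "W' \<subseteq> Z'" using WZ(3,7) Wd Zd x alt B_swap_zero by (auto simp: W'_def Z'_def f_def)
    moreover have "card Y \<le> card Z' * 3 ^ Suc j"
    proof -
      \<comment> \<open>Subtracting a fixed element of a fibre of B(., x) embeds that fibre into Z',
        and there are three fibres.\<close>
      have fibre: "card {z \<in> Z. B z x = c} \<le> card Z'" for c
      proof (cases "{z \<in> Z. B z x = c} = {}")
        case False
        then obtain z0 where z0: "z0 \<in> Z" "B z0 x = c" by auto
        show ?thesis
          by (rule card_inj_on_le[of "\<lambda>z. z + scal (-1) z0"])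
            (use z0 Zd subspD(5)[OF sZ] in \<open>auto simp: Z'_def inj_on_def\<close>)
      qed (use card.empty in \<open>metis zero_le\<close>)
      have "Z = (\<Union>c\<in>UNIV. {z \<in> Z. B z x = c})" by auto
      then have "card Z \<le> (\<Sum>c\<in>(UNIV::3 set). card {z \<in> Z. B z x = c})"
        using card_UN_le[of "UNIV :: 3 set" "\<lambda>c. {z \<in> Z. B z x = c}"] by simp
      also have "\<dots> \<le> (\<Sum>c\<in>(UNIV::3 set). card Z')" by (intro sum_mono fibre)
      finally have "card Z \<le> 3 * card Z'" by simp
      then have "card Z * 3 ^ j \<le> card Z' * 3 ^ Suc j" by simp
      then show ?thesis using WZ(6) by linarith
    qed
    moreover have "\<forall>w\<in>W'. \<forall>z\<in>Z'. B z w = 0" using WZ(7) by (auto simp: W'_def Z'_def f_def)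
    ultimately show ?case using sW sZ cW WZ(4) by (intro exI[of _ W'] exI[of _ Z']) (auto simp: Z'_def)
  qed
  then show ?thesis by (metis subset_iff)
qed

end

locale symplectic_sub = form_sub +
  assumes eps_neg: "\<epsilon> = -1"
begin

lemma alt [simp]: "B x x = 0"
  using B_sym[of x x] eps_neg F3_cases[of "B x x"] by auto

lemma B_anti: "B y x = - B x y"
  using B_sym[of y x] eps_neg by simp

lemma psi_sp: "psi u w x = x + scal (B x u) w + scal (B x w) u"
  unfolding psi_def by (simp add: eps_neg)

lemma psi_self: "psi u u x = x + scal (- B x u) u"
  unfolding psi_sp by (simp add: fvec algebra_simps)

text \<open>For w0, w1 orthogonal to u and u' with B w0 w1 = 1, the commutator of
  \<open>E u w1\<close> and \<open>E u w0\<close> is the transvection \<open>E u u\<close>. For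
  general w, the commutator of the transvection \<open>E w w\<close> with \<open>E u w'\<close>,
  where B w w' = 1, is \<open>E u w\<close> up to the inverse of \<open>E u u\<close>, which is
  already known to lie in H.\<close>

lemma transvections_in_H:
  assumes uu': "u \<in> V" "u' \<in> V" "B u u' = 1" and W: "card {w \<in> V. B w u = 0 \<and> B w u' = 0} > 1"
  shows "E u u \<in> H" "\<And>w. w \<in> V \<Longrightarrow> B w u = 0 \<Longrightarrow> B w u' = 0 \<Longrightarrow> E u w \<in> H"
    and "\<And>w c. w \<in> V \<Longrightarrow> B w u = 0 \<Longrightarrow> B w u' = 0 \<Longrightarrow> w \<noteq> 0 \<Longrightarrow> \<exists>w'\<in>V. B w' u = 0 \<and> B w' u' = 0 \<and> B w w' = c"
proof -
  show dual: "\<exists>w'\<in>V. B w' u = 0 \<and> B w' u' = 0 \<and> B w w' = c"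
    if w: "w \<in> V" "B w u = 0" "B w u' = 0" "w \<noteq> 0" for w c
  proof -
    obtain y where y: "y \<in> V" "B w y = c" using exists_dual w by blast
    have "B u' u = -1" using B_anti[of u' u] uu' by simp
    then show ?thesis
      \<comment> \<open>The witness is the projection of y to the complement of u and u'; this does
        not change its product with w.\<close>
      using y w uu' by (intro bexI[of _ "y + scal (- B y u') u + scal (B y u) u'"]) auto
  qed
  obtain w0 where w0: "w0 \<in> V" "B w0 u = 0" "B w0 u' = 0" "w0 \<noteq> 0"
  proof -
    have "\<not> {w \<in> V. B w u = 0 \<and> B w u' = 0} \<subseteq> {0}"
      using W card_mono[of "{0::F3vec}" "{w \<in> V. B w u = 0 \<and> B w u' = 0}"] by auto
    then show thesis using that by blast
  qed
  obtain w1 where w1: "w1 \<in> V" "B w1 u = 0" "B w1 u' = 0" "B w0 w1 = 1" using dual[OF w0] by blast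
  show t: "E u u \<in> H"
  proof (rule commutator_in_H)
    have G: "E u w1 \<in> carrier G" "E u w0 \<in> carrier G" "E u u \<in> carrier G"
      using uu' w0 w1 by (auto intro: E_in_G)
    then show "E u w1 \<in> carrier G" "E u w0 \<in> carrier G" "E u u \<in> carrier G" .
    have "act n (E u w1) u = u" "act n (E u w1) w0 = w0 + u"
      using uu' w0 w1 B_swap_zero[OF w1(2)] by (auto simp: act_E psi_sp)
    then have "E u w1 * E u w0 = E u (w0 + u) * E u w1"
      using E_conj[OF G(1) uu'(1) w0(1)] by simp
    also have "E u (w0 + u) = E u u * E u w0"
      using E_add[of u u w0] uu' w0 by (simp add: add.commute)
    finally show "E u w1 * E u w0 = E u u * (E u w0 * E u w1)"
      by (simp add: assoc_mult_mat[OF E_mat E_mat E_mat])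
  qed
  fix w assume w: "w \<in> V" "B w u = 0" "B w u' = 0"
  show "E u w \<in> H"
  proof (cases "w = 0")
    case True
    then show ?thesis using E_zero uu' subgroup.one_closed[OF H] by simp
  next
    case False
    then obtain w' where w': "w' \<in> V" "B w' u = 0" "B w' u' = 0" "B w w' = 1" using dual w by blast
    have ww: "B w' w = -1" using B_anti[of w' w] w' by simp
    have uw: "B u w = 0" using w B_swap_zero by blast
    have uw': "B u w' = 0" using w' B_swap_zero by blast
    let ?k = "E u (scal (-1) u) * E u w"
    have G: "E w w \<in> carrier G" "E u w \<in> carrier G" "E u w' \<in> carrier G" "E u (scal (-1) u) \<in> carrier G"
      using uu' w w' by (auto intro: E_in_G)
    have "?k \<in> H"
    proof (rule commutator_in_H[OF G(1) G(3)])
      show "?k \<in> carrier G" using G.m_closed[OF G(4) G(2)] by simp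
      have "act n (E w w) u = u" "act n (E w w) w' = w' + w"
        using uu' w w' uw ww by (auto simp: act_E psi_self)
      then have *: "E w w * E u w' = E u (w' + w) * E w w"
        using E_conj[OF G(1) uu'(1) w'(1)] by simp
      have "E u (w' + w) = ?k * E u w'"
      proof (rule mat_eq_by_act[of _ n])
        fix x assume x: "x \<in> V"
        have "act n (?k * E u w') x = psi u (scal (-1) u) (psi u w (psi u w' x))"
          using x uu' w w' by (simp add: act_mult act_E)
        also have "\<dots> = psi u (w' + w) x"
          using w w' uu' uw uw' ww by (simp add: psi_sp fvec algebra_simps)
        finally show "act n (E u (w' + w)) x = act n (?k * E u w') x"
          using x uu' w w' by (simp add: act_E)
      qed auto
      then show "E w w * E u w' = ?k * (E u w' * E w w)"
        unfolding * by (simp add: assoc_mult_mat[of _ n n _ n _ n])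
    qed
    then have "E u u * ?k \<in> H" using t H_mult by blast
    also have "E u u * ?k = (E u u * E u (scal (-1) u)) * E u w"
      by (simp add: assoc_mult_mat[OF E_mat E_mat E_mat])
    also have "E u u * E u (scal (-1) u) = 1\<^sub>m n"
      using E_add[of u u "scal (-1) u"] uu' E_zero by simp
    also have "1\<^sub>m n * E u w = E u w" by (rule left_mult_one_mat[OF E_mat])
    finally show ?thesis .
  qed
qed

text \<open>The complement of a hyperbolic pair has 9^(m-1) elements, but because of the cocycle A
  has to come from a totally isotropic subspace of it. This is why r is m - 1 and not 2m -
  2.\<close>

theorem symplectic_obstruction:
  assumes n: "n = 2 * m" "m \<ge> 2"
    and small: "2 ^ multiplicity 2 (card ((\<lambda>u. E u u) ` (V - {0}))) < (3::nat) ^ (m - 1)"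
  shows "\<exists>t s A. heisenberg_obstruction K t s A"
proof -
  interpret K: group K by (rule group_K)
  have hyp: "\<exists>u'\<in>V. B u u' = 1" if "u \<in> V" "u \<noteq> 0" for u using exists_dual that by blast
  have cardW: "card {w \<in> V. B w u = 0 \<and> B w u' = 0} = 9 ^ (m - 1)" if u: "u \<in> V" "u' \<in> V" "B u u' = 1" for u u'
  proof -
    have "3 ^ n = 9 * card {w \<in> V. B w u = 0 \<and> B w u' = 0}"
      using split_card[OF subsp_V u(1,2) alt alt u(3)] card_vecs by simp
    moreover have "(3::nat) ^ n = 9 * 9 ^ (m - 1)"
      using n by (simp add: power_mult flip: power_Suc)
    ultimately show ?thesis by simp
  qed
  have big: "card {w \<in> V. B w u = 0 \<and> B w u' = 0} > 1" if u: "u \<in> V" "u' \<in> V" "B u u' = 1" for u u'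
    using cardW[OF u] n one_less_power[of "9::nat" "m - 1"] by simp
  let ?T = "(\<lambda>u. E u u) ` (V - {0})"
  have "\<exists>t\<in>?T. (2::nat) ^ multiplicity 2 (Coset.order K) < 3 ^ (m - 1) * 2 ^ multiplicity 2 (card {g \<in> carrier K. g \<otimes>\<^bsub>K\<^esub> t = t \<otimes>\<^bsub>K\<^esub> g})"
  proof (rule exists_small_class_H[OF _ _ _ small])
    show "?T \<subseteq> H" using hyp transvections_in_H(1) big by fastforce
    have "n > 0" using n by simp
    then have "unit 0 \<in> V - {0}" by (auto simp: unit_def fvec vecs_def)
    then show "?T \<noteq> {}" by blast
    fix g t assume g: "g \<in> H" "t \<in> ?T"
    then obtain u where u: "u \<in> V" "u \<noteq> 0" "t = E u u" by auto
    obtain u' where u': "u' \<in> V" "B u u' = 1" using hyp u by blast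
    have "B (act n g u) (act n g u') = 1" using act_in_G[OF HG[OF g(1)] u(1) u'(1)] u' by simp
    then have "act n g u \<noteq> 0" by auto
    then show "g * t * inv\<^bsub>G\<^esub> g \<in> ?T"
      using E_conj_inv[OF HG[OF g(1)] u(1) u(1)] u by auto
  qed
  then obtain u where u: "u \<in> V" "u \<noteq> 0"
    and sm: "(2::nat) ^ multiplicity 2 (Coset.order K) < 3 ^ (m - 1) * 2 ^ multiplicity 2 (card {g \<in> carrier K. g \<otimes>\<^bsub>K\<^esub> E u u = E u u \<otimes>\<^bsub>K\<^esub> g})"
    by auto
  obtain u' where u': "u' \<in> V" "B u u' = 1" using hyp u by blast
  have u'u: "B u' u = -1" using B_anti[of u' u] u' by simp
  let ?W = "{w \<in> V. B w u = 0 \<and> B w u' = 0}"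
  note mem = transvections_in_H[OF u(1) u' big[OF u(1) u']]
  have "(3::nat) ^ (2 * (m - 1)) \<le> card ?W" using cardW[OF u(1) u'] by (simp add: power_mult)
  from exists_isotropic[OF alt subsp_perp2[OF subsp_V] this]
  obtain W0 where W0: "subsp W0" "W0 \<subseteq> ?W" "card W0 = 3 ^ (m - 1)" "\<forall>w\<in>W0. \<forall>w'\<in>W0. B w w' = 0" by blast
  \<comment> \<open>The pair (u', -u) is again hyperbolic, with the same complement.\<close>
  have s_in: "E u' u' \<in> H"
  proof (rule transvections_in_H(1)[of u' "scal (-1) u"])
    show "card {w \<in> V. B w u' = 0 \<and> B w (scal (-1) u) = 0} > 1"
      using big[OF u(1) u'] by (simp add: conj_commute)
  qed (use u u' u'u in auto)
  have cardA: "card (E u ` W0) = 3 ^ (m - 1)"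
    using card_E_image[of W0 u u' "-1"] W0 u u' u'u by auto
  have "heisenberg_obstruction K (E u u) (E u' u') (E u ` W0)"
  proof (intro heisenberg_obstruction.intro heisenberg_obstruction_axioms.intro K.group_axioms)
    show "finite (carrier K)" using finite_H by simp
    show "E u u \<in> carrier K" "E u' u' \<in> carrier K" using mem s_in by auto
    have "E u u * E u u * E u u = 1\<^sub>m n"
      by (rule mat_eq_by_act[of _ n]) (use u in \<open>auto simp: act_mult act_E psi_self fvec algebra_simps\<close>)
    then show "E u u [^]\<^bsub>K\<^esub> (3::nat) = \<one>\<^bsub>K\<^esub>" by (simp add: numeral_3_eq_3 left_mult_one_mat[OF E_mat])
    show "subgroup (E u ` W0) K"
      using W0 u mem(2) by (intro E_family_subgroup) auto
    show "odd (card (E u ` W0))" using cardA by simp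
    show "2 ^ multiplicity 2 (Coset.order K)
        < card (E u ` W0) * 2 ^ multiplicity 2 (card {g \<in> carrier K. g \<otimes>\<^bsub>K\<^esub> E u u = E u u \<otimes>\<^bsub>K\<^esub> g})"
      using sm unfolding cardA .
    have tA: "E u w * E u u = E u (w + u)" "E u u * E u w = E u (w + u)" if "w \<in> V" "B w u = 0" for w
      using E_add[of u w u] E_add[of u u w] that u B_swap_zero[of w u] by (auto simp: add.commute)
    show "a \<otimes>\<^bsub>K\<^esub> E u u = E u u \<otimes>\<^bsub>K\<^esub> a" if "a \<in> E u ` W0" for a
      using that W0(2) tA by auto
    show "\<exists>b\<in>carrier K. b \<otimes>\<^bsub>K\<^esub> E u u = E u u \<otimes>\<^bsub>K\<^esub> b \<and> b \<otimes>\<^bsub>K\<^esub> a = a \<otimes>\<^bsub>K\<^esub> E u u \<otimes>\<^bsub>K\<^esub> b"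
      if a: "a \<in> E u ` W0" "a \<noteq> \<one>\<^bsub>K\<^esub>" for a
    proof -
      obtain w where w: "a = E u w" "w \<in> W0" using a by auto
      then have wV: "w \<in> V" "B w u = 0" "B w u' = 0" using W0(2) by auto
      have "w \<noteq> 0" using a(2) w E_zero u by auto
      \<comment> \<open>b = \<open>E u w'\<close> fixes u and sends w to w + u, so it centralizes t
        and conjugates \<open>E u w\<close> to \<open>E u (w + u)\<close>, which is a t.\<close>
      then obtain w' where w': "w' \<in> V" "B w' u = 0" "B w' u' = 0" "B w w' = 1" using mem(3) wV by blast
      have bH: "E u w' \<in> H" using mem(2) w' by blast
      have "act n (E u w') u = u" "act n (E u w') w = w + u"
        using u w' wV B_swap_zero[OF w'(2)] by (auto simp: act_E psi_sp)
      then have "E u w' * E u u = E u u * E u w'" "E u w' * E u w = E u (w + u) * E u w'"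
        using E_conj[OF HG[OF bH] u(1) u(1)] E_conj[OF HG[OF bH] u(1) wV(1)] by auto
      then show ?thesis using bH tA[OF wV(1,2)] w by (intro bexI[of _ "E u w'"]) auto
    qed
    let ?w = "E u u * E u' u' * E u u"
    have wm: "?w \<in> carrier_mat n n" by auto
    \<comment> \<open>The Weyl element: it sends u to -u' and u' to u, and fixes the complement. Its
      square is -1 on the plane of u and u'.\<close>
    have act_w: "act n ?w x = x + scal (- B x u - B x u') u + scal (B x u - B x u') u'" if "x \<in> V" for x
    proof -
      have "act n ?w x = psi u u (psi u' u' (psi u u x))"
        using that u u' by (simp add: act_mult act_E)
      also have "\<dots> = x + scal (- B x u - B x u') u + scal (B x u - B x u') u'"
        using u' u'u by (simp add: psi_self fvec algebra_simps)
      finally show ?thesis .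
    qed
    show "E u u \<otimes>\<^bsub>K\<^esub> E u' u' \<otimes>\<^bsub>K\<^esub> E u u = E u' u' \<otimes>\<^bsub>K\<^esub> E u u \<otimes>\<^bsub>K\<^esub> E u' u'"
    proof -
      have "?w = E u' u' * E u u * E u' u'"
      proof (rule mat_eq_by_act[OF wm])
        fix x assume x: "x \<in> V"
        have "act n (E u' u' * E u u * E u' u') x = psi u' u' (psi u u (psi u' u' x))"
          using x u u' by (simp add: act_mult act_E)
        also have "\<dots> = x + scal (- B x u - B x u') u + scal (B x u - B x u') u'"
          using u' u'u by (simp add: psi_self fvec algebra_simps)
        finally show "act n ?w x = act n (E u' u' * E u u * E u' u') x" using act_w x by simp
      qed auto
      then show ?thesis by simp
    qed
    have ww: "?w * ?w \<in> carrier_mat n n" using wm by simp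
    have act_ww: "act n (?w * ?w) x = x + scal (B x u') u + scal (- B x u) u'" if "x \<in> V" for x
    proof -
      have "act n (?w * ?w) x = act n ?w (act n ?w x)" using wm by (simp add: act_mult)
      also have "\<dots> = x + scal (B x u') u + scal (- B x u) u'"
        using that u u' u'u by (simp add: act_w) (simp add: fvec algebra_simps)
      finally show ?thesis .
    qed
    have "?w * ?w * (?w * ?w) = 1\<^sub>m n"
    proof (rule mat_eq_by_act[of _ n])
      fix x assume x: "x \<in> V"
      show "act n (?w * ?w * (?w * ?w)) x = act n (1\<^sub>m n) x"
        using x u u' u'u by (simp add: act_mult[OF ww ww] act_ww) (simp add: fvec algebra_simps)
    qed (use ww in auto)
    then have "?w * ?w * ?w * ?w = 1\<^sub>m n" using assoc_mult_mat[OF ww wm wm] by simp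
    then show "(E u u \<otimes>\<^bsub>K\<^esub> E u' u' \<otimes>\<^bsub>K\<^esub> E u u) [^]\<^bsub>K\<^esub> (4::nat) = \<one>\<^bsub>K\<^esub>"
      using left_mult_one_mat[OF wm] by (simp add: eval_nat_numeral)
    show "E u u \<otimes>\<^bsub>K\<^esub> E u' u' \<otimes>\<^bsub>K\<^esub> E u u \<otimes>\<^bsub>K\<^esub> E u u \<noteq> E u u \<otimes>\<^bsub>K\<^esub> (E u u \<otimes>\<^bsub>K\<^esub> E u' u' \<otimes>\<^bsub>K\<^esub> E u u)"
    proof
      assume "E u u \<otimes>\<^bsub>K\<^esub> E u' u' \<otimes>\<^bsub>K\<^esub> E u u \<otimes>\<^bsub>K\<^esub> E u u = E u u \<otimes>\<^bsub>K\<^esub> (E u u \<otimes>\<^bsub>K\<^esub> E u' u' \<otimes>\<^bsub>K\<^esub> E u u)"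
      \<comment> \<open>Evaluated at u' and paired with u, the two products give 1 and 0.\<close>
      then have "act n (?w * E u u) u' = act n (E u u * ?w) u'" by simp
      then have "act n ?w (psi u u u') = psi u u (act n ?w u')"
        using wm u u' by (simp add: act_mult act_E)
      then have "B (act n ?w (psi u u u')) u = B (psi u u (act n ?w u')) u" by simp
      then show False using u u' u'u by (simp add: act_w psi_self)
    qed
  qed
  then show ?thesis by blast
qed

end

section \<open>Orthogonal groups\<close>

locale orthogonal_sub = form_sub +
  assumes eps_pos: "\<epsilon> = 1"
begin

lemma B_com: "B y x = B x y"
  using B_sym[of y x] eps_pos by simp

lemma psi_orth: "psi u w x = x + scal (B x u) w + scal (B w w * B x u - B x w) u"
  unfolding psi_def by (simp add: eps_pos)

text \<open>Ordered bases of totally singular planes.\<close>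

definition pair :: "F3vec \<Rightarrow> F3vec \<Rightarrow> bool" where
  "pair u v \<longleftrightarrow> u \<in> V \<and> v \<in> V \<and> B u u = 0 \<and> B v v = 0 \<and> B u v = 0 \<and> u \<noteq> 0 \<and> (\<forall>c. v \<noteq> scal c u)"

text \<open>Two mutually orthogonal hyperbolic pairs (u, u') and (v, v').\<close>

definition quad :: "F3vec \<Rightarrow> F3vec \<Rightarrow> F3vec \<Rightarrow> F3vec \<Rightarrow> bool" where
  "quad u v u' v' \<longleftrightarrow> u \<in> V \<and> v \<in> V \<and> u' \<in> V \<and> v' \<in> V
     \<and> B u u = 0 \<and> B v v = 0 \<and> B u' u' = 0 \<and> B v' v' = 0
     \<and> B u v = 0 \<and> B u' v' = 0 \<and> B u v' = 0 \<and> B u' v = 0 \<and> B u u' = 1 \<and> B v v' = 1"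

text \<open>The set is nested so that \<open>subsp_perp2\<close> and \<open>split_card\<close> apply
  twice, once for each hyperbolic pair.\<close>

definition perp4 :: "F3vec \<Rightarrow> F3vec \<Rightarrow> F3vec \<Rightarrow> F3vec \<Rightarrow> F3vec set" where
  "perp4 u v u' v' = {w \<in> {w \<in> V. B w u = 0 \<and> B w u' = 0}. B w v = 0 \<and> B w v' = 0}"

lemma quad_B:
  assumes "quad u v u' v'"
  shows "u \<in> V" "v \<in> V" "u' \<in> V" "v' \<in> V"
    and "B u u = 0" "B v v = 0" "B u' u' = 0" "B v' v' = 0"
    "B u v = 0" "B v u = 0" "B u' v' = 0" "B v' u' = 0" "B u v' = 0" "B v' u = 0" "B u' v = 0" "B v u' = 0"
    "B u u' = 1" "B u' u = 1" "B v v' = 1" "B v' v = 1"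
  using assms B_com[of v u] B_com[of v' u'] B_com[of v' u] B_com[of v u'] B_com[of u' u] B_com[of v' v]
  unfolding quad_def by simp_all

lemma quad_swap:
  assumes "quad u v u' v'" shows "quad v u v' u'" "quad u' v' u v"
  using quad_B[OF assms] by (simp_all add: quad_def)

lemma perp4_swap: "perp4 v u v' u' = perp4 u v u' v'" "perp4 u' v' u v = perp4 u v u' v'"
  by (auto simp: perp4_def)

lemma perp4_D:
  assumes "w \<in> perp4 u v u' v'"
  shows "w \<in> V" "B w u = 0" "B w v = 0" "B w u' = 0" "B w v' = 0"
    "B u w = 0" "B v w = 0" "B u' w = 0" "B v' w = 0"
  using assms B_com unfolding perp4_def by auto

lemma subsp_perp4: "subsp (perp4 u v u' v')"
  unfolding perp4_def by (intro subsp_perp2 subsp_V)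

lemma card_perp4:
  assumes "quad u v u' v'" shows "81 * card (perp4 u v u' v') = 3 ^ n"
proof -
  note q = quad_B[OF assms]
  have "3 ^ n = 9 * card {w \<in> V. B w u = 0 \<and> B w u' = 0}"
    using split_card[OF subsp_V q(1,3,5,7,17)] card_vecs by simp
  also have "card {w \<in> V. B w u = 0 \<and> B w u' = 0} = 9 * card (perp4 u v u' v')"
    unfolding perp4_def by (rule split_card[OF subsp_perp2[OF subsp_V]]) (use q in auto)
  finally show ?thesis by simp
qed

lemma perp4_dual:
  assumes q: "quad u v u' v'" and w: "w \<in> perp4 u v u' v'" "w \<noteq> 0"
  shows "\<exists>w'\<in>perp4 u v u' v'. B w w' = c"
proof -
  note wD [simp] = perp4_D[OF w(1)]
  obtain y where y: "y \<in> V" "B w y = c" using exists_dual[of w c] wD(1) w by blast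
  note qB [simp] = quad_B[OF q]
  show ?thesis
    using y
    by (intro bexI[of _ "y + scal (- B y u') u + scal (- B y u) u' + scal (- B y v') v + scal (- B y v) v'"])
      (simp_all add: perp4_def)
qed

text \<open>Otherwise every x with B x v = 0 also has B x u = 0. Then the functional of u is a
  multiple of that of v, and by nondegeneracy u is a multiple of v.\<close>

lemma functional_independent:
  assumes "u \<in> V" "v \<in> V" "u \<noteq> 0" "\<And>c. v \<noteq> scal c u"
  shows "\<exists>x\<in>V. B x u = 1 \<and> B x v = 0"
proof (rule ccontr)
  assume neg: "\<not> ?thesis"
  have zero: "B x u = 0" if "x \<in> V" "B x v = 0" for x
  proof (rule ccontr)
    assume "B x u \<noteq> 0"
    then have "B (scal (B x u) x) u = 1" using F3_square by simp
    moreover have "scal (B x u) x \<in> V" "B (scal (B x u) x) v = 0" using that by simp_all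
    ultimately show False using neg by blast
  qed
  have "v \<noteq> 0" using assms(4)[of 0] by simp
  then obtain y where y: "y \<in> V" "B v y = 1" using exists_dual assms by blast
  then have yv: "B y v = 1" using B_com by simp
  have "B u x = B (scal (B y u) v) x" if x: "x \<in> V" for x
  proof -
    have "B (x + scal (- B x v) y) u = 0" using zero[of "x + scal (- B x v) y"] x y yv by simp
    then have "B x u = B x v * B y u" by simp
    then show ?thesis using B_com by (simp add: mult.commute)
  qed
  then have "u + scal (- B y u) v = 0"
    by (intro nondeg) (use assms in auto)
  then have uv: "u = scal (B y u) v" by (simp add: fvec)
  show False
  proof (cases "B y u = 0")
    case True
    then show False using uv assms(3) by simp
  next
    case False
    then have "scal (B y u) u = v"
      by (subst uv) (simp add: F3_square)
    then show False using assms(4)[of "B y u"] by simp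
  qed
qed

lemma pair_sym:
  assumes "pair u v" shows "pair v u"
proof -
  have "v \<noteq> 0" using assms unfolding pair_def by (metis scal_simps(1))
  moreover have "u \<noteq> scal c v" for c
  proof
    assume u: "u = scal c v"
    then have "c \<noteq> 0" using assms by (auto simp: pair_def)
    then have "scal c u = v" using u F3_square by simp
    then show False using assms by (auto simp: pair_def)
  qed
  ultimately show ?thesis using assms B_com by (auto simp: pair_def)
qed

lemma pair_quad:
  assumes "pair u v" shows "\<exists>u' v'. quad u v u' v'"
proof -
  have uv: "u \<in> V" "v \<in> V" "B u u = 0" "B v v = 0" "B u v = 0" "B v u = 0"
    using assms B_com by (auto simp: pair_def)
  obtain x where x: "x \<in> V" "B x u = 1" "B x v = 0"
    using functional_independent[of u v] assms by (auto simp: pair_def)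
  obtain y where y: "y \<in> V" "B y v = 1" "B y u = 0"
    using functional_independent[of v u] pair_sym[OF assms] by (auto simp: pair_def)
  \<comment> \<open>Adding \<open>scal (B x x) u\<close> changes B x x by 2 B x x, which makes the
    vector singular modulo 3. The same correction turns y' into v'; the vector y' is y made
    orthogonal to u'.\<close>
  define u' where "u' = x + scal (B x x) u"
  define y' where "y' = y + scal (- B y u') u"
  define v' where "v' = y' + scal (B y' y') v"
  have x': "B u x = 1" "B v x = 0" using x B_com by auto
  have u': "u' \<in> V" "B u' u' = 0" "B u' v = 0" "B u u' = 1"
    using uv x x' by (auto simp: u'_def)
  have vu': "B v u' = 0" using u' B_com by simp
  have y': "y' \<in> V" "B y' u' = 0" "B y' u = 0" "B y' v = 1"
    using uv y u' by (auto simp: y'_def)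
  have vy': "B v y' = 1" "B u y' = 0" "B u' y' = 0" using y' B_com by auto
  have "v' \<in> V" "B v' v' = 0" "B u' v' = 0" "B u v' = 0" "B v v' = 1"
    using uv y' vy' u' by (auto simp: v'_def)
  then show ?thesis using uv u' by (intro exI[of _ u'] exI[of _ v']) (simp add: quad_def)
qed

lemma quad_pair:
  assumes "quad u v u' v'" shows "pair u v"
proof -
  note q = quad_B[OF assms]
  have "v \<noteq> scal c u" for c
  proof
    assume "v = scal c u"
    then have "B v v' = c * B u v'" by simp
    then show False using q by simp
  qed
  moreover have "u \<noteq> 0" using q by auto
  ultimately show ?thesis using q by (simp add: pair_def)
qed

lemma E_add':
  assumes "u \<in> V" "w1 \<in> V" "w2 \<in> V" "B u u = 0" "B w1 u = 0" "B w2 u = 0"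
  shows "E u w1 * E u w2 = E u (w1 + w2)"
  using E_add[OF assms] eps_pos by simp

text \<open>With B w1 w2 = 1, \<open>E v w1\<close> sends w2 to w2 - v, so its commutator with
  \<open>E u w2\<close> is \<open>E u (-v)\<close>. Likewise \<open>E v w\<close> sends v' to v' + w
  + (B w w) v, so its commutator with \<open>E u v'\<close> is \<open>E u w\<close> up to a factor
  \<open>E u (c v)\<close>, already in H. The bound n > 4 makes the complement of the two planes
  nonzero.\<close>

lemma siegel_in_H:
  assumes q: "quad u v u' v'" and n: "n > 4"
  shows "E u v \<in> H" "\<And>w. w \<in> perp4 u v u' v' \<Longrightarrow> E u w \<in> H"
proof -
  note qB [simp] = quad_B[OF q]
  have "(81::nat) < 3 ^ n" using power_strict_increasing[OF n, of "3::nat"] by simp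
  then have "card (perp4 u v u' v') > 1" using card_perp4[OF q] by simp
  then have "\<not> perp4 u v u' v' \<subseteq> {0}"
    using card_mono[of "{0::F3vec}" "perp4 u v u' v'"] by auto
  then obtain w1 where w1: "w1 \<in> perp4 u v u' v'" "w1 \<noteq> 0" by blast
  obtain w2 where w2: "w2 \<in> perp4 u v u' v'" "B w1 w2 = 1" using perp4_dual[OF q w1] by blast
  note w1D [simp] = perp4_D[OF w1(1)] and w2D [simp] = perp4_D[OF w2(1)]
  have w21: "B w2 w1 = 1" using w2 B_com by simp
  have "E u (scal (-1) v) \<in> H"
  proof (rule commutator_in_H)
    show G: "E v w1 \<in> carrier G" "E u w2 \<in> carrier G" "E u (scal (-1) v) \<in> carrier G"
      by (simp_all add: E_in_G)
    have "act n (E v w1) u = u" "act n (E v w1) w2 = scal (-1) v + w2"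
      using w21 by (simp_all add: act_E psi_orth add.commute)
    then have "E v w1 * E u w2 = E u (scal (-1) v + w2) * E v w1"
      using E_conj[OF G(1) qB(1) w2D(1)] by simp
    also have "E u (scal (-1) v + w2) = E u (scal (-1) v) * E u w2"
      using E_add'[of u "scal (-1) v" w2] by simp
    finally show "E v w1 * E u w2 = E u (scal (-1) v) * (E u w2 * E v w1)"
      by (simp add: assoc_mult_mat[OF E_mat E_mat E_mat])
  qed
  then show uv: "E u v \<in> H" using E_neg_in_H[of u v] by simp
  fix w assume "w \<in> perp4 u v u' v'"
  note wD [simp] = perp4_D[OF this]
  define k where "k = w + scal (B w w) v"
  have k: "k \<in> V" "B k u = 0" by (auto simp: k_def)
  have "E u k \<in> H"
  proof (rule commutator_in_H)
    show G: "E v w \<in> carrier G" "E u v' \<in> carrier G" "E u k \<in> carrier G"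
      using k by (simp_all add: E_in_G)
    have "act n (E v w) u = u" "act n (E v w) v' = k + v'"
      by (simp_all add: act_E psi_orth k_def add_ac)
    then have "E v w * E u v' = E u (k + v') * E v w"
      using E_conj[OF G(1) qB(1) qB(4)] by simp
    also have "E u (k + v') = E u k * E u v'"
      using E_add'[of u k v'] k by simp
    finally show "E v w * E u v' = E u k * (E u v' * E v w)"
      by (simp add: assoc_mult_mat[OF E_mat E_mat E_mat])
  qed
  moreover have "E u (scal (- B w w) v) \<in> H" using E_scal_in_H uv qB by blast
  ultimately have "E u k * E u (scal (- B w w) v) \<in> H" by (rule H_mult)
  also have "E u k * E u (scal (- B w w) v) = E u (k + scal (- B w w) v)"
    using k by (intro E_add') simp_all
  also have "k + scal (- B w w) v = w" by (simp add: k_def fvec)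
  finally show "E u w \<in> H" .
qed

definition long_roots :: "3 mat set" where "long_roots = {E u v |u v. pair u v}"

text \<open>For a symmetric form \<open>E u\<close> is additive on all vectors orthogonal to u, so A
  can use the entire complement of the two hyperbolic planes and r is n - 4.\<close>

theorem orthogonal_obstruction:
  assumes n: "n > 4" and ne: "long_roots \<noteq> {}"
    and small: "2 ^ multiplicity 2 (card long_roots) < (3::nat) ^ (n - 4)"
  shows "\<exists>t s A. heisenberg_obstruction K t s A"
proof -
  interpret K: group K by (rule group_K)
  have "\<exists>t\<in>long_roots. (2::nat) ^ multiplicity 2 (Coset.order K) < 3 ^ (n - 4) * 2 ^ multiplicity 2 (card {g \<in> carrier K. g \<otimes>\<^bsub>K\<^esub> t = t \<otimes>\<^bsub>K\<^esub> g})"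
  proof (rule exists_small_class_H[OF _ ne _ small])
    show "long_roots \<subseteq> H"
      using pair_quad siegel_in_H(1)[OF _ n] by (fastforce simp: long_roots_def)
    fix g t assume g: "g \<in> H" "t \<in> long_roots"
    then obtain u v where u: "pair u v" "t = E u v" by (auto simp: long_roots_def)
    then obtain u' v' where q: "quad u v u' v'" using pair_quad by blast
    note qB [simp] = quad_B[OF q]
    have "quad (act n g u) (act n g v) (act n g u') (act n g v')"
      using act_in_G[OF HG[OF g(1)]] by (simp add: quad_def)
    then have "pair (act n g u) (act n g v)" by (rule quad_pair)
    then show "g * t * inv\<^bsub>G\<^esub> g \<in> long_roots"
      using E_conj_inv[OF HG[OF g(1)] qB(1,2)] u(2) by (auto simp: long_roots_def)
  qed
  then obtain u v where "pair u v"
    and sm: "(2::nat) ^ multiplicity 2 (Coset.order K) < 3 ^ (n - 4) * 2 ^ multiplicity 2 (card {g \<in> carrier K. g \<otimes>\<^bsub>K\<^esub> E u v = E u v \<otimes>\<^bsub>K\<^esub> g})"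
    by (auto simp: long_roots_def)
  then obtain u' v' where q: "quad u v u' v'" using pair_quad by blast
  note qB [simp] = quad_B[OF q]
  let ?W = "perp4 u v u' v'"
  note mem = siegel_in_H[OF q n]
  have mem_v: "E v w \<in> H" if "w \<in> ?W" for w
    using siegel_in_H(2)[OF quad_swap(1)[OF q] n] that perp4_swap(1) by metis
  have s_in: "E u' v' \<in> H" by (rule siegel_in_H(1)[OF quad_swap(2)[OF q] n])
  have cardW: "card ?W = 3 ^ (n - 4)"
  proof -
    have "(3::nat) ^ n = 81 * 3 ^ (n - 4)" using n power_add[of "3::nat" 4 "n - 4"] by simp
    then show ?thesis using card_perp4[OF q] by simp
  qed
  have cardA: "card (E u ` ?W) = 3 ^ (n - 4)"
    unfolding cardW[symmetric]
  proof (rule card_E_image[of _ u u' 1])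
    show "?W \<subseteq> V" using perp4_D(1) by blast
    show "B w u = 0 \<and> B w u' = 0" if "w \<in> ?W" for w using perp4_D(2,4)[OF that] by simp
  qed simp_all
  let ?t = "E u v" and ?s = "E u' v'"
  have "heisenberg_obstruction K ?t ?s (E u ` ?W)"
  proof (intro heisenberg_obstruction.intro heisenberg_obstruction_axioms.intro K.group_axioms)
    show "finite (carrier K)" using finite_H by simp
    show "?t \<in> carrier K" "?s \<in> carrier K" using mem s_in by auto
    have t_act: "act n ?t x = x + scal (B x u) v + scal (- B x v) u" if "x \<in> V" for x
      using that by (simp add: act_E psi_orth)
    have s_act: "act n ?s x = x + scal (B x u') v' + scal (- B x v') u'" if "x \<in> V" for x
      using that by (simp add: act_E psi_orth)
    have "?t * ?t * ?t = 1\<^sub>m n"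
    proof (rule mat_eq_by_act[of _ n])
      fix x assume "x \<in> V"
      then show "act n (?t * ?t * ?t) x = act n (1\<^sub>m n) x"
        using \<open>x \<in> V\<close> by (simp add: act_mult t_act) (simp add: fvec algebra_simps)
    qed auto
    then show "?t [^]\<^bsub>K\<^esub> (3::nat) = \<one>\<^bsub>K\<^esub>" by (simp add: numeral_3_eq_3 left_mult_one_mat[OF E_mat])
    show "subgroup (E u ` ?W) K"
      by (rule E_family_subgroup[OF subsp_perp4 qB(1,5) _ _ mem(2)]) (use perp4_D(2) eps_pos in simp_all)
    show "odd (card (E u ` ?W))" using cardA by simp
    show "2 ^ multiplicity 2 (Coset.order K)
        < card (E u ` ?W) * 2 ^ multiplicity 2 (card {g \<in> carrier K. g \<otimes>\<^bsub>K\<^esub> ?t = ?t \<otimes>\<^bsub>K\<^esub> g})"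
      using sm unfolding cardA .
    have tA: "E u w * ?t = E u (w + v)" "?t * E u w = E u (w + v)" if "w \<in> ?W" for w
      using E_add'[of u w v] E_add'[of u v w] perp4_D[OF that] by (auto simp: add.commute)
    show "a \<otimes>\<^bsub>K\<^esub> ?t = ?t \<otimes>\<^bsub>K\<^esub> a" if "a \<in> E u ` ?W" for a
      using that tA by auto
    show "\<exists>b\<in>carrier K. b \<otimes>\<^bsub>K\<^esub> ?t = ?t \<otimes>\<^bsub>K\<^esub> b \<and> b \<otimes>\<^bsub>K\<^esub> a = a \<otimes>\<^bsub>K\<^esub> ?t \<otimes>\<^bsub>K\<^esub> b"
      if a: "a \<in> E u ` ?W" "a \<noteq> \<one>\<^bsub>K\<^esub>" for a
    proof -
      obtain w where w: "a = E u w" "w \<in> ?W" using a by auto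
      have "w \<noteq> 0" using a(2) w E_zero by auto
      \<comment> \<open>b = \<open>E v w'\<close> fixes u and v and sends w to w - B(w, w') v. The
        value -1 makes this w + v, so b conjugates a to a t.\<close>
      then obtain w' where w': "w' \<in> ?W" "B w w' = -1" using perp4_dual[OF q w(2)] by blast
      note wD [simp] = perp4_D[OF w(2)] and wD' [simp] = perp4_D[OF w'(1)]
      have bH: "E v w' \<in> H" using mem_v w' by blast
      have "act n (E v w') u = u" "act n (E v w') v = v" "act n (E v w') w = w + v"
        using w' by (simp_all add: act_E psi_orth)
      then have "E v w' * ?t = ?t * E v w'" "E v w' * E u w = E u (w + v) * E v w'"
        using E_conj[OF HG[OF bH] qB(1) qB(2)] E_conj[OF HG[OF bH] qB(1) wD(1)] by simp_all
      then show ?thesis using bH tA[OF w(2)] w by (intro bexI[of _ "E v w'"]) auto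
    qed
    let ?w = "?t * ?s * ?t"
    have wm: "?w \<in> carrier_mat n n" by simp
    \<comment> \<open>The Weyl element sends u to v', v' to -u, v to -u' and u' to v, and fixes the
      complement of these four vectors. Its square is -1 on their span.\<close>
    define wf where "wf x = x + scal (- B x v - B x u') u + scal (B x u - B x v') v
        + scal (- B x u - B x v') u' + scal (B x u' - B x v) v'" for x
    have act_w: "act n ?w x = wf x" if "x \<in> V" for x
    proof -
      have "act n ?w x = act n ?t (act n ?s (act n ?t x))" by (simp add: act_mult)
      also have "\<dots> = wf x"
        using that by (simp add: t_act s_act) (simp add: wf_def fvec algebra_simps)
      finally show ?thesis .
    qed
    show "?t \<otimes>\<^bsub>K\<^esub> ?s \<otimes>\<^bsub>K\<^esub> ?t = ?s \<otimes>\<^bsub>K\<^esub> ?t \<otimes>\<^bsub>K\<^esub> ?s"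
    proof -
      have "?w = ?s * ?t * ?s"
      proof (rule mat_eq_by_act[OF wm])
        fix x assume x: "x \<in> V"
        have "act n (?s * ?t * ?s) x = act n ?s (act n ?t (act n ?s x))" by (simp add: act_mult)
        also have "\<dots> = wf x"
          using x by (simp add: t_act s_act) (simp add: wf_def fvec algebra_simps)
        finally show "act n ?w x = act n (?s * ?t * ?s) x" using act_w[OF x] by simp
      qed auto
      then show ?thesis by simp
    qed
    have ww: "?w * ?w \<in> carrier_mat n n" using wm by simp
    have act_ww: "act n (?w * ?w) x = x + scal (B x u') u + scal (B x u) u' + scal (B x v') v + scal (B x v) v'" if "x \<in> V" for x
    proof -
      have "act n (?w * ?w) x = act n ?w (act n ?w x)" by (rule act_mult[OF wm wm])
      also have "\<dots> = wf (wf x)" unfolding act_w[OF that] using that by (intro act_w) (simp add: wf_def)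
      also have "\<dots> = x + scal (B x u') u + scal (B x u) u' + scal (B x v') v + scal (B x v) v'"
        using that by (simp add: wf_def) (simp add: fvec algebra_simps)
      finally show ?thesis .
    qed
    have "?w * ?w * (?w * ?w) = 1\<^sub>m n"
    proof (rule mat_eq_by_act[of _ n])
      fix x assume x: "x \<in> V"
      show "act n (?w * ?w * (?w * ?w)) x = act n (1\<^sub>m n) x"
        unfolding act_mult[OF ww ww] act_ww[OF x] act_one[OF x]
        by (subst act_ww) (use x in \<open>simp_all add: fvec algebra_simps\<close>)
    qed (use ww in auto)
    then have "?w * ?w * ?w * ?w = 1\<^sub>m n" using assoc_mult_mat[OF ww wm wm] by simp
    then show "(?t \<otimes>\<^bsub>K\<^esub> ?s \<otimes>\<^bsub>K\<^esub> ?t) [^]\<^bsub>K\<^esub> (4::nat) = \<one>\<^bsub>K\<^esub>"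
      using left_mult_one_mat[OF wm] by (simp add: eval_nat_numeral)
    show "?t \<otimes>\<^bsub>K\<^esub> ?s \<otimes>\<^bsub>K\<^esub> ?t \<otimes>\<^bsub>K\<^esub> ?t \<noteq> ?t \<otimes>\<^bsub>K\<^esub> (?t \<otimes>\<^bsub>K\<^esub> ?s \<otimes>\<^bsub>K\<^esub> ?t)"
    proof
      assume "?t \<otimes>\<^bsub>K\<^esub> ?s \<otimes>\<^bsub>K\<^esub> ?t \<otimes>\<^bsub>K\<^esub> ?t = ?t \<otimes>\<^bsub>K\<^esub> (?t \<otimes>\<^bsub>K\<^esub> ?s \<otimes>\<^bsub>K\<^esub> ?t)"
      \<comment> \<open>Evaluated at u' and paired with u, the two products give -1 and 0.\<close>
      then have "act n (?w * ?t) u' = act n (?t * ?w) u'" by simp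
      then have "act n ?w (act n ?t u') = act n ?t (act n ?w u')"
        unfolding act_mult[OF wm E_mat] act_mult[OF E_mat wm] .
      then have "wf (act n ?t u') = act n ?t (wf u')" using act_w by simp
      moreover have "wf u' \<in> V" by (simp add: wf_def)
      ultimately have "B (wf (u' + v)) u = B (wf u' + scal (B (wf u') u) v + scal (- B (wf u') v) u) u"
        using t_act by simp
      then show False by (simp add: wf_def)
    qed
  qed
  then show ?thesis by blast
qed

end

section \<open>Counting long root elements\<close>

lemma F3_UNIV: "(UNIV :: 3 set) = {0, 1, -1}"
  using F3_cases by auto

lemma F3_sum: "(\<Sum>c\<in>(UNIV::3 set). f c) = f 0 + f 1 + (f (-1) :: nat)"
  by (simp add: F3_UNIV)

text \<open>The elements of SL_2(3) as pairs of rows; they are the base changes of a plane that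
  preserve its Siegel element.\<close>

definition det_one :: "((3 \<times> 3) \<times> 3 \<times> 3) set" where
  "det_one = {((a,b),(c,d)). a * d - b * c = 1}"

lemma sum_UNIV_prod: "(\<Sum>p\<in>(UNIV::('a \<times> 'b) set). f p) = (\<Sum>a\<in>UNIV. \<Sum>b\<in>UNIV. f (a,b))"
  by (simp add: sum.cartesian_product)

lemma card_det_one: "card det_one = 24"
proof -
  have "card det_one = (\<Sum>p\<in>UNIV. if p \<in> det_one then 1 else 0 :: nat)"
    by (simp add: sum.If_cases)
  also have "\<dots> = (\<Sum>a\<in>UNIV. \<Sum>b\<in>UNIV. \<Sum>c\<in>UNIV. \<Sum>d\<in>UNIV. if ((a,b),(c,d)) \<in> det_one then 1 else 0)"
    by (simp only: sum_UNIV_prod)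
  also have "\<dots> = 24"
    by (simp add: F3_sum det_one_def)
  finally show ?thesis .
qed

context orthogonal_sub
begin

definition zeros :: "F3vec set \<Rightarrow> F3vec set" where "zeros Y = {x \<in> Y. B x x = 0}"

text \<open>The vector a u + b u' + w is singular exactly when B w w = a b, because 2 = -1. The
  product a b takes the value 0 five times and each of 1 and -1 twice; splitting 5 as 3 + 2 leaves
  twice the whole complement.\<close>

lemma split_zeros:
  assumes Y: "subsp Y" and u: "u \<in> Y" "u' \<in> Y" "B u u = 0" "B u' u' = 0" "B u u' = 1"
  shows "card (zeros Y) = 3 * card (zeros {w \<in> Y. B w u = 0 \<and> B w u' = 0}) + 2 * card {w \<in> Y. B w u = 0 \<and> B w u' = 0}"
proof -
  let ?P = "{w \<in> Y. B w u = 0 \<and> B w u' = 0}"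
  define f where "f = (\<lambda>((a,b),w). scal a u + scal b u' + w)"
  have bij: "bij_betw f (UNIV \<times> ?P) Y" unfolding f_def by (rule split_bij[OF assms])
  have finP: "finite ?P" using subspD(5)[OF Y] by simp
  have u'u: "B u' u = 1" using B_com u by simp
  have Bf: "B (f ((a,b),w)) (f ((a,b),w)) = B w w - a * b" if "w \<in> ?P" for a b w
  proof -
    have "B u w = 0" "B u' w = 0" using that B_com[of u w] B_com[of u' w] by auto
    then show ?thesis using that u u'u by (simp add: f_def algebra_simps)
  qed
  let ?q = "\<lambda>c. {w \<in> ?P. B w w = c}"
  have "bij_betw f {p \<in> UNIV \<times> ?P. B (f p) (f p) = 0} (zeros Y)"
  proof (rule bij_betw_subset[OF bij])
    have "f ` (UNIV \<times> ?P) = Y" using bij by (simp add: bij_betw_def)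
    moreover have "f ` {p \<in> A. B (f p) (f p) = 0} = {x \<in> f ` A. B x x = 0}" for A by auto
    ultimately show "f ` {p \<in> UNIV \<times> ?P. B (f p) (f p) = 0} = zeros Y" by (simp only: zeros_def)
  qed blast
  then have "card (zeros Y) = card {p \<in> UNIV \<times> ?P. B (f p) (f p) = 0}" by (simp add: bij_betw_same_card)
  also have "{p \<in> UNIV \<times> ?P. B (f p) (f p) = 0} = Sigma UNIV (\<lambda>(a,b). ?q (a * b))"
    using Bf by (auto; force)
  also have "card (Sigma UNIV (\<lambda>(a,b). ?q (a * b))) = (\<Sum>p\<in>UNIV. card (case p of (a,b) \<Rightarrow> ?q (a * b)))"
    by (intro card_SigmaI) (auto intro: finite_subset[OF _ finP])
  also have "\<dots> = (\<Sum>a\<in>UNIV. \<Sum>b\<in>UNIV. card (?q (a * b)))"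
    by (simp only: sum_UNIV_prod prod.case)
  also have "\<dots> = 5 * card (?q 0) + 2 * card (?q 1) + 2 * card (?q (-1))"
    by (simp add: F3_sum)
  finally have 1: "card (zeros Y) = 5 * card (?q 0) + 2 * card (?q 1) + 2 * card (?q (-1))" .
  have "?P = (\<Union>c\<in>UNIV. ?q c)" by auto
  then have "card ?P = (\<Sum>c\<in>UNIV. card (?q c))"
    using finP by (subst card_UN_disjoint[symmetric]) auto
  then have "card ?P = card (?q 0) + card (?q 1) + card (?q (-1))" by (simp add: F3_sum)
  then show ?thesis using 1 by (simp add: zeros_def)
qed

lemma hyperbolic_partner:
  assumes "u \<in> V" "B u u = 0" "u \<noteq> 0"
  shows "\<exists>u'\<in>V. B u' u' = 0 \<and> B u u' = 1"
proof -
  obtain y where y: "y \<in> V" "B u y = 1" using exists_dual assms by blast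
  then have "B y u = 1" using B_com by simp
  then show ?thesis using y assms by (intro bexI[of _ "y + scal (B y y) u"]) auto
qed

text \<open>
  The number \<open>z\<close> of singular vectors in the complement of a hyperbolic plane is determined by that
  of the whole space, so Witt's theorem is not needed.
\<close>

lemma card_pairs_at:
  assumes u: "u \<in> V" "B u u = 0" "u \<noteq> 0" and z: "card (zeros V) = 3 * z + 2 * 3 ^ (n - 2)" and n: "n \<ge> 2"
  shows "card {v. pair u v} = 3 * (z - 1)"
proof -
  obtain u' where u': "u' \<in> V" "B u' u' = 0" "B u u' = 1" using hyperbolic_partner u by blast
  have u'u: "B u' u = 1" using B_com u' by simp
  let ?P = "{w \<in> V. B w u = 0 \<and> B w u' = 0}"
  have "3 ^ n = 9 * card ?P" using split_card[OF subsp_V u(1) u'(1) u(2) u'(2,3)] card_vecs by simp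
  moreover have "(3::nat) ^ n = 9 * 3 ^ (n - 2)"
  proof -
    obtain d where "n = 2 + d" using n le_Suc_ex by blast
    then show ?thesis by (simp add: power_add)
  qed
  ultimately have P: "card ?P = 3 ^ (n - 2)" by simp
  have Z: "card (zeros ?P) = z" using split_zeros[OF subsp_V u(1) u'(1) u(2) u'(2,3)] z P by simp
  have fin: "finite (zeros ?P)" using finite_vecs by (auto simp: zeros_def)
  have z0: "0 \<in> zeros ?P" by (simp add: zeros_def)
  \<comment> \<open>The vectors orthogonal to u are a u + w with w in the complement of the
    hyperbolic plane. Such a vector is singular exactly when w is, and independent of u exactly when
    w is nonzero.\<close>
  define h where "h = (\<lambda>(a,w). scal a u + w)"
  define g where "g = (\<lambda>v. (B v u', v + scal (- B v u') u))"
  have "bij_betw h (UNIV \<times> (zeros ?P - {0})) {v. pair u v}"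
  proof (rule bij_betw_byWitness[of _ g])
    show "\<forall>p\<in>UNIV \<times> (zeros ?P - {0}). g (h p) = p"
      using u' u by (auto simp: zeros_def fvec g_def h_def)
    show "\<forall>v\<in>{v. pair u v}. h (g v) = v"
      by (auto simp: fvec g_def h_def)
    show "h ` (UNIV \<times> (zeros ?P - {0})) \<subseteq> {v. pair u v}"
    proof (rule image_subsetI)
      fix p assume "p \<in> (UNIV :: 3 set) \<times> (zeros ?P - {0})"
      then obtain a w where p: "p = (a, w)" and w: "w \<in> zeros ?P" "w \<noteq> 0" by auto
      have wD: "w \<in> V" "B w w = 0" "B w u = 0" "B w u' = 0" "B u w = 0"
        using w B_com[of u w] by (auto simp: zeros_def)
      have "scal a u + w \<noteq> scal c u" for c
      proof
        assume e: "scal a u + w = scal c u"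
        from arg_cong[OF this, of "\<lambda>x. B x u'"] have "a = c" using wD u' by simp
        with e show False using w(2) by (simp add: fvec)
      qed
      then show "h p \<in> {v. pair u v}" using wD u by (simp add: pair_def h_def p)
    qed
    show "g ` {v. pair u v} \<subseteq> UNIV \<times> (zeros ?P - {0})"
    proof (rule image_subsetI)
      fix v assume "v \<in> {v. pair u v}"
      then have v: "pair u v" by simp
      then have vD: "v \<in> V" "B v v = 0" "B u v = 0" "B v u = 0" using B_com[of u v] by (auto simp: pair_def)
      have "v + scal (- B v u') u \<in> zeros ?P" using vD u u' by (simp add: zeros_def)
      moreover have "v + scal (- B v u') u \<noteq> 0"
      proof
        assume "v + scal (- B v u') u = 0"
        then have "v = scal (B v u') u" by (simp add: fvec)
        then show False using v by (auto simp: pair_def)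
      qed
      ultimately show "g v \<in> UNIV \<times> (zeros ?P - {0})" by (simp add: g_def)
    qed
  qed
  from bij_betw_same_card[OF this] show ?thesis
    using fin z0 Z by (simp add: card_cartesian_product)
qed

text \<open>\<open>E x y\<close> depends only on the wedge of x and y: a change of basis in the
  plane of u and v multiplies the displacement by its determinant. So the fibre is an orbit of
  SL_2(3).\<close>

lemma card_fibre:
  assumes "pair u v"
  shows "card {(x,y). pair x y \<and> E x y = E u v} = 24"
proof -
  obtain u' v' where q: "quad u v u' v'" using pair_quad[OF assms] by blast
  note qB = quad_B[OF q]
  have uv: "u \<in> V" "v \<in> V" using qB by auto
  define f where "f = (\<lambda>((a,b),(c,d)). (scal a u + scal b v, scal c u + scal d v))"
  have psi_f: "psi (scal a u + scal b v) (scal c u + scal d v) x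
      = x + scal ((a * d - b * c) * B x u) v + scal (- (a * d - b * c) * B x v) u" for a b c d x
    using qB by (simp add: psi_orth) (simp add: fvec algebra_simps)
  have psi_uv: "psi u v x = x + scal (B x u) v + scal (- B x v) u" for x
    using qB by (simp add: psi_orth)
  have "inj_on f det_one"
  proof (rule inj_onI)
    fix p p' assume "f p = f p'"
    moreover obtain a b c d where p: "p = ((a,b),(c,d))" by (metis surj_pair)
    moreover obtain a' b' c' d' where p': "p' = ((a',b'),(c',d'))" by (metis surj_pair)
    ultimately have 1: "scal a u + scal b v = scal a' u + scal b' v" "scal c u + scal d v = scal c' u + scal d' v"
      by (auto simp: f_def)
    show "p = p'"
      using arg_cong[OF 1(1), of "\<lambda>x. B x u'"] arg_cong[OF 1(1), of "\<lambda>x. B x v'"]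
        arg_cong[OF 1(2), of "\<lambda>x. B x u'"] arg_cong[OF 1(2), of "\<lambda>x. B x v'"] qB p p' by simp
  qed
  moreover have "f ` det_one = {(x,y). pair x y \<and> E x y = E u v}"
  proof safe
    fix a b c d x y assume p: "((a,b),(c,d)) \<in> det_one" "(x,y) = f ((a,b),(c,d))"
    have det: "a * d - b * c = 1" using p(1) by (simp add: det_one_def)
    have xy: "x = scal a u + scal b v" "y = scal c u + scal d v" using p(2) by (auto simp: f_def)
    have sing: "x \<in> V" "y \<in> V" "B x x = 0" "B y y = 0" "B x y = 0" using qB by (simp_all add: xy)
    have "x \<noteq> 0"
    proof
      assume "x = 0"
      then have "B x u' = 0" "B x v' = 0" by simp_all
      then show False using qB det by (simp add: xy)
    qed
    moreover have "y \<noteq> scal k x" for k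
    proof
      assume "y = scal k x"
      then have "B y u' = k * B x u'" "B y v' = k * B x v'" by simp_all
      then have "c = k * a" "d = k * b" using qB by (simp_all add: xy)
      then show False using det by simp
    qed
    ultimately show "pair x y" using sing by (simp add: pair_def)
    show "E x y = E u v"
    proof (rule mat_eq_by_act[OF E_mat E_mat])
      fix z assume "z \<in> V"
      then show "act n (E x y) z = act n (E u v) z"
        unfolding act_E[OF sing(1,2) \<open>z \<in> V\<close>] act_E[OF uv \<open>z \<in> V\<close>] psi_uv unfolding xy psi_f det by simp
    qed
  next
    fix x y assume xy: "pair x y" and eq: "E x y = E u v"
    obtain x' y' where q': "quad x y x' y'" using pair_quad[OF xy] by blast
    note qB' = quad_B[OF q']
    have xyV: "x \<in> V" "y \<in> V" using qB' by auto
    have eq': "psi x y z = psi u v z" if "z \<in> V" for z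
      using act_E[OF xyV that] act_E[OF uv that] eq by simp
    \<comment> \<open>The dual vectors expose the plane: y' is moved by -x and x' by y, and both
      displacements lie in the span of u and v.\<close>
    have "psi x y y' = y' + scal (-1) x" using qB' by (simp add: psi_orth)
    then have "y' + scal (-1) x = y' + scal (B y' u) v + scal (- B y' v) u"
      using eq'[of y'] qB' psi_uv by simp
    then have x: "x = scal (B y' v) u + scal (- B y' u) v" by (simp add: fvec algebra_simps)
    have "psi x y x' = x' + y" using qB' by (simp add: psi_orth)
    then have "x' + y = x' + scal (B x' u) v + scal (- B x' v) u"
      using eq'[of x'] qB' psi_uv by simp
    then have y: "y = scal (- B x' v) u + scal (B x' u) v" by (simp add: fvec algebra_simps)
    define a b c d where "a = B y' v" and "b = - B y' u" and "c = - B x' v" and "d = B x' u"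
    have xy': "x = scal a u + scal b v" "y = scal c u + scal d v" using x y by (simp_all add: a_def b_def c_def d_def)
    have "u' + scal (a * d - b * c) v = u' + v"
      using eq'[of u'] qB unfolding psi_uv xy' psi_f by simp
    from arg_cong[OF this, of "\<lambda>x. B x v'"] have "a * d - b * c = 1" using qB by simp
    then have "((a,b),(c,d)) \<in> det_one" by (simp add: det_one_def)
    then show "(x,y) \<in> f ` det_one" using xy' by (force simp: f_def)
  qed
  ultimately show ?thesis using card_image[of f det_one] card_det_one by simp
qed

text \<open>Ordered singular pairs are counted by their first vector, with 3 (z - 1) choices for the
  second, and by their root element, with 24 pairs each; a factor 3 cancels.\<close>

lemma card_long_roots:
  assumes z: "card (zeros V) = 3 * z + 2 * 3 ^ (n - 2)" and n: "n \<ge> 2"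
  shows "8 * card long_roots = (card (zeros V) - 1) * (z - 1)"
proof -
  define N where "N = zeros V - {0}"
  have "card N = card (zeros V) - 1" using finite_vecs by (simp add: N_def zeros_def)
  have finV: "finite V" by (rule finite_vecs)
  define Ps where "Ps = {(u,v). pair u v}"
  have "Ps = Sigma N (\<lambda>u. {v. pair u v})" by (auto simp: Ps_def N_def zeros_def pair_def)
  moreover have "card (Sigma N (\<lambda>u. {v. pair u v})) = (\<Sum>u\<in>N. card {v. pair u v})"
    using finV by (intro card_SigmaI) (auto simp: N_def zeros_def pair_def)
  moreover have "(\<Sum>u\<in>N. card {v. pair u v}) = (\<Sum>u\<in>N. 3 * (z - 1))"
    by (intro sum.cong refl card_pairs_at[OF _ _ _ z n]) (auto simp: N_def zeros_def)
  ultimately have 1: "card Ps = (card (zeros V) - 1) * (3 * (z - 1))" using \<open>card N = _\<close> by simp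
  have finPs: "finite Ps"
    by (rule finite_subset[of _ "V \<times> V"]) (auto simp: Ps_def pair_def finV)
  let ?E = "\<lambda>(u,v). E u v"
  have "card Ps = (\<Sum>t\<in>?E ` Ps. card {p \<in> Ps. ?E p = t})"
    using sum.image_gen[OF finPs, of "\<lambda>_. 1::nat" ?E] by simp
  also have "\<dots> = (\<Sum>t\<in>?E ` Ps. 24)"
  proof (intro sum.cong refl)
    fix t assume "t \<in> ?E ` Ps"
    then obtain u v where u: "pair u v" "t = E u v" by (auto simp: Ps_def)
    have "{p \<in> Ps. ?E p = t} = {(x,y). pair x y \<and> E x y = E u v}" by (auto simp: Ps_def u)
    then show "card {p \<in> Ps. ?E p = t} = 24" using card_fibre[OF u(1)] by simp
  qed
  also have "?E ` Ps = long_roots" by (auto simp: long_roots_def Ps_def)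
  finally have "card Ps = card long_roots * 24" by simp
  moreover have "card Ps = 3 * ((card (zeros V) - 1) * (z - 1))" unfolding 1 by (simp only: mult.left_commute)
  ultimately show ?thesis by linarith
qed

definition hyp_perp :: "(nat \<Rightarrow> F3vec) \<Rightarrow> (nat \<Rightarrow> F3vec) \<Rightarrow> nat \<Rightarrow> F3vec set" where
  "hyp_perp e f k = {x \<in> V. \<forall>i<k. B x (e i) = 0 \<and> B x (f i) = 0}"

text \<open>Going up from the anisotropic part, of size c, the counts satisfy z_(k+1) = 3 z_k + 2 c
  9^k with z_0 = 1. Hence z_k = 3^k + c (3^(2k-1) - 3^(k-1)), stated three times over and with the
  negative term moved across to stay within the naturals.\<close>

lemma witt_count:
  assumes hyp: "\<And>i. i < j \<Longrightarrow> e i \<in> V \<and> f i \<in> V \<and> B (e i) (e i) = 0 \<and> B (f i) (f i) = 0 \<and> B (e i) (f i) = 1"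
    and orth: "\<And>i l. i < j \<Longrightarrow> l < j \<Longrightarrow> i \<noteq> l \<Longrightarrow> B (e i) (e l) = 0 \<and> B (e i) (f l) = 0 \<and> B (f i) (e l) = 0 \<and> B (f i) (f l) = 0"
    and aniso: "card (zeros (hyp_perp e f j)) = 1"
  shows "3 * card (zeros V) + card (hyp_perp e f j) * 3 ^ j = 3 ^ (j + 1) + card (hyp_perp e f j) * 3 ^ (2 * j)"
    and "card V = 9 ^ j * card (hyp_perp e f j)"
proof -
  define c where "c = card (hyp_perp e f j)"
  have sub: "subsp (hyp_perp e f k)" for k by (auto simp: hyp_perp_def subsp_def)
  have "k \<le> j \<Longrightarrow> card (hyp_perp e f (j - k)) = 9 ^ k * c
      \<and> 3 * card (zeros (hyp_perp e f (j - k))) + c * 3 ^ k = 3 ^ (k + 1) + c * 3 ^ (2 * k)" for k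
  proof (induction k)
    case 0
    show ?case using aniso by (simp add: c_def)
  next
    case (Suc k)
    define i where "i = j - Suc k"
    have i: "i < j" "j - k = Suc i" using Suc.prems by (auto simp: i_def)
    have eq: "hyp_perp e f (Suc i) = {w \<in> hyp_perp e f i. B w (e i) = 0 \<and> B w (f i) = 0}"
      by (auto simp: hyp_perp_def less_Suc_eq)
    have mem: "e i \<in> hyp_perp e f i" "f i \<in> hyp_perp e f i"
      using hyp[OF i(1)] orth[OF i(1)] i(1) by (auto simp: hyp_perp_def)
    note h = hyp[OF i(1)]
    have c1: "card (hyp_perp e f i) = 9 * card (hyp_perp e f (Suc i))"
      unfolding eq by (rule split_card[OF sub mem]) (use h in auto)
    have z1: "card (zeros (hyp_perp e f i)) = 3 * card (zeros (hyp_perp e f (Suc i))) + 2 * card (hyp_perp e f (Suc i))"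
      unfolding eq by (rule split_zeros[OF sub mem]) (use h in auto)
    have IH: "card (hyp_perp e f (Suc i)) = 9 ^ k * c"
      "3 * card (zeros (hyp_perp e f (Suc i))) + c * 3 ^ k = 3 ^ (k + 1) + c * 3 ^ (2 * k)"
      using Suc i(2) by auto
    have "3 * card (zeros (hyp_perp e f i)) + c * 3 ^ Suc k
        = 3 * (3 * card (zeros (hyp_perp e f (Suc i))) + c * 3 ^ k) + 6 * (9 ^ k * c)"
      unfolding z1 IH(1) by simp
    also have "\<dots> = 3 ^ (Suc k + 1) + c * 3 ^ (2 * Suc k)"
      unfolding IH(2) by (simp add: power_mult)
    finally show ?case using c1 IH(1) i_def by simp
  qed
  from this[of j] have r: "card (hyp_perp e f 0) = 9 ^ j * c"
      "3 * card (zeros (hyp_perp e f 0)) + c * 3 ^ j = 3 ^ (j + 1) + c * 3 ^ (2 * j)" by auto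
  have "hyp_perp e f 0 = V" by (simp add: hyp_perp_def)
  then show "3 * card (zeros V) + card (hyp_perp e f j) * 3 ^ j = 3 ^ (j + 1) + card (hyp_perp e f j) * 3 ^ (2 * j)"
    and "card V = 9 ^ j * card (hyp_perp e f j)" using r by (simp_all add: c_def)
qed

end

section \<open>Dyadic valuations\<close>

lemma multiplicity_two_eqI:
  assumes "x mod 2 ^ Suc k = (2::nat) ^ k" shows "multiplicity 2 x = k"
proof (rule multiplicity_eqI)
  have "(2::nat) ^ k dvd 2 ^ Suc k" by simp
  then show "2 ^ k dvd x" using assms by (metis dvd_mod_iff dvd_refl)
  show "\<not> 2 ^ Suc k dvd x" using assms by (simp add: dvd_eq_mod_eq_0)
qed

lemma mod_eqI: "x = r + m * q \<Longrightarrow> r < m \<Longrightarrow> x mod m = (r::nat)"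
  by simp

lemma mod_eqE:
  assumes "x mod m = (r::nat)" obtains q where "x = m * q + r"
  using assms by (metis mult_div_mod_eq)

lemma mod_arith:
  "x mod 8 = 1 \<Longrightarrow> (x + 1) mod 4 = (2::nat)" "x mod 8 = 3 \<Longrightarrow> (x - 1) mod 4 = (2::nat)"
  "x mod 8 = 3 \<Longrightarrow> (x + 1) mod 8 = (4::nat)" "x mod 8 = 1 \<Longrightarrow> (3 * x) mod 8 = (3::nat)"
  "x mod 16 = 1 \<Longrightarrow> (9 * x - 1) mod 16 = (8::nat)"
proof -
  show "(x + 1) mod 4 = 2" "(3 * x) mod 8 = 3" if "x mod 8 = 1"
  proof -
    obtain q where q: "x = 8 * q + 1" by (rule mod_eqE[OF \<open>x mod 8 = 1\<close>], rule that)
    show "(x + 1) mod 4 = 2" by (rule mod_eqI[of _ _ _ "2 * q"]) (simp_all add: q)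
    show "(3 * x) mod 8 = 3" by (rule mod_eqI[of _ _ _ "3 * q"]) (simp_all add: q)
  qed
  show "(x - 1) mod 4 = 2" "(x + 1) mod 8 = 4" if "x mod 8 = 3"
  proof -
    obtain q where q: "x = 8 * q + 3" by (rule mod_eqE[OF \<open>x mod 8 = 3\<close>], rule that)
    show "(x - 1) mod 4 = 2" by (rule mod_eqI[of _ _ _ "2 * q"]) (simp_all add: q)
    show "(x + 1) mod 8 = 4" by (rule mod_eqI[of _ _ _ q]) (simp_all add: q)
  qed
  show "(9 * x - 1) mod 16 = 8" if "x mod 16 = 1"
  proof -
    obtain q where q: "x = 16 * q + 1" by (rule mod_eqE[OF \<open>x mod 16 = 1\<close>], rule that)
    show ?thesis by (rule mod_eqI[of _ _ _ "9 * q"]) (simp_all add: q)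
  qed
qed

lemma square_minus_one: "(x::nat) * x - 1 = (x - 1) * (x + 1)"
  by (cases x) simp_all

lemma nine_power_minus_one: "(9::nat) ^ k - 1 = (3 ^ k - 1) * (3 ^ k + 1)"
proof -
  have "(9::nat) ^ k = 3 ^ k * 3 ^ k" by (simp flip: power_mult_distrib)
  then show ?thesis by (simp only: square_minus_one)
qed

lemma nine_power_mod: "(9::nat) ^ k mod 8 = 1"
  by (induction k) (simp_all add: mod_mult_right_eq[symmetric])

lemma multiplicity_nine_power_plus: "multiplicity 2 ((9::nat) ^ k + 1) = 1"
  using mod_arith(1)[OF nine_power_mod[of k]] by (intro multiplicity_two_eqI) simp

lemma multiplicity_three_odd:
  assumes "odd k"
  shows "multiplicity 2 ((3::nat) ^ k - 1) = 1" "multiplicity 2 ((3::nat) ^ k + 1) = 2"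
proof -
  obtain i where k: "k = 2 * i + 1" using assms oddE by blast
  have e: "(3::nat) ^ k = 3 * 9 ^ i" by (simp add: k power_mult)
  have "(3::nat) ^ k mod 8 = 3" unfolding e by (rule mod_arith(4)[OF nine_power_mod])
  from mod_arith(2,3)[OF this]
  show "multiplicity 2 ((3::nat) ^ k - 1) = 1" "multiplicity 2 ((3::nat) ^ k + 1) = 2"
    by (intro multiplicity_two_eqI; simp)+
qed

lemma multiplicity_mult_nat:
  "a > 0 \<Longrightarrow> b > 0 \<Longrightarrow> multiplicity 2 (a * b) = multiplicity 2 a + multiplicity 2 (b::nat)"
  by (intro prime_elem_multiplicity_mult_distrib) auto

lemma nine_power_minus_pos: "k > 0 \<Longrightarrow> (9::nat) ^ k - 1 > 0"
  using one_less_power[of "9::nat" k] by simp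

text \<open>Lifting the exponent: for k = 2 i the number is (9^i - 1)(9^i + 1), whose second factor
  has valuation 1; for odd k the number is 8 modulo 16.\<close>

lemma multiplicity_nine_power_minus: "k > 0 \<Longrightarrow> multiplicity 2 ((9::nat) ^ k - 1) = 3 + multiplicity 2 k"
proof (induction k rule: less_induct)
  case (less k)
  show ?case
  proof (cases "even k")
    case True
    then obtain i where i: "k = 2 * i" by blast
    have ip: "i > 0" "i < k" using i less.prems by auto
    have pos: "(9::nat) ^ i - 1 > 0" using nine_power_minus_pos[OF ip(1)] .
    have "(9::nat) ^ k - 1 = (9 ^ i - 1) * (9 ^ i + 1)"
      unfolding i mult_2 power_add by (rule square_minus_one)
    then have "multiplicity 2 ((9::nat) ^ k - 1) = 3 + multiplicity 2 i + 1"
      using multiplicity_mult_nat[OF pos, of "9 ^ i + 1"] less.IH[OF ip(2,1)] multiplicity_nine_power_plus[of i] by simp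
    moreover have "multiplicity 2 k = 1 + multiplicity 2 i"
      unfolding i using multiplicity_mult_nat[of 2 i] ip by simp
    ultimately show ?thesis by simp
  next
    case False
    then obtain i where i: "k = 2 * i + 1" using oddE by blast
    have "(81::nat) ^ i mod 16 = 1" by (induction i) (simp_all add: mod_mult_right_eq[symmetric])
    moreover have "(9::nat) ^ k = 9 * 81 ^ i" by (simp add: i power_mult)
    ultimately have "((9::nat) ^ k - 1) mod 16 = 8" using mod_arith(5)[of "81 ^ i"] by simp
    then have "multiplicity 2 ((9::nat) ^ k - 1) = 3" by (intro multiplicity_two_eqI) simp
    then show ?thesis using False by (simp add: not_dvd_imp_multiplicity_0)
  qed
qed

lemma two_power_multiplicity_le: "k > 0 \<Longrightarrow> 2 ^ multiplicity 2 k \<le> (k::nat)"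
  using multiplicity_dvd[of 2 k] by (intro dvd_imp_le) auto

text \<open>The factor 8 on the left cancels the summand 3 in the valuation of 9^(m-1) - 1.\<close>

lemma mult_three_factors:
  fixes L x y m :: nat
  assumes "8 * L = (9 ^ (m - 1) - 1) * (x * y)" "m \<ge> 2" "x > 0" "y > (0::nat)"
  shows "multiplicity 2 L = multiplicity 2 (m - 1) + multiplicity 2 x + multiplicity 2 y"
proof -
  have pos: "(9::nat) ^ (m - 1) - 1 > 0" using assms(2) by (intro nine_power_minus_pos) simp
  have "L > 0" using assms pos by (metis mult_is_0 neq0_conv)
  have "multiplicity 2 (8::nat) = 3" by (rule multiplicity_two_eqI) simp
  then have "multiplicity 2 (8 * L) = 3 + multiplicity 2 L"
    using multiplicity_mult_nat[of 8 L] \<open>L > 0\<close> by simp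
  moreover have "multiplicity 2 ((9 ^ (m - 1) - 1) * (x * y)) = 3 + multiplicity 2 (m - 1) + (multiplicity 2 x + multiplicity 2 y)"
    using assms pos multiplicity_mult_nat[OF pos, of "x * y"] multiplicity_mult_nat[of x y]
      multiplicity_nine_power_minus[of "m - 1"] by simp
  ultimately show ?thesis using assms(1) by simp
qed

lemma eight_times_less:
  assumes "m \<ge> 4" shows "8 * m < 3 ^ (2 * m - 4)"
  using assms
proof (induction m rule: nat_induct_at_least)
  case (Suc m)
  have "8 * Suc m < 9 * (8 * m)" using Suc.hyps by simp
  also have "\<dots> < 9 * 3 ^ (2 * m - 4)" using Suc.IH by simp
  also have "\<dots> = 3 ^ Suc (Suc (2 * m - 4))" by simp
  also have "Suc (Suc (2 * m - 4)) = 2 * Suc m - 4" using Suc.hyps by simp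
  finally show ?case .
qed simp

lemma four_times_less:
  assumes "m \<ge> 4" shows "4 * m < (3::nat) ^ (m - 1)"
  using assms
proof (induction m rule: nat_induct_at_least)
  case (Suc m)
  have "4 * Suc m < 3 * (4 * m)" using Suc.hyps by simp
  also have "\<dots> < 3 * 3 ^ (m - 1)" using Suc.IH by simp
  also have "\<dots> = 3 ^ Suc (m - 1)" by simp
  also have "Suc (m - 1) = Suc m - 1" using Suc.hyps by simp
  finally show ?case .
qed simp

lemma bound_from_multiplicity:
  assumes "multiplicity 2 L \<le> 3 + multiplicity 2 k" "0 < k" "k \<le> m"
  shows "2 ^ multiplicity 2 (L::nat) \<le> 8 * (m::nat)"
proof -
  have "(2::nat) ^ multiplicity 2 L \<le> 2 ^ (3 + multiplicity 2 k)" using assms by (intro power_increasing) auto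
  also have "\<dots> \<le> 8 * k" using two_power_multiplicity_le[OF assms(2)] by (simp add: power_add)
  finally show ?thesis using assms(3) by linarith
qed

text \<open>The valuation of L is 3 plus those of m and m - 1. One of these consecutive numbers is
  odd, so the 2-part of L is at most 8 m.\<close>

lemma odd_bound:
  fixes L m :: nat
  assumes "8 * L = (9 ^ m - 1) * (9 ^ (m - 1) - 1)" "m \<ge> 3"
  shows "2 ^ multiplicity 2 L < (3::nat) ^ (2 * m + 1 - 4)"
proof -
  have pos: "(9::nat) ^ m - 1 > 0" using assms(2) by (intro nine_power_minus_pos) simp
  have "multiplicity 2 L = multiplicity 2 (m - 1) + multiplicity 2 ((9::nat) ^ m - 1) + multiplicity 2 (1::nat)"
    using assms pos by (intro mult_three_factors) auto
  then have e: "multiplicity 2 L = multiplicity 2 (m - 1) + (3 + multiplicity 2 m)"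
    using multiplicity_nine_power_minus[of m] assms by simp
  have "2 ^ multiplicity 2 L \<le> 8 * m"
  proof (cases "even m")
    case True
    then have "odd (m - 1)" using assms by simp
    then have "multiplicity 2 (m - 1) = 0" by (rule not_dvd_imp_multiplicity_0)
    then show ?thesis using e assms by (intro bound_from_multiplicity[of _ m]) auto
  next
    case False
    then have "multiplicity 2 m = 0" by (rule not_dvd_imp_multiplicity_0)
    then show ?thesis using e assms by (intro bound_from_multiplicity[of _ "m - 1"]) auto
  qed
  also have "8 * m < 3 ^ (2 * m + 1 - 4)"
  \<comment> \<open>For m = 3 the inequality is 24 < 27, outside the range of
    \<open>eight_times_less\<close>.\<close>
  proof (cases "m = 3")
    case False
    then have "8 * m < 3 ^ (2 * m - 4)" using assms by (intro eight_times_less) simp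
    also have "(3::nat) ^ (2 * m - 4) \<le> 3 ^ (2 * m + 1 - 4)" by (intro power_increasing) auto
    finally show ?thesis .
  qed simp
  finally show ?thesis .
qed

text \<open>Two factors combine to 9^(m-1) - 1. For even m the valuation of L is 3 plus that of m,
  coming from 3^m - 1 and 3^(m-2) + 1; for odd m it is 3 plus that of m - 1.\<close>

lemma plus_bound:
  fixes L m :: nat
  assumes "8 * L = ((3 ^ m - 1) * (3 ^ (m - 1) + 1)) * ((3 ^ (m - 1) - 1) * (3 ^ (m - 2) + 1))" "m \<ge> 4"
  shows "2 ^ multiplicity 2 L < (3::nat) ^ (2 * m - 4)"
proof -
  have "8 * L = (9 ^ (m - 1) - 1) * ((3 ^ m - 1) * (3 ^ (m - 2) + 1))" using assms(1) by (simp only: mult_ac nine_power_minus_one)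
  then have e: "multiplicity 2 L = multiplicity 2 (m - 1) + multiplicity 2 ((3::nat) ^ m - 1) + multiplicity 2 ((3::nat) ^ (m - 2) + 1)"
    using assms(2) one_less_power[of "3::nat" m] by (intro mult_three_factors) auto
  have "2 ^ multiplicity 2 L \<le> 8 * m"
  proof (cases "even m")
    case True
    then obtain i where i: "m = 2 * i" by blast
    have "odd (m - 1)" using True assms by simp
    then have "multiplicity 2 (m - 1) = 0" by (rule not_dvd_imp_multiplicity_0)
    moreover have "multiplicity 2 ((3::nat) ^ m - 1) = 3 + multiplicity 2 i"
      using multiplicity_nine_power_minus[of i] assms i by (simp add: power_mult)
    moreover have "(3::nat) ^ (m - 2) = 9 ^ (i - 1)" proof -
      have "m - 2 = 2 * (i - 1)" using i by simp
      then show ?thesis by (simp add: power_mult)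
    qed
    then have "multiplicity 2 ((3::nat) ^ (m - 2) + 1) = 1" using multiplicity_nine_power_plus by simp
    moreover have "multiplicity 2 m = 1 + multiplicity 2 i"
      unfolding i using multiplicity_mult_nat[of 2 i] i assms by simp
    ultimately show ?thesis using e assms by (intro bound_from_multiplicity[of _ m]) auto
  next
    case False
    then have "multiplicity 2 ((3::nat) ^ m - 1) = 1" "multiplicity 2 ((3::nat) ^ (m - 2) + 1) = 2"
      using multiplicity_three_odd assms by auto
    then show ?thesis using e assms by (intro bound_from_multiplicity[of _ "m - 1"]) auto
  qed
  also have "8 * m < 3 ^ (2 * m - 4)" by (rule eight_times_less[OF assms(2)])
  finally show ?thesis .
qed

text \<open>As for the plus type, except that for even m the large power of 2 sits in 3^(m-2) - 1,
  so that m - 2 takes the place of m.\<close>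

lemma minus_bound:
  fixes L m :: nat
  assumes "8 * L = ((3 ^ m + 1) * (3 ^ (m - 1) - 1)) * ((3 ^ (m - 1) + 1) * (3 ^ (m - 2) - 1))" "m \<ge> 4"
  shows "2 ^ multiplicity 2 L < (3::nat) ^ (2 * m - 4)"
proof -
  have "8 * L = (9 ^ (m - 1) - 1) * ((3 ^ m + 1) * (3 ^ (m - 2) - 1))" using assms(1) by (simp only: mult_ac nine_power_minus_one)
  then have e: "multiplicity 2 L = multiplicity 2 (m - 1) + multiplicity 2 ((3::nat) ^ m + 1) + multiplicity 2 ((3::nat) ^ (m - 2) - 1)"
    using assms(2) one_less_power[of "3::nat" "m - 2"] by (intro mult_three_factors) auto
  have "2 ^ multiplicity 2 L \<le> 8 * m"
  proof (cases "even m")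
    case True
    then obtain i where i: "m = 2 * i" by blast
    have "odd (m - 1)" using True assms by simp
    then have "multiplicity 2 (m - 1) = 0" by (rule not_dvd_imp_multiplicity_0)
    moreover have "(3::nat) ^ (m - 2) = 9 ^ (i - 1)" proof -
      have "m - 2 = 2 * (i - 1)" using i by simp
      then show ?thesis by (simp add: power_mult)
    qed
    then have "multiplicity 2 ((3::nat) ^ (m - 2) - 1) = 3 + multiplicity 2 (i - 1)"
      using multiplicity_nine_power_minus[of "i - 1"] assms i by simp
    moreover have "multiplicity 2 ((3::nat) ^ m + 1) = 1" using multiplicity_nine_power_plus[of i] by (simp add: i power_mult)
    moreover have "multiplicity 2 (m - 2) = 1 + multiplicity 2 (i - 1)"
    proof -
      have "m - 2 = 2 * (i - 1)" "i - 1 > 0" using i assms(2) by auto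
      then show ?thesis using multiplicity_mult_nat[of 2 "i - 1"] by simp
    qed
    ultimately show ?thesis using e assms by (intro bound_from_multiplicity[of _ "m - 2"]) auto
  next
    case False
    then have "multiplicity 2 ((3::nat) ^ m + 1) = 2" "multiplicity 2 ((3::nat) ^ (m - 2) - 1) = 1"
      using multiplicity_three_odd assms by auto
    then show ?thesis using e assms by (intro bound_from_multiplicity[of _ "m - 1"]) auto
  qed
  also have "8 * m < 3 ^ (2 * m - 4)" by (rule eight_times_less[OF assms(2)])
  finally show ?thesis .
qed

lemma symplectic_bound:
  fixes L m :: nat
  assumes "2 * L = 9 ^ m - 1" "m \<ge> 3"
  shows "2 ^ multiplicity 2 L < (3::nat) ^ (m - 1)"
proof -
  have "(9::nat) ^ m - 1 > 0" using assms(2) by (intro nine_power_minus_pos) simp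
  then have "L > 0" using assms by simp
  then have "multiplicity 2 (2 * L) = 1 + multiplicity 2 L" using multiplicity_mult_nat[of 2 L] by simp
  then have e: "multiplicity 2 L = 2 + multiplicity 2 m" using multiplicity_nine_power_minus[of m] assms by simp
  show ?thesis
  \<comment> \<open>For m = 3 the estimate 4 m = 12 is too weak against 3^2, but the exact 2-part is
    4.\<close>
  proof (cases "m = 3")
    case True
    have "multiplicity 2 (3::nat) = 0" by (rule not_dvd_imp_multiplicity_0) simp
    then show ?thesis using e True by simp
  next
    case False
    have "2 ^ multiplicity 2 L \<le> 4 * m" using e two_power_multiplicity_le[of m] assms by (simp add: power_add)
    also have "4 * m < 3 ^ (m - 1)" using False assms by (intro four_times_less) simp
    finally show ?thesis .
  qed
qed

section \<open>The standard forms\<close>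

text \<open>A Gram matrix with one nonzero entry per row, placed by an involution, covers all the
  forms of the theorem: two-cycles give hyperbolic planes, fixed points give diagonal
  entries.\<close>

locale pairing_form =
  fixes n :: nat and \<sigma> :: "nat \<Rightarrow> nat" and c :: "nat \<Rightarrow> 3" and \<epsilon> :: 3
  assumes sw: "\<And>i. i < n \<Longrightarrow> \<sigma> i < n \<and> \<sigma> (\<sigma> i) = i" and c: "\<And>i. i < n \<Longrightarrow> c i \<noteq> 0"
    and c_sw: "\<And>i. i < n \<Longrightarrow> c (\<sigma> i) = \<epsilon> * c i" and e: "\<epsilon> = 1 \<or> \<epsilon> = -1"
begin

definition S where "S = mat n n (\<lambda>(i,j). if j = \<sigma> i then c i else 0)"

lemma col_sum: "j < n \<Longrightarrow> (\<Sum>i<n. x i * S $$ (i,j)) = x (\<sigma> j) * c (\<sigma> j)"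
proof -
  assume j: "j < n"
  have "(\<Sum>i<n. x i * S $$ (i,j)) = (\<Sum>i<n. if i = \<sigma> j then x (\<sigma> j) * c (\<sigma> j) else 0)"
    by (intro sum.cong refl) (use j sw in \<open>auto simp: S_def\<close>)
  then show ?thesis using sw[OF j] by simp
qed

sublocale form n S \<epsilon>
proof
  show "S \<in> carrier_mat n n" by (simp add: S_def)
  show "\<epsilon> = 1 \<or> \<epsilon> = -1" by (rule e)
  show "S $$ (j,i) = \<epsilon> * S $$ (i,j)" if "i < n" "j < n" for i j
    using that sw[OF that(1)] sw[OF that(2)] c_sw[OF that(1)] by (auto simp: S_def)
  fix x :: F3vec assume x: "x \<in> vecs n" and z: "\<And>j. j < n \<Longrightarrow> (\<Sum>i<n. x i * S $$ (i,j)) = 0"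
  have "x l = 0" for l
  proof (cases "l < n")
    case True
    then have "x l * c l = 0" using z[of "\<sigma> l"] col_sum[of "\<sigma> l" x] sw[OF True] by simp
    then show ?thesis using c[OF True] F3_cases[of "c l"] by auto
  qed (use x in \<open>simp add: vecs_def\<close>)
  then show "x = 0" by (simp add: fvec)
qed

lemma B_unit: "j < n \<Longrightarrow> B x (unit j) = x (\<sigma> j) * c (\<sigma> j)"
  by (simp add: B_unit_right col_sum)

lemma B_eq: "B x y = (\<Sum>i<n. x i * c i * y (\<sigma> i))"
proof -
  have "(\<Sum>j<n. x i * S $$ (i,j) * y j) = x i * c i * y (\<sigma> i)" if i: "i < n" for i
  proof -
    have "(\<Sum>j<n. x i * S $$ (i,j) * y j) = (\<Sum>j<n. if j = \<sigma> i then x i * c i * y (\<sigma> i) else 0)"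
      by (intro sum.cong refl) (use i in \<open>auto simp: S_def\<close>)
    then show ?thesis using sw[OF i] by simp
  qed
  then show ?thesis by (simp add: B_def)
qed

end

lemma unit_apply: "unit j i = (if i = j then 1 else 0)"
  by (simp add: unit_def)

definition swap_halves :: "nat \<Rightarrow> nat \<Rightarrow> nat" where
  "swap_halves k i = (if i < k then i + k else if i < 2 * k then i - k else i)"

text \<open>k hyperbolic planes plus a sum of n - 2k squares, since \<open>swap_halves\<close> fixes
  the indices from 2k on. No, one or two squares give the plus, odd and minus types.\<close>

definition hyp_form :: "nat \<Rightarrow> nat \<Rightarrow> 3 mat" where
  "hyp_form k n = mat n n (\<lambda>(i,j). if j = swap_halves k i then 1 else 0)"

lemma form_hyp_form: "2 * k \<le> n \<Longrightarrow> pairing_form n (swap_halves k) (\<lambda>i. 1) 1"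
  by unfold_locales (auto simp: swap_halves_def)

context
  fixes k r n :: nat and H
  assumes n: "n = 2 * k + r" and r: "r \<le> 2" and k: "k \<ge> 2"
    and H: "subgroup H (isom_group n (hyp_form k n))"
      "derived (isom_group n (hyp_form k n)) (carrier (isom_group n (hyp_form k n))) \<subseteq> H"
begin

interpretation pairing_form n "swap_halves k" "\<lambda>i. 1" 1
  using form_hyp_form n by simp

lemma S_eq: "S = hyp_form k n"
  by (simp add: S_def hyp_form_def)

interpretation orthogonal_sub n S 1 H
  by (intro orthogonal_sub.intro form_sub.intro form_sub_axioms.intro orthogonal_sub_axioms.intro form_axioms)
    (use H in \<open>simp_all add: S_eq\<close>)

lemma index_less: "i < k \<Longrightarrow> i < n" "i < k \<Longrightarrow> i + k < n"
  using n by auto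

text \<open>The complement of the k hyperbolic planes carries a sum of r squares. It is anisotropic
  because r \<le> 2 and nonzero squares are 1, so that a vanishing sum of them needs three.\<close>

lemma hyp_form_zeros:
  "3 * card (zeros V) + 3 ^ r * 3 ^ k = 3 ^ (k + 1) + 3 ^ r * 3 ^ (2 * k)"
proof -
  let ?e = "\<lambda>i. unit i" and ?f = "\<lambda>i. unit (i + k)"
  let ?R = "hyp_perp ?e ?f k"
  have R: "?R = {x \<in> V. \<forall>i<2 * k. x i = 0}"
  proof -
    have "(\<forall>i<k. x (i + k) = 0 \<and> x i = 0) \<longleftrightarrow> (\<forall>i<2 * k. x i = (0::3))" for x
    proof
      assume a: "\<forall>i<k. x (i + k) = 0 \<and> x i = 0"
      show "\<forall>i<2 * k. x i = 0"
      proof (intro allI impI)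
        fix i assume "i < 2 * k"
        then show "x i = 0" using a spec[OF a, of "i - k"] by (cases "i < k") auto
      qed
    qed auto
    then show ?thesis
      unfolding hyp_perp_def by (auto simp: B_unit swap_halves_def index_less)
  qed
  have B_R: "B x x = (\<Sum>i\<in>{2 * k..<n}. x i * x i)" if "x \<in> ?R" for x
  proof -
    have "B x x = (\<Sum>i\<in>{..<n}. x i * x (swap_halves k i))" by (simp add: B_eq)
    also have "\<dots> = (\<Sum>i\<in>{2 * k..<n}. x i * x i)"
      by (rule sum.mono_neutral_cong_right) (use that R in \<open>auto simp: swap_halves_def\<close>)
    finally show ?thesis .
  qed
  have "x = 0" if x: "x \<in> ?R" "B x x = 0" for x
  proof -
    have s: "(\<Sum>i\<in>{2 * k..<n}. x i * x i) = 0" using B_R[OF x(1)] x(2) by simp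
    have "x i = 0" if i: "2 * k \<le> i" "i < n" for i
    proof -
      consider "r = 1" | "r = 2" using i n r by linarith
      then show ?thesis
      proof cases
        case 1
        then have "i = 2 * k" "{2 * k..<n} = {2 * k}" using n i by auto
        then show ?thesis using s F3_square[of "x i"] by auto
      next
        case 2
        then have "{2 * k..<n} = {2 * k, 2 * k + 1}" and "i = 2 * k \<or> i = 2 * k + 1" using n i by auto
        then show ?thesis using s F3_cases[of "x (2 * k)"] F3_cases[of "x (2 * k + 1)"] by auto
      qed
    qed
    moreover have "x i = 0" if "i < 2 * k \<or> n \<le> i" for i
      using x(1) that unfolding R by (auto simp: vecs_def)
    ultimately show "x = 0" by (simp add: fvec) (meson not_le)
  qed
  then have "zeros ?R = {0}" by (auto simp: zeros_def hyp_perp_def)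
  then have aniso: "card (zeros ?R) = 1" by simp
  have hyp: "?e i \<in> V \<and> ?f i \<in> V \<and> B (?e i) (?e i) = 0 \<and> B (?f i) (?f i) = 0 \<and> B (?e i) (?f i) = 1" if "i < k" for i
    using that k by (simp add: B_unit swap_halves_def unit_apply index_less)
  have orth: "B (?e i) (?e l) = 0 \<and> B (?e i) (?f l) = 0 \<and> B (?f i) (?e l) = 0 \<and> B (?f i) (?f l) = 0"
    if "i < k" "l < k" "i \<noteq> l" for i l
    using that by (simp add: B_unit swap_halves_def unit_apply index_less)
  note w = witt_count[OF hyp orth aniso]
  have "9 ^ k * (3::nat) ^ r = 9 ^ k * card ?R"
    using w(2) card_vecs[of n] unfolding n by (simp add: power_add power_mult)
  then have "card ?R = 3 ^ r" by simp
  then show ?thesis using w(1) by simp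
qed

lemma hyp_form_obstruction:
  assumes Z: "card (zeros V) = 3 * z + 2 * 3 ^ (n - 2)"
    and bound: "\<And>L. 8 * L = (card (zeros V) - 1) * (z - 1) \<Longrightarrow> 2 ^ multiplicity 2 L < (3::nat) ^ (n - 4)"
    and n4: "n > 4"
  shows "\<exists>t s A. heisenberg_obstruction (isom_group n (hyp_form k n)\<lparr>carrier := H\<rparr>) t s A"
proof -
  have "pair (unit 0) (unit 1)"
  proof -
    have "unit 1 \<noteq> scal c (unit 0)" for c
    proof
      assume "unit 1 = scal c (unit 0)"
      from fun_cong[OF this, of 1] show False by (simp add: unit_apply scal_apply)
    qed
    moreover have "unit 0 \<noteq> 0"
    proof
      assume "unit 0 = 0"
      from fun_cong[OF this, of 0] show False by (simp add: unit_apply zero_fun_apply)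
    qed
    ultimately show ?thesis
      using k index_less(1)[of 0] index_less(1)[of 1]
      by (simp add: pair_def B_unit swap_halves_def unit_apply)
  qed
  then have "long_roots \<noteq> {}" by (auto simp: long_roots_def)
  from orthogonal_obstruction[OF n4 this bound] card_long_roots[OF Z] n4
  show ?thesis by (simp add: S_eq)
qed

text \<open>The number z is the count of singular vectors with one hyperbolic plane fewer. In even
  dimension both counts are polynomials in a power a of 3, and subtracting 1 makes each of them
  split into two linear factors; writing a = b + 1 removes the truncated subtractions from these
  identities.\<close>

lemma hyp_form_obstruction_cases:
  assumes "(r = 1 \<and> k \<ge> 3) \<or> (r = 0 \<and> k \<ge> 4) \<or> (r = 2 \<and> k \<ge> 3)"
  shows "\<exists>t s A. heisenberg_obstruction (isom_group n (hyp_form k n)\<lparr>carrier := H\<rparr>) t s A"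
proof -
  note Z = hyp_form_zeros
  consider "r = 1" "k \<ge> 3" | "r = 0" "k \<ge> 4" | "r = 2" "k \<ge> 3" using assms by blast
  then show ?thesis
  proof cases
    case 1
    have Zv: "card (zeros V) = 9 ^ k" using Z 1 by (simp add: power_mult)
    have k1: "2 * (k - 1) = 2 * k - 2" "Suc (2 * k - 2) = n - 2" using 1 n by auto
    have "(9::nat) ^ k = 9 * 9 ^ (k - 1)" using 1 by (cases k) auto
    moreover have "(3::nat) ^ (n - 2) = 3 * 9 ^ (k - 1)"
      unfolding k1(2)[symmetric] k1(1)[symmetric] by (simp add: power_mult)
    ultimately have "card (zeros V) = 3 * 9 ^ (k - 1) + 2 * 3 ^ (n - 2)" using Zv by simp
    then show ?thesis
    proof (rule hyp_form_obstruction)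
      fix L assume "8 * L = (card (zeros V) - 1) * (9 ^ (k - 1) - 1)"
      then show "2 ^ multiplicity 2 L < (3::nat) ^ (n - 4)"
        using odd_bound[of L k] 1 Zv n by simp
    qed (use n 1 in simp)
  next
    case 2
    define a where "a = (3::nat) ^ (k - 2)"
    obtain d where "k = 2 + d" using k le_Suc_ex by blast
    then have p: "(3::nat) ^ k = 9 * a" "(3::nat) ^ (k - 1) = 3 * a" by (simp_all add: a_def power_add)
    have sq: "(3::nat) ^ (2 * k) = 81 * (a * a)"
      using p(1) by (simp add: mult_2 power_add)
    have "n - 2 = (k - 1) + (k - 1)" using 2 n by simp
    then have "(3::nat) ^ (n - 2) = 3 ^ (k - 1) * 3 ^ (k - 1)" by (simp only: power_add)
    then have n2: "(3::nat) ^ (n - 2) = 9 * (a * a)" unfolding p(2) by simp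
    have Zv: "card (zeros V) = 27 * (a * a) + 6 * a" using Z 2 p(1) sq by simp
    have "card (zeros V) = 3 * (3 * (a * a) + 2 * a) + 2 * 3 ^ (n - 2)" using Zv n2 by simp
    then show ?thesis
    proof (rule hyp_form_obstruction)
      fix L assume L: "8 * L = (card (zeros V) - 1) * (3 * (a * a) + 2 * a - 1)"
      have "a > 0" by (simp add: a_def)
      then obtain b where b: "a = Suc b" by (cases a) auto
      have f: "27 * (a * a) + 6 * a - 1 = (9 * a - 1) * (3 * a + 1)" "3 * (a * a) + 2 * a - 1 = (3 * a - 1) * (a + 1)"
        unfolding b by (simp_all add: algebra_simps)
      have "8 * L = ((3 ^ k - 1) * (3 ^ (k - 1) + 1)) * ((3 ^ (k - 1) - 1) * (3 ^ (k - 2) + 1))"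
        using L unfolding Zv f p a_def[symmetric] .
      from plus_bound[OF this] show "2 ^ multiplicity 2 L < (3::nat) ^ (n - 4)" using 2 n by simp
    qed (use n 2 in simp)
  next
    case 3
    define m where "m = Suc k"
    have nm: "n = 2 * m" using 3 n by (simp add: m_def)
    define a where "a = (3::nat) ^ (m - 2)"
    obtain d where "k = 1 + d" using 3 le_Suc_ex[of 1 k] by auto
    then have p: "(3::nat) ^ k = 3 * a" "(3::nat) ^ m = 9 * a" "(3::nat) ^ (m - 1) = 3 * a"
      by (simp_all add: a_def m_def power_add)
    have sq: "(3::nat) ^ (2 * k) = 9 * (a * a)"
      using p(1) by (simp add: mult_2 power_add)
    have "n - 2 = k + k" using 3 n by simp
    then have "(3::nat) ^ (n - 2) = 3 ^ k * 3 ^ k" by (simp only: power_add)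
    then have n2: "(3::nat) ^ (n - 2) = 9 * (a * a)" unfolding p(1) by simp
    have "a > 0" by (simp add: a_def)
    then obtain b where b: "a = Suc b" by (cases a) auto
    have Zv: "card (zeros V) + 6 * a = 27 * (a * a)" using Z 3 p(1) sq by simp
    define q where "q = 3 * (a * a) - 2 * a"
    have "q + 2 * a = 3 * (a * a)" unfolding q_def b by simp
    then have "card (zeros V) = 3 * q + 2 * 3 ^ (n - 2)" using Zv unfolding n2 by linarith
    then show ?thesis
    proof (rule hyp_form_obstruction)
      fix L assume L: "8 * L = (card (zeros V) - 1) * (q - 1)"
      have Zv': "card (zeros V) = 27 * (a * a) - 6 * a" using Zv by simp
      have f: "27 * (a * a) - 6 * a - 1 = (9 * a + 1) * (3 * a - 1)" "3 * (a * a) - 2 * a - 1 = (3 * a + 1) * (a - 1)"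
        unfolding b by (simp_all add: algebra_simps)
      have "8 * L = ((3 ^ m + 1) * (3 ^ (m - 1) - 1)) * ((3 ^ (m - 1) + 1) * (3 ^ (m - 2) - 1))"
        using L unfolding Zv' q_def f p a_def[symmetric] .
      from minus_bound[OF this] show "2 ^ multiplicity 2 L < (3::nat) ^ (n - 4)" using 3 nm by (simp add: m_def)
    qed (use n 3 in simp)
  qed
qed

end

context symplectic_sub
begin

text \<open>The transvection of u is quadratic in u, so u and -u give the same one. Conversely its
  value at a vector u' with B u u' = 1 determines u up to sign.\<close>

lemma card_transvections: "2 * card ((\<lambda>u. E u u) ` (V - {0})) = 3 ^ n - 1"
proof -
  let ?f = "\<lambda>u. E u u"
  have fin: "finite (V - {0})" using finite_vecs by simp
  have fibre: "card {v \<in> V - {0}. ?f v = ?f u} = 2" if u: "u \<in> V" "u \<noteq> 0" for u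
  proof -
    obtain u' where u': "u' \<in> V" "B u u' = 1" using exists_dual u by blast
    have u'u: "B u' u = -1" using B_anti[of u' u] u' by simp
    have "v = u \<or> v = scal (-1) u" if v: "v \<in> V" "?f v = ?f u" for v
    proof -
      have "psi v v u' = psi u u u'" using act_E[OF v(1,1) u'(1)] act_E[OF u(1,1) u'(1)] v(2) by simp
      then have e: "u = scal (- B u' v) v" using u'u by (simp add: psi_self fvec)
      then have "B u' v \<noteq> 0" using u(2) by auto
      then have "B u' v = 1 \<or> B u' v = -1" using F3_cases by blast
      then show ?thesis
      proof
        assume "B u' v = 1"
        then have "u = scal (-1) v" using e by simp
        then show ?thesis by simp
      qed (use e in simp)
    qed
    moreover have "?f (scal (-1) u) = ?f u"
      by (rule mat_eq_by_act[OF E_mat E_mat]) (use u in \<open>simp add: act_E psi_self\<close>)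
    moreover have "scal (-1) u \<noteq> 0"
    proof
      assume "scal (-1) u = 0"
      then have "B (scal (-1) u) u' = 0" by simp
      then show False using u' by simp
    qed
    ultimately have "{v \<in> V - {0}. ?f v = ?f u} = {u, scal (-1) u}" using u by auto
    moreover have "u \<noteq> scal (-1) u"
    proof
      assume "u = scal (-1) u"
      then have "B u u' = - B u u'" by (metis B_scal(1) mult_minus1)
      then show False using u' by simp
    qed
    ultimately show ?thesis by simp
  qed
  have "card (V - {0}) = (\<Sum>t\<in>?f ` (V - {0}). card {v \<in> V - {0}. ?f v = t})"
    using sum.image_gen[OF fin, of "\<lambda>_. 1::nat" ?f] by simp
  also have "\<dots> = (\<Sum>t\<in>?f ` (V - {0}). 2)" by (intro sum.cong refl) (use fibre in auto)
  finally show ?thesis using finite_vecs by (simp add: card_Diff_singleton card_vecs mult.commute)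
qed

end

definition sp_form :: "nat \<Rightarrow> 3 mat" where
  "sp_form m = mat (2 * m) (2 * m) (\<lambda>(i,j). if j = swap_halves m i then if i < m then 1 else -1 else 0)"

lemma sp_obstruction:
  assumes m: "m \<ge> 3" and H: "subgroup H (isom_group (2 * m) (sp_form m))"
      "derived (isom_group (2 * m) (sp_form m)) (carrier (isom_group (2 * m) (sp_form m))) \<subseteq> H"
  shows "\<exists>t s A. heisenberg_obstruction (isom_group (2 * m) (sp_form m)\<lparr>carrier := H\<rparr>) t s A"
proof -
  interpret pairing_form "2 * m" "swap_halves m" "\<lambda>i. if i < m then 1 else -1" "-1"
    by unfold_locales (auto simp: swap_halves_def)
  have S_eq: "S = sp_form m" by (simp add: S_def sp_form_def)
  interpret symplectic_sub "2 * m" S "-1" H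
    by (intro symplectic_sub.intro form_sub.intro form_sub_axioms.intro symplectic_sub_axioms.intro form_axioms)
      (use H in \<open>simp_all add: S_eq\<close>)
  have "2 * card ((\<lambda>u. E u u) ` (V - {0})) = 9 ^ m - 1"
    using card_transvections by (simp add: power_mult)
  from symplectic_bound[OF this m] have "\<exists>t s A. heisenberg_obstruction K t s A"
    using m by (intro symplectic_obstruction[of m]) auto
  then show ?thesis by (simp add: S_eq)
qed

section \<open>The four families of the theorem as isometry groups of these forms\<close>

lemma GO_odd_eq: "GO_odd m = isom_group (2 * m + 1) (hyp_form m (2 * m + 1))"
  unfolding GO_odd_def hyp_form_def
  by (rule arg_cong[of _ _ "isom_group _"], rule eq_matI) (auto simp: hyp_def swap_halves_def)

lemma GO_plus_eq: "GO_plus m = isom_group (2 * m) (hyp_form m (2 * m))"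
  unfolding GO_plus_def hyp_form_def
  by (rule arg_cong[of _ _ "isom_group _"], rule eq_matI) (auto simp: hyp_def swap_halves_def)

lemma GO_minus_eq: "m \<ge> 1 \<Longrightarrow> GO_minus m = isom_group (2 * m) (hyp_form (m - 1) (2 * m))"
  unfolding GO_minus_def hyp_form_def
  by (rule arg_cong[of _ _ "isom_group _"], rule eq_matI) (auto simp: hyp_def swap_halves_def)

lemma Sp_eq: "Sp m = isom_group (2 * m) (sp_form m)"
  unfolding Sp_def sp_form_def
  by (rule arg_cong[of _ _ "isom_group _"], rule eq_matI) (auto simp: swap_halves_def)

theorem theorem11p24:
  fixes G :: "3 mat monoid" and H :: "3 mat set"
  assumes "(\<exists>m\<ge>3. G = GO_odd m) \<or> (\<exists>m\<ge>4. G = GO_plus m \<or> G = GO_minus m) \<or> (\<exists>m\<ge>3. G = Sp m)"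
    and "subgroup H G"
    and "derived G (carrier G) \<subseteq> H"
  shows "\<not> (\<exists>\<chi>. steinberg_like_2 (G\<lparr>carrier := H\<rparr>) \<chi>)
       \<and> \<not> (\<exists>\<chi>. steinberg_like_2 (G\<lparr>carrier := H\<rparr> Mod center (G\<lparr>carrier := H\<rparr>)) \<chi>)"
proof -
  have "\<exists>t s A. heisenberg_obstruction (G\<lparr>carrier := H\<rparr>) t s A"
    using assms(1)
  proof (elim disjE exE conjE)
    fix m assume "3 \<le> m" "G = GO_odd m"
    then show ?thesis
      using assms(2,3) hyp_form_obstruction_cases[of "2 * m + 1" m 1 H] by (simp add: GO_odd_eq)
  next
    fix m assume "4 \<le> m" "G = GO_plus m"
    then show ?thesis
      using assms(2,3) hyp_form_obstruction_cases[of "2 * m" m 0 H] by (simp add: GO_plus_eq)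
  next
    fix m assume "4 \<le> m" "G = GO_minus m"
    \<comment> \<open>For the minus type the number of hyperbolic planes is m - 1, and r =
      2.\<close>
    moreover obtain k where "m = Suc k" using \<open>4 \<le> m\<close> by (cases m) auto
    ultimately show ?thesis
      using assms(2,3) hyp_form_obstruction_cases[of "2 * Suc k" k 2 H] by (simp add: GO_minus_eq)
  next
    fix m assume "3 \<le> m" "G = Sp m"
    then show ?thesis using assms(2,3) sp_obstruction[of m H] by (simp add: Sp_eq)
  qed
  then obtain t s A where "heisenberg_obstruction (G\<lparr>carrier := H\<rparr>) t s A" by blast
  then interpret heisenberg_obstruction "G\<lparr>carrier := H\<rparr>" t s A .
  show ?thesis using no_steinberg_like no_steinberg_like_mod_center by simp
qed

end
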